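(* Let $n\ge 2$ and let $A\subseteq[n]=\{1,\dots,n\}$ with $n\in A$. For $2\le j\le n$ let $T_j=\{(i\ j): 1\le i<j\}$ (the transpositions of $S_n$ that are Jucys--Murphy elements of $S_j$), let $T_1=\emptyset$, and let $T_A=\bigcup_{j\in A}T_j$. Let $P_A$ be the $n!\times n!$ transition matrix on $S_n$ given by $$P_A(x,x\sigma)=\begin{cases}\frac1n, & \sigma=\mathrm{id},\\ \frac{n-1}{n}\cdot\frac{1}{|T_A|}, & \sigma\in T_A,\\ 0,&\text{otherwise},\end{cases}\qquad x,\sigma\in S_n.$$ For a standard Young tableau $S$ with $n$ boxes, let $S(i,j)$ denote the entry in the box in row $i$ and column $j$, and set $$\mathrm{eig}(S)=\frac1n+\frac{n-1}{n|T_A|}\sum_{(i,j):\,S(i,j)\in A}(j-i).$$ Then the eigenvalues of $P_A$ are indexed by the standard Young tableaux with $n$ boxes: the spectrum of $P_A$, counted with multiplicity, consists of the numbers $\mathrm{eig}(S)$, where each standard Young tableau $S$ of shape $\lambda\vdash n$ contributes the eigenvalue $\mathrm{eig}(S)$ with multiplicity $d_\lambda$.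
   Context: A partition $\lambda=(\lambda_1\ge\dots\ge\lambda_m>0)$ of $n$ is identified with its Young diagram (row $i$ has $\lambda_i$ boxes, rows indexed top to bottom starting at 1, columns left to right starting at 1). A standard Young tableau of shape $\lambda$ is a filling of the diagram with $1,\dots,n$, each used once, increasing along rows and down columns; $d_\lambda$ is the number of standard Young tableaux of shape $\lambda$. *)

theory Defs
  imports Complex_Main "HOL-Library.FuncSet" "HOL-Combinatorics.Permutations"
    "Jordan_Normal_Form.Char_Poly"
begin

definition jm_transpositions :: "nat \<Rightarrow> (nat \<Rightarrow> nat) set" where
  "jm_transpositions j = {Transposition.transpose i j | i. 1 \<le> i \<and> i < j}"

definition transposition_set :: "nat set \<Rightarrow> (nat \<Rightarrow> nat) set" where
  "transposition_set A = (\<Union>j\<in>A. jm_transpositions j)"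

definition step_prob :: "nat \<Rightarrow> nat set \<Rightarrow> (nat \<Rightarrow> nat) \<Rightarrow> real" where
  "step_prob n A \<sigma> =
    (if \<sigma> = id then 1 / real n
     else if \<sigma> \<in> transposition_set A
       then (real n - 1) / real n * (1 / real (card (transposition_set A)))
     else 0)"

text \<open>Permutations of \<open>{1..n}\<close> are functions fixing everything outside \<open>{1..n}\<close>. The step from
  \<open>x\<close> to \<open>y\<close> is the unique \<open>\<sigma>\<close> with \<open>y = x \<circ> \<sigma>\<close>.\<close>

definition transition_prob :: "nat \<Rightarrow> nat set \<Rightarrow> (nat \<Rightarrow> nat) \<Rightarrow> (nat \<Rightarrow> nat) \<Rightarrow> real" where
  "transition_prob n A x y = step_prob n A (inv_into UNIV x \<circ> y)"

text \<open>Matrices have rows and columns numbered by naturals, so \<open>xs\<close> lists the permutations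
  of \<open>{1..n}\<close> in the order in which they label rows and columns.\<close>

definition transition_mat :: "nat \<Rightarrow> nat set \<Rightarrow> (nat \<Rightarrow> nat) list \<Rightarrow> real mat" where
  "transition_mat n A xs =
    mat (length xs) (length xs) (\<lambda>(r, c). transition_prob n A (xs ! r) (xs ! c))"

definition partitions :: "nat \<Rightarrow> nat list set" where
  "partitions n = {lam. sorted_wrt (\<ge>) lam \<and> (\<forall>p\<in>set lam. 0 < p) \<and> sum_list lam = n}"

text \<open>Lists are indexed from 0, whereas the rows and columns of a diagram start at 1.\<close>

definition young_diagram :: "nat list \<Rightarrow> (nat \<times> nat) set" where
  "young_diagram lam = {(i, j). 1 \<le> i \<and> i \<le> length lam \<and> 1 \<le> j \<and> j \<le> lam ! (i - 1)}"

text \<open>Tableaux are extensional functions, so that distinct elements of the set below are distinct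
  fillings of the diagram.\<close>

definition standard_tableaux :: "nat list \<Rightarrow> (nat \<times> nat \<Rightarrow> nat) set" where
  "standard_tableaux lam =
    {S. S \<in> extensional (young_diagram lam) \<and>
        bij_betw S (young_diagram lam) {1..sum_list lam} \<and>
        (\<forall>i j j'. (i, j) \<in> young_diagram lam \<longrightarrow> (i, j') \<in> young_diagram lam \<longrightarrow> j < j' \<longrightarrow>
           S (i, j) < S (i, j')) \<and>
        (\<forall>i i' j. (i, j) \<in> young_diagram lam \<longrightarrow> (i', j) \<in> young_diagram lam \<longrightarrow> i < i' \<longrightarrow>
           S (i, j) < S (i', j))}"

definition num_standard_tableaux :: "nat list \<Rightarrow> nat" where
  "num_standard_tableaux lam = card (standard_tableaux lam)"

text \<open>The shape is an explicit argument because \<open>S\<close> carries no information about which boxes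
  belong to its diagram.\<close>

definition eig :: "nat \<Rightarrow> nat set \<Rightarrow> nat list \<Rightarrow> (nat \<times> nat \<Rightarrow> nat) \<Rightarrow> real" where
  "eig n A lam S =
    1 / real n + (real n - 1) / (real n * real (card (transposition_set A))) *
      (\<Sum>(i, j) \<in> {b \<in> young_diagram lam. S b \<in> A}. real j - real i)"

text \<open>Finiteness of the index sets, so that cardinalities and products over them are the
  intended ones.\<close>

lemma finite_partitions: "finite (partitions n)"
proof (rule finite_subset)
  show "partitions n \<subseteq> {lam. set lam \<subseteq> {..n} \<and> length lam \<le> n}"
  proof
    fix lam assume "lam \<in> partitions n"
    then have pos: "\<forall>p\<in>set lam. 0 < p" and sum: "sum_list lam = n"
      by (auto simp: partitions_def)
    have "length lam \<le> sum_list lam"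
      using pos by (induction lam) auto
    moreover have "set lam \<subseteq> {..n}"
      using sum member_le_sum_list by fastforce
    ultimately show "lam \<in> {lam. set lam \<subseteq> {..n} \<and> length lam \<le> n}"
      using sum by simp
  qed
  show "finite {lam. set lam \<subseteq> {..n} \<and> length lam \<le> n}"
    by (rule finite_lists_length_le) simp
qed

lemma finite_young_diagram: "finite (young_diagram lam)"
proof -
  have "young_diagram lam \<subseteq> (\<Union>i\<in>{1..length lam}. {i} \<times> {1..lam ! (i - 1)})"
    by (auto simp: young_diagram_def)
  then show ?thesis
    by (rule finite_subset) auto
qed

lemma finite_standard_tableaux: "finite (standard_tableaux lam)"
proof (rule finite_subset)
  show "standard_tableaux lam \<subseteq> young_diagram lam \<rightarrow>\<^sub>E {1..sum_list lam}"
    by (auto simp: standard_tableaux_def PiE_def dest: bij_betw_imp_funcset)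
  show "finite (young_diagram lam \<rightarrow>\<^sub>E {1..sum_list lam})"
    by (intro finite_PiE finite_young_diagram) auto
qed

end

theory Submission
  imports Defs "HOL-Library.Poly_Mapping"
begin

text \<open>
  The matrix acts on the regular representation as right multiplication by a linear combination of
  the identity and the Jucys--Murphy elements. These commute, and it suffices to find, for every pair
  \<open>S\<close>, \<open>T\<close> of standard tableaux of the same shape, a nonzero element of the group algebra whose left and
  right Jucys--Murphy eigenvalues are the contents of \<open>S\<close> and \<open>T\<close>: elements with different contents are
  linearly independent, and there are \<open>n!\<close> pairs because Young's lattice is a differential poset.

  Existence goes by induction on \<open>n\<close>. Intertwiners move an eigenvector from one tableau to any other
  of the same shape, so one pair per shape is enough. For a shape with two corners, an eigenvector is
  \<open>x * s * y\<close>, where \<open>x\<close> and \<open>y\<close> belong to the two shapes with one corner removed and \<open>s\<close> is the last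
  Coxeter generator. For a \<open>p \<times> q\<close> rectangle, removing the corner leaves a shape on which the last
  Jucys--Murphy element can only have the eigenvalues \<open>- p\<close>, \<open>q\<close> and \<open>q - p\<close>; its second moment
  \<open>n - 1\<close> shows that \<open>q - p\<close> does occur.
\<close>

section \<open>Young diagrams and growth sequences\<close>

text \<open>What replaces semisimplicity is counting. Once \<open>full n\<close> is known, the
  weight vectors form a basis of the group algebra of S_n, and since 1 commutes with everything it
  is a combination of those of diagonal weight. Multiplying by this expansion shows that a nonzero
  vector of right weight \<open>R\<close> is not annihilated by a nonzero vector of weight
  \<open>(R, R)\<close>, and that on vectors of right weight \<open>R\<close> the next Jucys--Murphy
  element can only take contents of boxes addable to \<open>R\<close>. The induction step uses both
  facts at smaller levels.

  A rectangle is the obstacle because it has one corner: there is no second smaller shape, hence no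
  pair \<open>x\<close>, \<open>y\<close> with \<open>x * y = 0\<close> from which to form
  \<open>x * s * y\<close>. The list of three eigenvalues comes from the two ways to take off a
  further box after the corner. By the Hecke relations, each way leaves \<open>- p\<close>,
  \<open>q\<close> and the content of that further box plus or minus 1. The two contents are
  \<open>q - p + 1\<close> and \<open>q - p - 1\<close>, so besides \<open>- p\<close> and
  \<open>q\<close> only \<open>q - p\<close> is common to both.\<close>

definition diagram :: "(nat \<times> nat) set \<Rightarrow> bool" where
  "diagram D \<longleftrightarrow> finite D \<and> (\<forall>i j. (i, j) \<in> D \<longrightarrow> 1 \<le> i \<and> 1 \<le> j) \<and>
    (\<forall>i j. 1 \<le> i \<longrightarrow> (Suc i, j) \<in> D \<longrightarrow> (i, j) \<in> D) \<and>
    (\<forall>i j. 1 \<le> j \<longrightarrow> (i, Suc j) \<in> D \<longrightarrow> (i, j) \<in> D)"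

definition addable :: "(nat \<times> nat) set \<Rightarrow> (nat \<times> nat) set" where
  "addable D = {b. b \<notin> D \<and> diagram (insert b D)}"

definition removable :: "(nat \<times> nat) set \<Rightarrow> (nat \<times> nat) set" where
  "removable D = {b \<in> D. diagram (D - {b})}"

definition box_content :: "nat \<times> nat \<Rightarrow> real" where
  "box_content b = real (snd b) - real (fst b)"

text \<open>A standard tableau is encoded as the list of its boxes in the order of their entries.\<close>

definition growth :: "(nat \<times> nat) list \<Rightarrow> bool" where
  "growth bs \<longleftrightarrow> distinct bs \<and> (\<forall>k. diagram (set (take k bs)))"

definition growths :: "(nat \<times> nat) set \<Rightarrow> (nat \<times> nat) list set" where
  "growths D = {bs. growth bs \<and> set bs = D}"

lemma diagram_finite: "diagram D \<Longrightarrow> finite D"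
  unfolding diagram_def by (rule conjunct1)

lemma diagram_pos: "diagram D \<Longrightarrow> (i, j) \<in> D \<Longrightarrow> 1 \<le> i \<and> 1 \<le> j"
  unfolding diagram_def by blast

lemma diagram_down:
  assumes D: "diagram D" and ij: "(i, j) \<in> D" and "1 \<le> i'" "i' \<le> i" "1 \<le> j'" "j' \<le> j"
  shows "(i', j') \<in> D"
proof -
  have "(i', j) \<in> D"
    using \<open>i' \<le> i\<close> ij \<open>1 \<le> i'\<close>
  proof (induction i rule: dec_induct)
    case (step k)
    then show ?case
      using D unfolding diagram_def by (meson le_trans)
  qed
  with \<open>j' \<le> j\<close> show ?thesis
    using \<open>1 \<le> j'\<close>
  proof (induction j rule: dec_induct)
    case (step k)
    then show ?case
      using D unfolding diagram_def by (meson le_trans)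
  qed
qed

lemma diagram_empty [simp]: "diagram {}"
  by (simp add: diagram_def)

lemma diagram_Int: "diagram D \<Longrightarrow> diagram E \<Longrightarrow> diagram (D \<inter> E)"
  unfolding diagram_def by blast

lemma diagram_Un:
  assumes D: "diagram D" and E: "diagram E"
  shows "diagram (D \<union> E)"
proof -
  have "(i, j) \<in> D \<union> E" if "1 \<le> i" "(Suc i, j) \<in> D \<union> E" for i j
    using that D E unfolding diagram_def by (meson Un_iff)
  moreover have "(i, j) \<in> D \<union> E" if "1 \<le> j" "(i, Suc j) \<in> D \<union> E" for i j
    using that D E unfolding diagram_def by (meson Un_iff)
  moreover have "1 \<le> i \<and> 1 \<le> j" if "(i, j) \<in> D \<union> E" for i j
    using that diagram_pos D E by blast
  moreover have "finite (D \<union> E)"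
    using diagram_finite D E by simp
  ultimately show ?thesis
    unfolding diagram_def by blast
qed

lemma addable_iff:
  assumes "diagram D"
  shows "(i, j) \<in> addable D \<longleftrightarrow> (i, j) \<notin> D \<and> 1 \<le> i \<and> 1 \<le> j \<and>
    (i = 1 \<or> (i - 1, j) \<in> D) \<and> (j = 1 \<or> (i, j - 1) \<in> D)" (is "?L \<longleftrightarrow> ?R")
proof
  assume ?L
  then have n: "(i, j) \<notin> D" and d: "diagram (insert (i, j) D)"
    by (auto simp: addable_def)
  have p: "1 \<le> i" "1 \<le> j"
    using diagram_pos[OF d, of i j] by auto
  have "(i - 1, j) \<in> D" if "i \<noteq> 1"
    using diagram_down[OF d, of i j "i - 1" j] p that by fastforce
  moreover have "(i, j - 1) \<in> D" if "j \<noteq> 1"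
    using diagram_down[OF d, of i j i "j - 1"] p that by fastforce
  ultimately show ?R
    using n p by blast
next
  assume R: ?R
  have "(k, l) \<in> D" if "1 \<le> k" "(Suc k, l) \<in> insert (i, j) D" for k l
  proof (cases "(Suc k, l) = (i, j)")
    case True
    then have "k = i - 1" "l = j" "i \<noteq> 1"
      using that(1) by auto
    then show ?thesis
      using R by simp
  next
    case False
    then show ?thesis
      using that assms unfolding diagram_def by blast
  qed
  moreover have "(k, l) \<in> D" if "1 \<le> l" "(k, Suc l) \<in> insert (i, j) D" for k l
  proof (cases "(k, Suc l) = (i, j)")
    case True
    then have "k = i" "l = j - 1" "j \<noteq> 1"
      using that(1) by auto
    then show ?thesis
      using R by simp
  next
    case False
    then show ?thesis
      using that assms unfolding diagram_def by blast
  qed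
  moreover have "1 \<le> k \<and> 1 \<le> l" if "(k, l) \<in> insert (i, j) D" for k l
    using that R diagram_pos[OF assms, of k l] by blast
  moreover have "finite (insert (i, j) D)"
    using diagram_finite[OF assms] by simp
  ultimately have "diagram (insert (i, j) D)"
    unfolding diagram_def by blast
  then show ?L
    using R by (simp add: addable_def)
qed

lemma removable_iff:
  assumes "diagram D"
  shows "(i, j) \<in> removable D \<longleftrightarrow> (i, j) \<in> D \<and> (Suc i, j) \<notin> D \<and> (i, Suc j) \<notin> D" (is "?L \<longleftrightarrow> ?R")
proof
  assume ?L
  then have n: "(i, j) \<in> D" and d: "diagram (D - {(i, j)})"
    by (auto simp: removable_def)
  have p: "1 \<le> i" "1 \<le> j"
    using diagram_pos[OF assms n] by auto
  have "(Suc i, j) \<notin> D"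
    using diagram_down[OF d, of "Suc i" j i j] p by auto
  moreover have "(i, Suc j) \<notin> D"
    using diagram_down[OF d, of i "Suc j" i j] p by auto
  ultimately show ?R
    using n by blast
next
  assume R: ?R
  have "(k, l) \<in> D - {(i, j)}" if "1 \<le> k" "(Suc k, l) \<in> D - {(i, j)}" for k l
    using that R assms unfolding diagram_def by blast
  moreover have "(k, l) \<in> D - {(i, j)}" if "1 \<le> l" "(k, Suc l) \<in> D - {(i, j)}" for k l
    using that R assms unfolding diagram_def by blast
  moreover have "1 \<le> k \<and> 1 \<le> l" if "(k, l) \<in> D - {(i, j)}" for k l
    using that diagram_pos[OF assms, of k l] by blast
  moreover have "finite (D - {(i, j)})"
    using diagram_finite[OF assms] by simp
  ultimately have "diagram (D - {(i, j)})"
    unfolding diagram_def by blast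
  then show ?L
    using R by (simp add: removable_def)
qed

lemma addableD:
  "a \<in> addable D \<Longrightarrow> a \<notin> D" "a \<in> addable D \<Longrightarrow> diagram (insert a D)"
  by (auto simp: addable_def)

lemma removableD:
  "b \<in> removable D \<Longrightarrow> b \<in> D" "b \<in> removable D \<Longrightarrow> diagram (D - {b})"
  by (auto simp: removable_def)

lemma finite_removable: "diagram D \<Longrightarrow> finite (removable D)"
  by (simp add: removable_def diagram_finite)

text \<open>Two boxes whose contents differ by at most 1 are comparable in both coordinates, so
  adding the larger one alone would leave a hole at the smaller one. The gap 2, and not only 1, is
  what keeps the intertwiner in \<open>swap_right_wt\<close> from vanishing.\<close>

lemma addable_content_gap:
  assumes "a \<in> addable D" "b \<in> addable D" "a \<noteq> b"
  shows "\<bar>box_content a - box_content b\<bar> \<ge> 2"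
proof (rule ccontr)
  assume *: "\<not> ?thesis"
  obtain i j k l where ab: "a = (i, j)" "b = (k, l)"
    by fastforce
  have a: "(i, j) \<notin> D" "diagram (insert (i, j) D)" and b: "(k, l) \<notin> D" "diagram (insert (k, l) D)"
    using assms unfolding addable_def ab by blast+
  have p: "1 \<le> i" "1 \<le> j" "1 \<le> k" "1 \<le> l"
    using diagram_pos[OF a(2), of i j] diagram_pos[OF b(2), of k l] by auto
  have "\<bar>(int j - int i) - (int l - int k)\<bar> < 2"
    using * unfolding ab box_content_def by (simp; linarith)
  then have "k \<le> i \<and> l \<le> j \<or> i \<le> k \<and> j \<le> l"
    by linarith
  then show False
    using diagram_down[OF a(2), of i j k l] diagram_down[OF b(2), of k l i j] p a b assms(3) ab by auto
qed

lemma addable_content_inj: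
  "a \<in> addable D \<Longrightarrow> b \<in> addable D \<Longrightarrow> box_content a = box_content b \<Longrightarrow> a = b"
  by (rule ccontr) (use addable_content_gap[of a D b] in simp)

section \<open>Tableaux built box by box\<close>

lemma growth_Nil [simp]: "growth []"
  by (simp add: growth_def)

lemma growth_diagram: "growth bs \<Longrightarrow> diagram (set bs)"
  unfolding growth_def by (metis order_refl take_all)

lemma growth_distinct: "growth bs \<Longrightarrow> distinct bs"
  by (simp add: growth_def)

lemma growth_snoc: "growth (bs @ [b]) \<longleftrightarrow> growth bs \<and> b \<in> addable (set bs)"
proof
  assume *: "growth (bs @ [b])"
  have "diagram (set (take k bs))" for k
    using * unfolding growth_def
    by (metis append_Nil2 diff_is_0_eq linorder_linear take0 take_all take_append)
  moreover have "diagram (insert b (set bs))"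
    using growth_diagram[OF *] by simp
  ultimately show "growth bs \<and> b \<in> addable (set bs)"
    using * by (auto simp: growth_def addable_def)
next
  assume *: "growth bs \<and> b \<in> addable (set bs)"
  have "diagram (set (take k (bs @ [b])))" for k
  proof (cases "k \<le> length bs")
    case True
    then show ?thesis
      using * by (simp add: growth_def)
  next
    case False
    then show ?thesis
      using * by (simp add: addable_def)
  qed
  then show "growth (bs @ [b])"
    using * by (auto simp: growth_def addable_def)
qed

lemma growth_take: "growth bs \<Longrightarrow> growth (take k bs)"
  by (simp add: growth_def min_def)

lemma growths_empty [simp]: "growths {} = {[]}"
  by (auto simp: growths_def)

lemma growths_diagram: "bs \<in> growths D \<Longrightarrow> diagram D"
  by (auto simp: growths_def growth_diagram)

lemma growths_length: "bs \<in> growths D \<Longrightarrow> length bs = card D"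
  by (auto simp: growths_def growth_distinct distinct_card)

lemma growths_snoc:
  "bs @ [b] \<in> growths D \<longleftrightarrow> diagram D \<and> b \<in> removable D \<and> bs \<in> growths (D - {b})"
proof
  assume *: "bs @ [b] \<in> growths D"
  then have g: "growth bs" "b \<in> addable (set bs)" and D: "D = insert b (set bs)"
    by (auto simp: growths_def growth_snoc)
  have "D - {b} = set bs"
    using g(2) D by (auto simp: addable_def)
  then show "diagram D \<and> b \<in> removable D \<and> bs \<in> growths (D - {b})"
    using g D growths_diagram[OF *] growth_diagram[OF g(1)]
    by (auto simp: growths_def removable_def)
next
  assume *: "diagram D \<and> b \<in> removable D \<and> bs \<in> growths (D - {b})"
  then show "bs @ [b] \<in> growths D"
    by (auto simp: growths_def growth_snoc removable_def addable_def insert_absorb)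
qed

lemma growths_eq:
  assumes "diagram D" "D \<noteq> {}"
  shows "growths D = (\<Union>b\<in>removable D. (\<lambda>bs. bs @ [b]) ` growths (D - {b}))"
proof (intro Set.set_eqI iffI)
  fix cs assume cs: "cs \<in> growths D"
  then have "cs \<noteq> []"
    using assms(2) by (auto simp: growths_def)
  then obtain bs b where "cs = bs @ [b]"
    by (metis rev_exhaust)
  then show "cs \<in> (\<Union>b\<in>removable D. (\<lambda>bs. bs @ [b]) ` growths (D - {b}))"
    using cs growths_snoc by auto
qed (auto simp: growths_snoc assms)

lemma finite_growths: "finite (growths D)"
proof (cases "finite D")
  case True
  have "growths D \<subseteq> {bs. set bs \<subseteq> D \<and> length bs = card D}"
    by (auto simp: growths_length) (auto simp: growths_def)
  then show ?thesis
    using finite_lists_length_eq[OF True] finite_subset by blast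
next
  case False
  then have "growths D = {}"
    by (auto simp: growths_def)
  then show ?thesis by simp
qed

lemma card_growths:
  assumes "diagram D" "D \<noteq> {}"
  shows "card (growths D) = (\<Sum>b\<in>removable D. card (growths (D - {b})))"
proof -
  have "card (growths D) = (\<Sum>b\<in>removable D. card ((\<lambda>bs. bs @ [b]) ` growths (D - {b})))"
    unfolding growths_eq[OF assms]
    by (rule card_UN_disjoint) (auto simp: finite_removable assms finite_growths)
  also have "\<dots> = (\<Sum>b\<in>removable D. card (growths (D - {b})))"
    by (intro sum.cong refl card_image inj_onI) simp
  finally show ?thesis .
qed

text \<open>Among the boxes weakly below and to the right of \<open>(i, j)\<close>, one with maximal
  coordinate sum has no neighbour in \<open>D\<close> below it or to its right.\<close>

lemma removable_below:
  assumes "diagram D" "(i, j) \<in> D"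
  obtains k l where "(k, l) \<in> removable D" "i \<le> k" "j \<le> l"
proof -
  define S where "S = {(k, l) \<in> D. i \<le> k \<and> j \<le> l}"
  define h where "h b = fst b + snd b" for b :: "nat \<times> nat"
  have fin: "finite S"
    using diagram_finite[OF assms(1)] unfolding S_def by (rule finite_subset[rotated]) auto
  have "S \<noteq> {}"
    using assms(2) by (auto simp: S_def)
  then have "Max (h ` S) \<in> h ` S"
    using fin by (intro Max_in) auto
  then obtain b where b: "b \<in> S" "Max (h ` S) = h b"
    by blast
  then have max: "h c \<le> h b" if "c \<in> S" for c
    using fin that by (metis Max_ge finite_imageI imageI)
  obtain k l where kl: "b = (k, l)"
    by fastforce
  have "(Suc k, l) \<notin> D" "(k, Suc l) \<notin> D"
    using b(1) max[of "(Suc k, l)"] max[of "(k, Suc l)"] unfolding kl by (auto simp: S_def h_def)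
  then have "(k, l) \<in> removable D"
    using removable_iff[OF assms(1), of k l] b(1) kl by (auto simp: S_def)
  then show ?thesis
    by (rule that) (use b(1) kl in \<open>simp_all add: S_def\<close>)
qed

lemma removable_nonempty:
  assumes "diagram D" "D \<noteq> {}"
  shows "removable D \<noteq> {}"
proof -
  obtain p where "p \<in> D"
    using assms(2) by blast
  then have "(fst p, snd p) \<in> D"
    by simp
  then obtain k l where "(k, l) \<in> removable D"
    by (rule removable_below[OF assms(1)])
  then show ?thesis
    by blast
qed

lemma growths_nonempty: "diagram D \<Longrightarrow> growths D \<noteq> {}"
proof (induction "card D" arbitrary: D)
  case 0
  then show ?case
    by (simp add: diagram_finite)
next
  case (Suc n)
  then have "D \<noteq> {}"
    by auto
  then obtain b where b: "b \<in> removable D"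
    using removable_nonempty Suc by blast
  then have "card (D - {b}) = n"
    using Suc removableD(1) diagram_finite by fastforce
  then show ?case
    using Suc b growths_snoc removableD(2) by (metis all_not_in_conv)
qed

section \<open>Row lengths, corners and addable boxes\<close>

definition row_len :: "(nat \<times> nat) set \<Rightarrow> nat \<Rightarrow> nat" where
  "row_len D i = card {j. (i, j) \<in> D}"

lemma row_len_iff:
  assumes D: "diagram D"
  shows "(i, j) \<in> D \<longleftrightarrow> 1 \<le> j \<and> j \<le> row_len D i"
proof -
  let ?R = "{j. (i, j) \<in> D}"
  have fin: "finite ?R"
    using finite_imageI[OF diagram_finite[OF D], of snd]
    by (rule finite_subset[rotated]) force
  have "?R = {1..row_len D i}"
  proof (cases "?R = {}")
    case True
    then show ?thesis
      by (simp add: row_len_def)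
  next
    case False
    let ?m = "Max ?R"
    have m: "(i, ?m) \<in> D"
      using Max_in[OF fin False] by simp
    then have i: "1 \<le> i"
      using diagram_pos[OF D] by blast
    have "?R = {1..?m}"
      using diagram_pos[OF D] diagram_down[OF D m i] Max_ge[OF fin] by auto
    then have "row_len D i = ?m"
      unfolding row_len_def by (metis card_atLeastAtMost diff_Suc_1 One_nat_def)
    then show ?thesis
      using \<open>?R = {1..?m}\<close> by simp
  qed
  then show ?thesis
    by auto
qed

lemma row_len_antimono:
  assumes "diagram D" "1 \<le> i"
  shows "row_len D (Suc i) \<le> row_len D i"
proof (cases "row_len D (Suc i) = 0")
  case False
  then have "(Suc i, row_len D (Suc i)) \<in> D"
    using row_len_iff[OF assms(1)] by simp
  then have "(i, row_len D (Suc i)) \<in> D"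
    using diagram_down[OF assms(1), of "Suc i" _ i] assms(2) False by simp
  then show ?thesis
    using row_len_iff[OF assms(1)] by simp
qed simp

text \<open>A corner in row \<open>i\<close> makes the box at the end of row \<open>i + 1\<close>
  addable, because that row is shorter. Every addable box arises in this way except the one at the
  end of row 1, which accounts for the \<open>Suc\<close>.\<close>

lemma card_addable:
  assumes D: "diagram D"
  shows "finite (addable D)" "card (addable D) = Suc (card (removable D))"
proof -
  let ?f = "\<lambda>(i, j::nat). (Suc i, Suc (row_len D (Suc i)))"
  have inj: "inj_on ?f (removable D)"
  proof (rule inj_onI)
    fix p q assume p: "p \<in> removable D" and q: "q \<in> removable D" and eq: "?f p = ?f q"
    have j: "j = row_len D i" if "(i, j) \<in> removable D" for i j
      using that by (auto simp: removable_iff[OF D] row_len_iff[OF D])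
    show "p = q"
      using j[of "fst p" "snd p"] j[of "fst q" "snd q"] p q eq by (simp add: case_prod_beta prod_eq_iff)
  qed
  have sub: "?f ` removable D \<subseteq> addable D"
  proof clarify
    fix i j assume r: "(i, j) \<in> removable D"
    then have ij: "(i, j) \<in> D" "(Suc i, j) \<notin> D"
      by (auto simp: removable_iff[OF D])
    have p: "1 \<le> i" "1 \<le> j"
      using diagram_pos[OF D ij(1)] by auto
    have "row_len D (Suc i) < j" "j \<le> row_len D i"
      using ij p row_len_iff[OF D] by auto
    then show "(Suc i, Suc (row_len D (Suc i))) \<in> addable D"
      using p by (auto simp: addable_iff[OF D] row_len_iff[OF D])
  qed
  have "addable D \<subseteq> insert (1, Suc (row_len D 1)) (?f ` removable D)"
  proof clarify
    fix i j assume a: "(i, j) \<in> addable D" and n: "(i, j) \<notin> ?f ` removable D"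
    have ij: "(i, j) \<notin> D" "1 \<le> i" "1 \<le> j" "i = 1 \<or> (i - 1, j) \<in> D" "j = 1 \<or> (i, j - 1) \<in> D"
      using a addable_iff[OF D, of i j] by auto
    then have j: "j = Suc (row_len D i)"
      using row_len_iff[OF D] by fastforce
    show "i = 1 \<and> j = Suc (row_len D 1)"
    proof (cases "i = 1")
      case False
      let ?r = "(i - 1, row_len D (i - 1))"
      have "j \<le> row_len D (i - 1)"
        using ij False row_len_iff[OF D] by auto
      then have "?r \<in> removable D"
        using ij False j by (auto simp: removable_iff[OF D] row_len_iff[OF D])
      then have "?f ?r \<in> ?f ` removable D"
        by blast
      then show ?thesis
        using n ij(2) False j by simp
    qed (use j in simp)
  qed
  moreover have "(1, Suc (row_len D 1)) \<in> addable D"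
    by (auto simp: addable_iff[OF D] row_len_iff[OF D])
  ultimately have eq: "addable D = insert (1, Suc (row_len D 1)) (?f ` removable D)"
    using sub by blast
  have "1 \<le> i" if "(i, j) \<in> removable D" for i j
    using that removable_iff[OF D] diagram_pos[OF D] by blast
  then have "(1, Suc (row_len D 1)) \<notin> ?f ` removable D"
    by fastforce
  then show "finite (addable D)" "card (addable D) = Suc (card (removable D))"
    unfolding eq using finite_removable[OF D] card_image[OF inj] by auto
qed

text \<open>Unions and intersections of diagrams are diagrams: \<open>D - {b}\<close> is the
  intersection of \<open>D\<close> with \<open>insert a D - {b}\<close>, and
  \<open>insert a D\<close> is the union of \<open>D\<close> with
  \<open>insert a (D - {b})\<close>.\<close>

lemma add_remove_commute:
  assumes "diagram D" "a \<noteq> b"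
  shows "a \<in> addable D \<and> b \<in> removable (insert a D) \<longleftrightarrow> b \<in> removable D \<and> a \<in> addable (D - {b})"
proof
  assume "a \<in> addable D \<and> b \<in> removable (insert a D)"
  then have *: "a \<notin> D" "diagram (insert a D)" "b \<in> D" "diagram (insert a D - {b})"
    using assms(2) by (auto simp: addable_def removable_def)
  have "D \<inter> (insert a D - {b}) = D - {b}" "insert a D - {b} = insert a (D - {b})"
    using * assms(2) by auto
  then show "b \<in> removable D \<and> a \<in> addable (D - {b})"
    using diagram_Int[OF assms(1) *(4)] * by (auto simp: addable_def removable_def)
next
  assume "b \<in> removable D \<and> a \<in> addable (D - {b})"
  then have *: "b \<in> D" "diagram (D - {b})" "a \<notin> D" "diagram (insert a (D - {b}))"
    using assms(2) by (auto simp: addable_def removable_def)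
  have "D \<union> insert a (D - {b}) = insert a D" "insert a D - {b} = insert a (D - {b})"
    using * assms(2) by auto
  then show "a \<in> addable D \<and> b \<in> removable (insert a D)"
    using diagram_Un[OF assms(1) *(4)] * by (auto simp: addable_def removable_def)
qed

text \<open>Young's lattice is differential: adding a box and then removing one differs from the
  opposite order only in the pairs that return to \<open>D\<close>, of which there is exactly one more.\<close>

lemma sum_growths_addable:
  assumes "diagram D"
  shows "(\<Sum>a\<in>addable D. card (growths (insert a D))) = Suc (card D) * card (growths D)"
  using assms
proof (induction "card D" arbitrary: D)
  case (0 D)
  then have "D = {}"
    by (simp add: diagram_finite)
  have "addable {} = {(1, 1)}"
    by (auto simp: addable_iff)
  moreover from this have "growth [(1, 1)]"
    using growth_snoc[of "[]" "(1, 1)"] by simp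
  then have "growths {(1, 1)} = {[(1, 1)]}"
    using growths_eq[of "{(1, 1)}"] growth_diagram[of "[(1, 1)]"] by (auto simp: removable_def)
  ultimately show ?case
    by (simp add: \<open>D = {}\<close>)
next
  case (Suc n D)
  let ?d = "\<lambda>D. card (growths D)"
  have ne: "D \<noteq> {}" and finD: "finite D"
    using Suc by (auto simp: diagram_finite)
  note finA = card_addable(1)[OF Suc.prems] and finR = finite_removable[OF Suc.prems]
  let ?P = "SIGMA a:addable D. removable (insert a D) - {a}"
  let ?Q = "SIGMA b:removable D. addable (D - {b}) - {b}"
  have D_b: "card (D - {b}) = n" "diagram (D - {b})" if "b \<in> removable D" for b
    using that Suc finD by (auto simp: removable_def)
  have "(\<Sum>a\<in>addable D. ?d (insert a D)) =
      (\<Sum>a\<in>addable D. \<Sum>b\<in>removable (insert a D). ?d (insert a D - {b}))"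
    by (intro sum.cong refl card_growths) (auto dest: addableD)
  also have "\<dots> = (\<Sum>a\<in>addable D. ?d D + (\<Sum>b\<in>removable (insert a D) - {a}. ?d (insert a D - {b})))"
  proof (intro sum.cong refl)
    fix a assume a: "a \<in> addable D"
    then have "insert a D - {a} = D" and "a \<in> removable (insert a D)"
      using Suc.prems by (auto simp: addable_def removable_def)
    then show "(\<Sum>b\<in>removable (insert a D). ?d (insert a D - {b})) =
        ?d D + (\<Sum>b\<in>removable (insert a D) - {a}. ?d (insert a D - {b}))"
      using finite_removable[OF addableD(2)[OF a]] by (simp add: sum.remove)
  qed
  also have "\<dots> = card (addable D) * ?d D + (\<Sum>(a, b)\<in>?P. ?d (insert a D - {b}))"
    by (simp add: sum.distrib sum.Sigma finA finite_removable addableD)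
  also have "(\<Sum>(a, b)\<in>?P. ?d (insert a D - {b})) = (\<Sum>(b, a)\<in>?Q. ?d (insert a (D - {b})))"
  proof (rule sum.reindex_bij_witness[of _ prod.swap prod.swap], goal_cases)
    case (2 p)
    then show ?case
      using add_remove_commute[OF Suc.prems, of "fst p" "snd p"] by (cases p, simp, metis)
  next
    case (4 p)
    then show ?case
      using add_remove_commute[OF Suc.prems, of "snd p" "fst p"] by (cases p, simp, metis)
  next
    case (5 p)
    then show ?case
      by (cases p) (auto simp add: insert_Diff_if)
  qed auto
  also have "\<dots> = (\<Sum>b\<in>removable D. \<Sum>a\<in>addable (D - {b}) - {b}. ?d (insert a (D - {b})))"
    by (simp add: sum.Sigma finR card_addable(1) D_b)
  \<comment> \<open>There is one addable box more than there are corners. Each corner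
    \<open>b\<close> receives one copy of \<open>?d D\<close>, which is the summand
    \<open>a = b\<close> missing from its inner sum; one copy is left over.\<close>
  also have "card (addable D) * ?d D + \<dots> = ?d D + (\<Sum>b\<in>removable D. ?d D +
      (\<Sum>a\<in>addable (D - {b}) - {b}. ?d (insert a (D - {b}))))"
    by (simp add: sum.distrib card_addable(2)[OF Suc.prems])
  also have "(\<Sum>b\<in>removable D. ?d D + (\<Sum>a\<in>addable (D - {b}) - {b}. ?d (insert a (D - {b})))) =
      (\<Sum>b\<in>removable D. Suc n * ?d (D - {b}))"
  proof (intro sum.cong refl)
    fix b assume b: "b \<in> removable D"
    have "b \<in> addable (D - {b})" "insert b (D - {b}) = D"
      using b Suc.prems by (auto simp: addable_def removable_def insert_absorb)
    then have "?d D + (\<Sum>a\<in>addable (D - {b}) - {b}. ?d (insert a (D - {b}))) =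
        (\<Sum>a\<in>addable (D - {b}). ?d (insert a (D - {b})))"
      using card_addable(1)[OF D_b(2)[OF b]] by (simp add: sum.remove)
    then show "?d D + (\<Sum>a\<in>addable (D - {b}) - {b}. ?d (insert a (D - {b}))) = Suc n * ?d (D - {b})"
      using Suc.hyps(1)[of "D - {b}"] D_b[OF b] by simp
  qed
  also have "\<dots> = Suc n * ?d D"
    by (simp only: sum_distrib_left[symmetric] card_growths[OF Suc.prems ne])
  finally show ?case
    using Suc.hyps(2) by simp
qed

section \<open>The sum of the squares of the tableau counts\<close>

definition diagrams :: "nat \<Rightarrow> (nat \<times> nat) set set" where
  "diagrams n = {D. diagram D \<and> card D = n}"

lemma diagrams_Suc_pairs:
  "(D, b) \<in> (SIGMA D:diagrams (Suc n). removable D) \<longleftrightarrow>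
    b \<in> D \<and> (D - {b}, b) \<in> (SIGMA E:diagrams n. addable E)"
proof (cases "b \<in> D \<and> diagram D")
  case True
  then have "card D = Suc (card (D - {b}))"
    by (metis card_Suc_Diff1 diagram_finite)
  then show ?thesis
    using True by (auto simp: diagrams_def removable_def addable_def insert_absorb)
qed (auto simp: diagrams_def removable_def addable_def insert_absorb)

lemma finite_diagrams: "finite (diagrams n)"
proof -
  have "D \<subseteq> {1..n} \<times> {1..n}" if "D \<in> diagrams n" for D
  proof clarify
    fix i j assume ij: "(i, j) \<in> D"
    have D: "diagram D" "card D = n"
      using that by (auto simp: diagrams_def)
    have p: "1 \<le> i" "1 \<le> j"
      using diagram_pos[OF D(1) ij] by auto
    have "(\<lambda>k. (k, j)) ` {1..i} \<subseteq> D" "(\<lambda>k. (i, k)) ` {1..j} \<subseteq> D"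
      using diagram_down[OF D(1) ij] p by auto
    then have "card ((\<lambda>k. (k, j)) ` {1..i}) \<le> n" "card ((\<lambda>k. (i, k)) ` {1..j}) \<le> n"
      using D card_mono[OF diagram_finite[OF D(1)]] by auto
    then show "i \<in> {1..n} \<and> j \<in> {1..n}"
      using p by (simp add: card_image inj_on_def)
  qed
  then have "diagrams n \<subseteq> Pow ({1..n} \<times> {1..n})"
    by blast
  then show ?thesis
    by (rule finite_subset) simp
qed

text \<open>The enumerative form of the Robinson--Schensted correspondence. One factor of each
  square is expanded over the corners; regrouping the pairs of neighbouring shapes by the smaller
  one lets \<open>sum_growths_addable\<close> sum over its addable boxes.\<close>

theorem sum_card_growths_squared: "(\<Sum>D\<in>diagrams n. card (growths D) ^ 2) = fact n"
proof (induction n)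
  case 0
  have "diagrams 0 = {{}}"
    by (auto simp: diagrams_def diagram_finite)
  then show ?case
    by simp
next
  case (Suc n)
  let ?d = "\<lambda>D. card (growths D)"
  have "(\<Sum>D\<in>diagrams (Suc n). ?d D ^ 2) =
      (\<Sum>D\<in>diagrams (Suc n). \<Sum>b\<in>removable D. ?d D * ?d (D - {b}))"
    unfolding power2_eq_square sum_distrib_left[symmetric]
    by (intro sum.cong refl arg_cong2[where f = "(*)"] card_growths) (auto simp: diagrams_def)
  also have "\<dots> = (\<Sum>(D, b)\<in>(SIGMA D:diagrams (Suc n). removable D). ?d D * ?d (D - {b}))"
    by (intro sum.Sigma finite_diagrams ballI finite_removable) (auto simp: diagrams_def)
  also have "\<dots> = (\<Sum>(E, b)\<in>(SIGMA E:diagrams n. addable E). ?d (insert b E) * ?d E)"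
  proof (rule sum.reindex_bij_witness[of _ "\<lambda>(E, b). (insert b E, b)" "\<lambda>(D, b). (D - {b}, b)"], goal_cases)
    case (2 p)
    then show ?case
      using diagrams_Suc_pairs by (cases p) auto
  next
    case (4 p)
    moreover from 4 have "insert (snd p) (fst p) - {snd p} = fst p"
      by (auto simp: addable_def)
    ultimately show ?case
      using diagrams_Suc_pairs[of "insert (snd p) (fst p)" "snd p" n] by (cases p) auto
  qed (auto simp: addable_def removable_def insert_absorb)
  also have "\<dots> = (\<Sum>E\<in>diagrams n. \<Sum>b\<in>addable E. ?d (insert b E) * ?d E)"
    by (intro sum.Sigma[symmetric] finite_diagrams ballI card_addable) (auto simp: diagrams_def)
  also have "\<dots> = (\<Sum>E\<in>diagrams n. Suc n * ?d E ^ 2)"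
    by (intro sum.cong refl)
      (auto simp: sum_distrib_right[symmetric] sum_growths_addable diagrams_def power2_eq_square distrib_right mult.assoc)
  also have "\<dots> = fact (Suc n)"
    using Suc.IH by (simp add: sum_distrib_left[symmetric] del: mult_Suc)
  finally show ?case .
qed

section \<open>The group algebra and its Jucys--Murphy elements\<close>

abbreviation lookup :: "('a \<Rightarrow>\<^sub>0 'b) \<Rightarrow> 'a \<Rightarrow> 'b::zero" where
  "lookup \<equiv> Poly_Mapping.lookup"

abbreviation keys :: "('a \<Rightarrow>\<^sub>0 'b::zero) \<Rightarrow> 'a set" where
  "keys \<equiv> Poly_Mapping.keys"

text \<open>One type contains every S_n, so the group algebras form a chain of literal inclusions
  and elements of different levels multiply without embeddings. The support bound
  \<open>{..n}\<close> includes 0, which makes \<open>tr i j\<close> well defined for all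
  \<open>i\<close> and \<open>j\<close>.\<close>

typedef fperm = "{p :: nat \<Rightarrow> nat. \<exists>n. p permutes {..n}}"
  morphisms fapp Fperm
  by (rule exI[of _ id]) (auto intro: permutes_id)

lemma fapp_bounded: "\<exists>n. fapp g permutes {..n}"
  using fapp[of g] by simp

lemma fapp_Fperm: "p permutes {..n} \<Longrightarrow> fapp (Fperm p) = p"
  by (rule Fperm_inverse) auto

lemma fperm_eqI: "(\<And>i. fapp g i = fapp h i) \<Longrightarrow> g = h"
  by (metis ext fapp_inject)

text \<open>Composition is written additively because \<open>poly_mapping\<close> builds convolution algebras over
  additive monoids.\<close>

instantiation fperm :: group_add
begin

definition "0 = Fperm id"
definition "g + h = Fperm (fapp g \<circ> fapp h)"
definition "- g = Fperm (inv_into UNIV (fapp g))"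
definition "g - h = g + (- h :: fperm)"

lemma fapp_zero: "fapp 0 = id"
  unfolding zero_fperm_def by (rule fapp_Fperm[of _ 0]) (rule permutes_id)

lemma fapp_plus: "fapp (g + h) = fapp g \<circ> fapp h"
proof -
  obtain m n where "fapp g permutes {..m}" "fapp h permutes {..n}"
    using fapp_bounded by blast
  then have "fapp g permutes {..max m n}" "fapp h permutes {..max m n}"
    by (auto elim: permutes_subset)
  then show ?thesis
    unfolding plus_fperm_def by (intro fapp_Fperm permutes_compose)
qed

lemma fapp_uminus: "fapp (- g) = inv_into UNIV (fapp g)"
  unfolding uminus_fperm_def using fapp_bounded[of g] fapp_Fperm permutes_inv by blast

instance
proof
  fix g :: fperm
  have "bij (fapp g)"
    using fapp_bounded[of g] permutes_bij by blast
  then show "- g + g = 0"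
    by (intro fperm_eqI) (simp add: fapp_plus fapp_uminus fapp_zero bij_is_inj)
qed (auto intro!: fperm_eqI simp: fapp_plus fapp_zero minus_fperm_def)

end

section \<open>The symmetric groups and their transpositions\<close>

definition Sn :: "nat \<Rightarrow> fperm set" where
  "Sn n = {g. fapp g permutes {1..n}}"

lemma Sn_image: "fapp ` Sn n = {p. p permutes {1..n}}"
proof (intro Set.set_eqI iffI)
  fix p assume p: "p \<in> {p. p permutes {1..n}}"
  then have "p permutes {..n}"
    by (auto elim: permutes_subset)
  then have "fapp (Fperm p) = p"
    by (rule fapp_Fperm)
  then show "p \<in> fapp ` Sn n"
    using p by (intro image_eqI[of _ _ "Fperm p"]) (auto simp: Sn_def)
qed (auto simp: Sn_def)

lemma inj_fapp: "inj_on fapp X"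
  by (simp add: fapp_inject inj_on_def)

lemma Sn_bij: "bij_betw fapp (Sn n) {p. p permutes {1..n}}"
  using inj_fapp Sn_image by (simp add: bij_betw_def)

lemma finite_Sn: "finite (Sn n)"
  using bij_betw_finite[OF Sn_bij] finite_permutations[of "{1..n}"] by simp

lemma card_Sn: "card (Sn n) = fact n"
  using bij_betw_same_card[OF Sn_bij] card_permutations[of "{1..n}" n] by simp

lemma Sn_mono: "m \<le> n \<Longrightarrow> g \<in> Sn m \<Longrightarrow> g \<in> Sn n"
  by (auto simp: Sn_def elim: permutes_subset)

lemma Sn_zero [simp]: "0 \<in> Sn n"
  by (simp add: Sn_def fapp_zero permutes_id)

lemma Sn_uminus [simp]: "- g \<in> Sn n \<longleftrightarrow> g \<in> Sn n"
  unfolding Sn_def using permutes_inv fapp_uminus minus_minus by (metis mem_Collect_eq)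

lemma Sn_plus: "g \<in> Sn n \<Longrightarrow> h \<in> Sn n \<Longrightarrow> g + h \<in> Sn n"
  by (simp add: Sn_def fapp_plus permutes_compose)

lemma Sn_plus_left_iff: "g \<in> Sn n \<Longrightarrow> g + h \<in> Sn n \<longleftrightarrow> h \<in> Sn n"
  using Sn_plus[of "- g" n "g + h"] by (auto simp: Sn_plus add.assoc[symmetric])

lemma Sn_plus_right_iff: "h \<in> Sn n \<Longrightarrow> g + h \<in> Sn n \<longleftrightarrow> g \<in> Sn n"
  using Sn_plus[of "g + h" n "- h"] by (auto simp: Sn_plus add.assoc)

lemma Sn_fix: "g \<in> Sn n \<Longrightarrow> n < i \<Longrightarrow> fapp g i = i"
  by (auto simp: Sn_def permutes_def)

lemma Sn_Suc_fix:
  assumes "g \<in> Sn (Suc n)" "fapp g (Suc n) = Suc n"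
  shows "g \<in> Sn n"
proof -
  have p: "fapp g permutes {1..Suc n}"
    using assms(1) by (simp add: Sn_def)
  have "fapp g permutes {1..n}"
    by (rule permutes_superset[OF p]) (use assms(2) in \<open>auto simp: le_Suc_eq\<close>)
  then show ?thesis
    by (simp add: Sn_def)
qed

definition tr :: "nat \<Rightarrow> nat \<Rightarrow> fperm" where
  "tr i j = Fperm (Transposition.transpose i j)"

lemma fapp_tr: "fapp (tr i j) = Transposition.transpose i j"
  unfolding tr_def by (rule fapp_Fperm[of _ "max i j"]) (rule permutes_swap_id, auto)

lemma tr_in_Sn: "1 \<le> i \<Longrightarrow> i \<le> n \<Longrightarrow> 1 \<le> j \<Longrightarrow> j \<le> n \<Longrightarrow> tr i j \<in> Sn n"
  unfolding Sn_def by (simp add: fapp_tr permutes_swap_id)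

lemma tr_tr [simp]: "tr i j + tr i j = 0"
  by (rule fperm_eqI) (simp add: fapp_plus fapp_tr fapp_zero)

lemma conj_tr: "g + tr i j = tr (fapp g i) (fapp g j) + g"
proof (rule fperm_eqI)
  fix k
  have "inj (fapp g)"
    using fapp_bounded[of g] permutes_inj by blast
  then show "fapp (g + tr i j) k = fapp (tr (fapp g i) (fapp g j) + g) k"
    by (simp add: fapp_plus fapp_tr Transposition.transpose_def inj_eq)
qed

section \<open>The group algebra as a real algebra\<close>

instantiation poly_mapping :: (type, real_vector) real_vector
begin

definition scaleR_poly_mapping :: "real \<Rightarrow> ('a \<Rightarrow>\<^sub>0 'b) \<Rightarrow> ('a \<Rightarrow>\<^sub>0 'b)" where
  "scaleR_poly_mapping c x = Poly_Mapping.map (scaleR c) x"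

lemma lookup_scaleR:
  fixes x :: "'a \<Rightarrow>\<^sub>0 'b :: real_vector"
  shows "lookup (c *\<^sub>R x) k = c *\<^sub>R lookup x k"
  by (simp add: scaleR_poly_mapping_def Poly_Mapping.map.rep_eq when_def)

instance
  by standard
    (auto intro!: poly_mapping_eqI simp: lookup_scaleR lookup_add scaleR_add_right scaleR_add_left)

end

lemma lookup_mult_group:
  fixes x y :: "'a :: group_add \<Rightarrow>\<^sub>0 'b :: semiring_0"
  shows "lookup (x * y) k = (\<Sum>h\<in>keys x. lookup x h * lookup y (- h + k))"
proof -
  have "k = l + q \<longleftrightarrow> q = - l + k" for l q :: 'a
    by (metis add.assoc add.left_inverse add.right_inverse add_0)
  then have "lookup (x * y) k = Sum_any (\<lambda>l. lookup x l * lookup y (- l + k))"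
    by (simp add: lookup_mult)
  also have "\<dots> = (\<Sum>h\<in>keys x. lookup x h * lookup y (- h + k))"
    by (rule Sum_any.expand_superset) (auto simp: in_keys_iff)
  finally show ?thesis .
qed

instance poly_mapping :: (group_add, real_algebra) real_algebra
proof
  fix c :: real and x y :: "'a \<Rightarrow>\<^sub>0 'b"
  show "c *\<^sub>R x * y = c *\<^sub>R (x * y)"
  proof (rule poly_mapping_eqI)
    fix k
    have "lookup (c *\<^sub>R x * y) k = (\<Sum>h\<in>keys x. lookup (c *\<^sub>R x) h * lookup y (- h + k))"
      unfolding lookup_mult_group
      by (rule sum.mono_neutral_left) (auto simp: in_keys_iff lookup_scaleR)
    then show "lookup (c *\<^sub>R x * y) k = lookup (c *\<^sub>R (x * y)) k"
      by (simp add: lookup_scaleR lookup_mult_group scaleR_sum_right)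
  qed
  show "x * c *\<^sub>R y = c *\<^sub>R (x * y)"
    by (rule poly_mapping_eqI) (simp add: lookup_scaleR lookup_mult_group scaleR_sum_right)
qed

instance poly_mapping :: (group_add, real_algebra_1) real_algebra_1 ..

type_synonym galg = "fperm \<Rightarrow>\<^sub>0 real"

definition bas :: "fperm \<Rightarrow> galg" where
  "bas g = Poly_Mapping.single g 1"

lemma lookup_bas: "lookup (bas g) h = (if g = h then 1 else 0)"
  by (simp add: bas_def lookup_single when_def)

lemma bas_mult: "bas g * bas h = bas (g + h)"
  by (simp add: bas_def mult_single)

lemma bas_zero: "bas 0 = 1"
  by (simp add: bas_def)

lemma galg_expand: "finite X \<Longrightarrow> keys x \<subseteq> X \<Longrightarrow> x = (\<Sum>g\<in>X. lookup x g *\<^sub>R bas g)"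
  by (rule poly_mapping_eqI)
    (auto simp: lookup_sum lookup_scaleR lookup_bas if_distrib in_keys_iff cong: if_cong)

section \<open>The group algebras of the groups S_n inside the common one\<close>

definition gsub :: "nat \<Rightarrow> galg set" where
  "gsub n = {x. keys x \<subseteq> Sn n}"

lemma gsubI: "(\<And>g. g \<notin> Sn n \<Longrightarrow> lookup x g = 0) \<Longrightarrow> x \<in> gsub n"
  by (auto simp: gsub_def in_keys_iff)

lemma gsubD: "x \<in> gsub n \<Longrightarrow> g \<notin> Sn n \<Longrightarrow> lookup x g = 0"
  by (auto simp: gsub_def in_keys_iff)

lemma bas_in_gsub [simp]: "bas g \<in> gsub n \<longleftrightarrow> g \<in> Sn n"
  by (auto simp: gsub_def bas_def)

lemma gsub_span: "gsub n = span (bas ` Sn n)"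
proof (intro Set.set_eqI iffI)
  fix x assume "x \<in> gsub n"
  then have "x = (\<Sum>g\<in>Sn n. lookup x g *\<^sub>R bas g)"
    by (intro galg_expand finite_Sn) (simp add: gsub_def)
  also have "\<dots> \<in> span (bas ` Sn n)"
    by (intro span_sum span_scale span_base) simp
  finally show "x \<in> span (bas ` Sn n)" .
next
  have "subspace (gsub n)"
    unfolding subspace_def by (auto intro!: gsubI simp: lookup_add lookup_scaleR gsubD)
  moreover have "bas ` Sn n \<subseteq> gsub n"
    by auto
  ultimately show "x \<in> gsub n" if "x \<in> span (bas ` Sn n)" for x
    using that span_minimal by blast
qed

lemma subspace_gsub: "subspace (gsub n)"
  by (simp add: gsub_span)

lemma gsub_diff: "x \<in> gsub n \<Longrightarrow> y \<in> gsub n \<Longrightarrow> x - y \<in> gsub n"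
  by (rule subspace_diff[OF subspace_gsub])

lemma gsub_scaleR: "x \<in> gsub n \<Longrightarrow> c *\<^sub>R x \<in> gsub n"
  by (rule subspace_scale[OF subspace_gsub])

lemma gsub_one: "1 \<in> gsub n"
  using bas_in_gsub[of 0 n] by (simp add: bas_zero)

lemma gsub_mono: "m \<le> n \<Longrightarrow> x \<in> gsub m \<Longrightarrow> x \<in> gsub n"
  using Sn_mono by (auto simp: gsub_def)

lemma UNIV_span: "(UNIV :: galg set) = span (range bas)"
proof -
  have "x \<in> span (range bas)" for x
  proof -
    have "(\<Sum>g\<in>keys x. lookup x g *\<^sub>R bas g) \<in> span (range bas)"
      by (intro span_sum span_scale span_base) simp
    then show ?thesis
      using galg_expand[of "keys x" x] by simp
  qed
  then show ?thesis by auto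
qed

lemma linear_mult_left: "linear (\<lambda>x. a * x :: galg)"
  by (rule linearI) (simp_all add: distrib_left)

lemma linear_mult_right: "linear (\<lambda>x. x * a :: galg)"
  by (rule linearI) (simp_all add: distrib_right)

lemma linear_eq_on_gsub:
  fixes f h :: "galg \<Rightarrow> 'a :: real_vector"
  assumes "linear f" "linear h" "\<And>g. g \<in> Sn n \<Longrightarrow> f (bas g) = h (bas g)" "x \<in> gsub n"
  shows "f x = h x"
  by (rule linear_eq_on[OF assms(1,2) assms(4)[unfolded gsub_span]]) (use assms(3) in auto)

lemma linear_eq_galg:
  fixes f h :: "galg \<Rightarrow> 'a :: real_vector"
  assumes "linear f" "linear h" "\<And>g. f (bas g) = h (bas g)"
  shows "f x = h x"
  by (rule linear_eq_on[OF assms(1,2), of x "range bas"]) (use assms(3) UNIV_span in auto)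

lemma gsub_mult:
  assumes "x \<in> gsub n" "y \<in> gsub n"
  shows "x * y \<in> gsub n"
proof (rule gsubI)
  fix g assume g: "g \<notin> Sn n"
  have "lookup x h * lookup y (- h + g) = 0" if "h \<in> keys x" for h
    using that assms g Sn_plus_left_iff[of "- h" n g] by (auto simp: gsub_def gsubD)
  then show "lookup (x * y) g = 0"
    by (auto simp: lookup_mult_group intro!: sum.neutral)
qed

text \<open>The conditional expectation onto the group algebra of S_n. It is linear over that
  subalgebra on both sides, and it serves to show that products built at a higher level are
  nonzero.\<close>

definition pr :: "nat \<Rightarrow> galg \<Rightarrow> galg" where
  "pr n x = (\<Sum>g\<in>Sn n. lookup x g *\<^sub>R bas g)"

lemma lookup_pr: "lookup (pr n x) g = (if g \<in> Sn n then lookup x g else 0)"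
  by (simp add: pr_def lookup_sum lookup_scaleR lookup_bas if_distrib finite_Sn cong: if_cong)

lemma pr_in_gsub: "pr n x \<in> gsub n"
  by (rule gsubI) (simp add: lookup_pr)

lemma pr_bas: "pr n (bas g) = (if g \<in> Sn n then bas g else 0)"
  by (rule poly_mapping_eqI) (auto simp: lookup_pr lookup_bas)

lemma linear_pr: "linear (pr n)"
  by (rule linearI) (auto intro!: poly_mapping_eqI simp: lookup_pr lookup_add lookup_scaleR)

lemmas pr_add = linear_add[OF linear_pr]
  and pr_diff = linear_diff[OF linear_pr]
  and pr_scaleR = linear_scale[OF linear_pr]
  and pr_sum = linear_sum[OF linear_pr]
  and pr_0 [simp] = linear_0[OF linear_pr]

lemma pr_mult_left:
  assumes "x \<in> gsub n"
  shows "pr n (x * z) = x * pr n z"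
proof (rule linear_eq_on_gsub[OF _ _ _ assms])
  show "linear (\<lambda>x. pr n (x * z))"
    using linear_compose[OF linear_mult_right linear_pr] by (simp add: comp_def)
  fix g assume g: "g \<in> Sn n"
  show "pr n (bas g * z) = bas g * pr n z"
  proof (rule linear_eq_galg[of "\<lambda>z. pr n (bas g * z)" "\<lambda>z. bas g * pr n z" z])
    show "linear (\<lambda>z. pr n (bas g * z))" "linear (\<lambda>z. bas g * pr n z)"
      using linear_compose[OF linear_mult_left linear_pr] linear_compose[OF linear_pr linear_mult_left]
      by (simp_all add: comp_def)
  qed (simp add: bas_mult pr_bas Sn_plus_left_iff[OF g])
qed (rule linear_mult_right)

lemma pr_mult_right:
  assumes "x \<in> gsub n"
  shows "pr n (z * x) = pr n z * x"
proof (rule linear_eq_on_gsub[OF _ _ _ assms])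
  show "linear (\<lambda>x. pr n (z * x))"
    using linear_compose[OF linear_mult_left linear_pr] by (simp add: comp_def)
  fix g assume g: "g \<in> Sn n"
  show "pr n (z * bas g) = pr n z * bas g"
  proof (rule linear_eq_galg[of "\<lambda>z. pr n (z * bas g)" "\<lambda>z. pr n z * bas g" z])
    show "linear (\<lambda>z. pr n (z * bas g))" "linear (\<lambda>z. pr n z * bas g)"
      using linear_compose[OF linear_mult_right linear_pr] linear_compose[OF linear_pr linear_mult_right]
      by (simp_all add: comp_def)
  qed (simp add: bas_mult pr_bas Sn_plus_right_iff[OF g])
qed (rule linear_mult_left)

text \<open>The anti-automorphism that inverts group elements. It fixes the Jucys--Murphy elements
  and therefore exchanges left and right weights, and it provides positivity: the coefficient of
  \<open>x * star x\<close> at the identity is a sum of squares.\<close>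

definition star :: "galg \<Rightarrow> galg" where
  "star x = (\<Sum>g\<in>keys x. lookup x g *\<^sub>R bas (- g))"

lemma lookup_star: "lookup (star x) g = lookup x (- g)"
proof -
  have "- h = g \<longleftrightarrow> h = - g" for h
    by auto
  then show ?thesis
    by (auto simp: star_def lookup_sum lookup_scaleR lookup_bas if_distrib in_keys_iff cong: if_cong)
qed

lemma star_bas: "star (bas g) = bas (- g)"
  by (rule poly_mapping_eqI) (auto simp: lookup_star lookup_bas)

lemma linear_star: "linear star"
  by (rule linearI) (auto intro!: poly_mapping_eqI simp: lookup_star lookup_add lookup_scaleR)

lemma star_mult: "star (x * y) = star y * star x"
proof (rule linear_eq_galg[of "\<lambda>x. star (x * y)" "\<lambda>x. star y * star x" x])
  show "linear (\<lambda>x. star (x * y))" "linear (\<lambda>x. star y * star x)"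
    using linear_compose[OF linear_mult_right linear_star] linear_compose[OF linear_star linear_mult_left]
    by (simp_all add: comp_def)
  fix g
  show "star (bas g * y) = star y * star (bas g)"
  proof (rule linear_eq_galg[of "\<lambda>y. star (bas g * y)" "\<lambda>y. star y * star (bas g)" y])
    show "linear (\<lambda>y. star (bas g * y))" "linear (\<lambda>y. star y * star (bas g))"
      using linear_compose[OF linear_mult_left linear_star] linear_compose[OF linear_star linear_mult_right]
      by (simp_all add: comp_def)
  qed (simp add: bas_mult star_bas minus_add)
qed

lemma star_in_gsub: "x \<in> gsub n \<Longrightarrow> star x \<in> gsub n"
  by (rule gsubI) (simp add: lookup_star gsubD)

lemma lookup_mult_star_pos:
  assumes "x \<noteq> 0"
  shows "0 < lookup (x * star x) 0"
proof -
  have "lookup (x * star x) 0 = (\<Sum>g\<in>keys x. (lookup x g)\<^sup>2)"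
    by (simp add: lookup_mult_group lookup_star power2_eq_square)
  also have "\<dots> > 0"
    using assms by (intro sum_pos) (auto simp: in_keys_iff)
  finally show ?thesis .
qed

section \<open>Jucys--Murphy elements\<close>

definition jm :: "nat \<Rightarrow> galg" where
  "jm k = (\<Sum>i\<in>{1..<k}. bas (tr i k))"

lemma jm_in_gsub: "jm k \<in> gsub k"
  unfolding jm_def by (intro subspace_sum[OF subspace_gsub]) (auto intro!: tr_in_Sn)

lemma star_jm: "star (jm k) = jm k"
proof -
  have "- tr i k = tr i k" for i
    by (metis tr_tr minus_unique)
  then show ?thesis
    by (simp add: jm_def linear_sum[OF linear_star] star_bas)
qed

text \<open>A permutation in S_m fixes \<open>k\<close> and permutes \<open>{1..<k}\<close>, so
  conjugation by it only permutes the summands of \<open>jm k\<close>.\<close>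

lemma jm_commute_gsub:
  assumes "x \<in> gsub m" "m < k"
  shows "x * jm k = jm k * x"
proof (rule linear_eq_on_gsub[OF linear_mult_right linear_mult_left _ assms(1)])
  fix g assume g: "g \<in> Sn m"
  have gk: "fapp g k = k"
    using Sn_fix[OF g assms(2)] .
  have "fapp g permutes {1..m}"
    using g by (simp add: Sn_def)
  then have "fapp g permutes {1..<k}"
    by (rule permutes_subset) (use assms(2) in auto)
  then have bij: "bij_betw (fapp g) {1..<k} {1..<k}"
    by (rule permutes_imp_bij)
  have "bas g * jm k = (\<Sum>i\<in>{1..<k}. bas (tr (fapp g i) k + g))"
    by (simp add: jm_def sum_distrib_left bas_mult conj_tr gk)
  also have "\<dots> = (\<Sum>i\<in>{1..<k}. bas (tr i k + g))"
    by (rule sum.reindex_bij_betw[OF bij])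
  also have "\<dots> = jm k * bas g"
    by (simp add: jm_def sum_distrib_right bas_mult)
  finally show "bas g * jm k = jm k * bas g" .
qed

lemma jm_commute: "jm i * jm j = jm j * jm i"
  using jm_commute_gsub[OF jm_in_gsub, of i j] jm_commute_gsub[OF jm_in_gsub, of j i]
  by (cases i j rule: linorder_cases) auto

section \<open>Coxeter generators and the Hecke relations\<close>

definition cox :: "nat \<Rightarrow> galg" where
  "cox k = bas (tr k (Suc k))"

lemma cox_cox: "cox k * cox k = 1"
  by (simp add: cox_def bas_mult bas_zero)

lemma cox_cox_left: "cox k * (cox k * x) = x"
  by (simp add: mult.assoc[symmetric] cox_cox)

lemma cox_in_gsub: "1 \<le> k \<Longrightarrow> k < n \<Longrightarrow> cox k \<in> gsub n"
  by (simp add: cox_def tr_in_Sn)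

lemma cox_commute_gsub:
  assumes "x \<in> gsub m" "m < k"
  shows "x * cox k = cox k * x"
proof (rule linear_eq_on_gsub[OF linear_mult_right linear_mult_left _ assms(1)])
  fix g assume "g \<in> Sn m"
  then have "fapp g k = k" "fapp g (Suc k) = Suc k"
    using assms(2) by (auto intro!: Sn_fix)
  then show "bas g * cox k = cox k * bas g"
    by (simp add: cox_def bas_mult conj_tr)
qed

text \<open>The relation of the degenerate affine Hecke algebra. Conjugation by the generator turns
  each \<open>tr i (Suc k)\<close> with \<open>i < k\<close> into \<open>tr i k\<close>; the one
  remaining summand of \<open>jm (Suc k)\<close> is the generator itself, whose square is the
  1.\<close>

lemma cox_jm:
  assumes "1 \<le> k"
  shows "cox k * jm (Suc k) = jm k * cox k + 1"
proof -
  have "jm (Suc k) = (\<Sum>i\<in>{1..<k}. bas (tr i (Suc k))) + cox k"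
    using assms by (simp add: jm_def cox_def)
  then have "cox k * jm (Suc k) = (\<Sum>i\<in>{1..<k}. bas (tr k (Suc k) + tr i (Suc k))) + 1"
    by (simp add: distrib_left cox_cox sum_distrib_left) (simp add: cox_def bas_mult)
  also have "(\<Sum>i\<in>{1..<k}. bas (tr k (Suc k) + tr i (Suc k))) = (\<Sum>i\<in>{1..<k}. bas (tr i k + tr k (Suc k)))"
  proof (intro sum.cong refl)
    fix i assume "i \<in> {1..<k}"
    then show "bas (tr k (Suc k) + tr i (Suc k)) = bas (tr i k + tr k (Suc k))"
      by (subst conj_tr) (simp add: fapp_tr Transposition.transpose_def)
  qed
  also have "\<dots> = jm k * cox k"
    by (simp add: jm_def cox_def sum_distrib_right bas_mult)
  finally show ?thesis .
qed

lemma jm_cox: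
  assumes "1 \<le> k"
  shows "jm (Suc k) * cox k = cox k * jm k + 1"
proof -
  have "cox k * (cox k * jm (Suc k)) * cox k = cox k * (jm k * cox k + 1) * cox k"
    by (simp only: cox_jm[OF assms])
  then show ?thesis
    by (simp add: cox_cox_left algebra_simps cox_cox)
qed

lemma cox_jm_commute:
  assumes "1 \<le> k" "i \<noteq> k" "i \<noteq> Suc k"
  shows "cox k * jm i = jm i * cox k"
proof (cases "i < k")
  case True
  then show ?thesis
    using cox_commute_gsub[OF jm_in_gsub] by simp
next
  case False
  then show ?thesis
    using assms jm_commute_gsub[of "cox k" "Suc k" i] cox_in_gsub[of k "Suc k"] by simp
qed

text \<open>Conjugation by the generator renames the point \<open>Suc m\<close> to
  \<open>Suc (Suc m)\<close>. The result stays in S_(m+1) only if \<open>g\<close> fixes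
  \<open>Suc m\<close>, and then \<open>g\<close> commutes with the generator.\<close>

lemma pr_cox_conj:
  assumes "y \<in> gsub (Suc m)"
  shows "pr (Suc m) (cox (Suc m) * y * cox (Suc m)) = pr m y"
proof (rule linear_eq_on_gsub[OF _ linear_pr _ assms])
  show "linear (\<lambda>y. pr (Suc m) (cox (Suc m) * y * cox (Suc m)))"
    by (rule linearI) (simp_all add: distrib_left distrib_right pr_add pr_scaleR)
  fix g assume g: "g \<in> Sn (Suc m)"
  let ?t = "tr (Suc m) (Suc (Suc m))"
  have eq: "cox (Suc m) * bas g * cox (Suc m) = bas (?t + g + ?t)"
    by (simp add: cox_def bas_mult)
  show "pr (Suc m) (cox (Suc m) * bas g * cox (Suc m)) = pr m (bas g)"
  proof (cases "g \<in> Sn m")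
    case True
    then have "g + ?t = ?t + g"
      by (simp add: conj_tr Sn_fix)
    then have "?t + g + ?t = g"
      by (metis add.assoc add.right_neutral tr_tr)
    then show ?thesis
      using True g by (simp add: eq pr_bas)
  next
    case False
    have *: "fapp g (Suc m) \<noteq> Suc m"
      using False g Sn_Suc_fix by blast
    have "fapp g permutes {1..Suc m}"
      using g by (simp add: Sn_def)
    then have "fapp g (Suc m) \<in> {1..Suc m}"
      using permutes_in_image by fastforce
    then have "fapp (?t + g + ?t) (Suc (Suc m)) = fapp g (Suc m)" "fapp g (Suc m) \<noteq> Suc (Suc m)"
      using * by (auto simp: fapp_plus fapp_tr Transposition.transpose_def)
    then have "?t + g + ?t \<notin> Sn (Suc m)"
      using Sn_fix[of "?t + g + ?t" "Suc m" "Suc (Suc m)"] by auto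
    then show ?thesis
      using False by (simp add: eq pr_bas)
  qed
qed

section \<open>Moments of a Jucys--Murphy element and symmetrizers\<close>

lemma pr_jm: "pr n (jm (Suc n)) = 0"
proof -
  have "tr i (Suc n) \<notin> Sn n" if "i \<in> {1..<Suc n}" for i
    using that Sn_fix[of "tr i (Suc n)" n "Suc n"] by (auto simp: fapp_tr)
  then show ?thesis
    unfolding jm_def pr_sum by (intro sum.neutral ballI) (simp add: pr_bas)
qed

text \<open>A product of two transpositions \<open>tr i (Suc n)\<close> and
  \<open>tr j (Suc n)\<close> moves \<open>Suc n\<close> unless \<open>i = j\<close>, when it is the
  identity. So exactly \<open>n\<close> of the products survive the projection.\<close>

lemma pr_jm_squared: "pr n (jm (Suc n) * jm (Suc n)) = real n *\<^sub>R 1"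
proof -
  have *: "pr n (bas (tr i (Suc n) + tr j (Suc n))) = (if i = j then 1 else 0)"
    if "i \<in> {1..<Suc n}" "j \<in> {1..<Suc n}" for i j
  proof (cases "i = j")
    case False
    then have "fapp (tr i (Suc n) + tr j (Suc n)) (Suc n) = j" "j \<noteq> Suc n"
      using that by (auto simp: fapp_plus fapp_tr Transposition.transpose_def)
    then have "tr i (Suc n) + tr j (Suc n) \<notin> Sn n"
      using Sn_fix[of "tr i (Suc n) + tr j (Suc n)" n "Suc n"] by auto
    then show ?thesis
      using False by (simp add: pr_bas)
  qed (simp add: pr_bas bas_zero[symmetric])
  have "pr n (jm (Suc n) * jm (Suc n)) = (\<Sum>i\<in>{1..<Suc n}. \<Sum>j\<in>{1..<Suc n}. pr n (bas (tr i (Suc n) + tr j (Suc n))))"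
    by (simp only: jm_def sum_product bas_mult pr_sum)
  also have "\<dots> = (\<Sum>i\<in>{1..<Suc n}. \<Sum>j\<in>{1..<Suc n}. if i = j then 1 else 0)"
    by (intro sum.cong refl *)
  also have "\<dots> = (\<Sum>i\<in>{1..<Suc n}. 1)"
    by (intro sum.cong refl) (simp add: sum.delta)
  also have "\<dots> = real n *\<^sub>R 1"
    by (simp add: scaleR_conv_of_real)
  finally show ?thesis .
qed

text \<open>Every transposition multiplies \<open>x\<close> by \<open>e\<close>, and
  \<open>jm k\<close> is a sum of \<open>k - 1\<close> transpositions. The trivial character and the
  sign character are the cases \<open>e = 1\<close> and \<open>e = - 1\<close>.\<close>

lemma symmetrizer_jm:
  fixes \<epsilon> :: "fperm \<Rightarrow> real" and e :: real
  assumes mult: "\<And>g i j. g \<in> Sn n \<Longrightarrow> 1 \<le> i \<Longrightarrow> i < j \<Longrightarrow> j \<le> n \<Longrightarrow>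
      \<epsilon> (g + tr i j) = e * \<epsilon> g \<and> \<epsilon> (tr i j + g) = e * \<epsilon> g"
    and x: "x = (\<Sum>g\<in>Sn n. \<epsilon> g *\<^sub>R bas g)" and k: "1 \<le> k" "k \<le> n" and e: "e * e = 1"
  shows "x * jm k = (e * (real k - 1)) *\<^sub>R x" "jm k * x = (e * (real k - 1)) *\<^sub>R x"
proof -
  have e': "c = e * (e * c)" for c
    by (simp add: mult.assoc[symmetric] e)
  have right: "x * bas (tr i j) = e *\<^sub>R x" and left: "bas (tr i j) * x = e *\<^sub>R x"
    if ij: "1 \<le> i" "i < j" "j \<le> n" for i j
  proof -
    have t: "tr i j \<in> Sn n"
      using ij by (intro tr_in_Sn) auto
    have inv: "g + tr i j + tr i j = g" "tr i j + (tr i j + g) = g" for g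
      by (simp add: add.assoc, simp add: add.assoc[symmetric])
    have "x * bas (tr i j) = (\<Sum>g\<in>Sn n. \<epsilon> g *\<^sub>R bas (g + tr i j))"
      by (simp add: x sum_distrib_right bas_mult)
    also have "\<dots> = (\<Sum>g\<in>Sn n. (e * \<epsilon> g) *\<^sub>R bas g)"
      using mult[OF _ ij] e' inv t
      by (intro sum.reindex_bij_witness[of _ "\<lambda>g. g + tr i j" "\<lambda>g. g + tr i j"]) (auto simp: Sn_plus)
    finally show "x * bas (tr i j) = e *\<^sub>R x"
      by (simp add: x scaleR_sum_right)
    have "bas (tr i j) * x = (\<Sum>g\<in>Sn n. \<epsilon> g *\<^sub>R bas (tr i j + g))"
      by (simp add: x sum_distrib_left bas_mult)
    also have "\<dots> = (\<Sum>g\<in>Sn n. (e * \<epsilon> g) *\<^sub>R bas g)"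
      using mult[OF _ ij] e' inv t
      by (intro sum.reindex_bij_witness[of _ "\<lambda>g. tr i j + g" "\<lambda>g. tr i j + g"]) (auto simp: Sn_plus)
    finally show "bas (tr i j) * x = e *\<^sub>R x"
      by (simp add: x scaleR_sum_right)
  qed
  have "(\<Sum>i\<in>{1..<k}. e *\<^sub>R x) = (e * (real k - 1)) *\<^sub>R x"
    using k by (simp add: sum_constant_scaleR algebra_simps of_nat_diff del: sum_constant)
  moreover have "x * jm k = (\<Sum>i\<in>{1..<k}. e *\<^sub>R x)"
    unfolding jm_def sum_distrib_left using k by (intro sum.cong refl right) auto
  moreover have "jm k * x = (\<Sum>i\<in>{1..<k}. e *\<^sub>R x)"
    unfolding jm_def sum_distrib_right using k by (intro sum.cong refl left) auto
  ultimately show "x * jm k = (e * (real k - 1)) *\<^sub>R x" "jm k * x = (e * (real k - 1)) *\<^sub>R x"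
    by simp_all
qed

definition sgn_fperm :: "fperm \<Rightarrow> real" where
  "sgn_fperm g = of_int (sign (fapp g))"

lemma sgn_fperm_plus: "sgn_fperm (g + h) = sgn_fperm g * sgn_fperm h"
proof -
  have "permutation (fapp g)" for g
    using fapp_bounded[of g] permutation_permutes by blast
  then show ?thesis
    by (simp add: sgn_fperm_def fapp_plus sign_compose)
qed

lemma sgn_fperm_tr: "i \<noteq> j \<Longrightarrow> sgn_fperm (tr i j) = - 1"
  by (simp add: sgn_fperm_def fapp_tr sign_swap_id)

section \<open>Weight spaces\<close>

text \<open>If \<open>l\<close> separates \<open>k0\<close> from \<open>k\<close>, then applying
  \<open>f l\<close> minus the scalar \<open>a l k0\<close> removes \<open>u k0\<close> from the
  vanishing sum and leaves a nonzero multiple of \<open>u k\<close>. Speaking of a vanishing sum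
  instead of a set of vectors allows some of them to be zero.\<close>

lemma joint_eigenvectors_independent:
  fixes u :: "'k \<Rightarrow> 'v :: real_vector" and f :: "'l \<Rightarrow> 'v \<Rightarrow> 'v"
  assumes "finite K" "\<And>l. l \<in> I \<Longrightarrow> linear (f l)"
    and "\<And>k l. k \<in> K \<Longrightarrow> l \<in> I \<Longrightarrow> f l (u k) = a l k *\<^sub>R u k"
    and "\<And>k k'. k \<in> K \<Longrightarrow> k' \<in> K \<Longrightarrow> k \<noteq> k' \<Longrightarrow> \<exists>l\<in>I. a l k \<noteq> a l k'"
    and "(\<Sum>k\<in>K. u k) = 0" "k \<in> K"
  shows "u k = 0"
  using assms(1,3-6)
proof (induction K arbitrary: u k rule: finite_induct)
  case (insert k0 F)
  have F: "u k = 0" if k: "k \<in> F" for k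
  proof -
    obtain l where l: "l \<in> I" "a l k0 \<noteq> a l k"
      using insert.prems(2)[of k0 k] insert.hyps(2) k by blast
    have "(\<Sum>k\<in>F. (a l k - a l k0) *\<^sub>R u k) = (\<Sum>k\<in>insert k0 F. (a l k - a l k0) *\<^sub>R u k)"
      using insert.hyps by simp
    also have "\<dots> = (\<Sum>k\<in>insert k0 F. f l (u k) - a l k0 *\<^sub>R u k)"
      by (intro sum.cong refl) (use insert.prems(1) l in \<open>simp add: scaleR_diff_left\<close>)
    also have "\<dots> = f l (\<Sum>k\<in>insert k0 F. u k) - a l k0 *\<^sub>R (\<Sum>k\<in>insert k0 F. u k)"
      by (simp only: sum_subtractf scaleR_sum_right linear_sum[OF assms(2)[OF l(1)]])
    also have "\<dots> = 0"
      using insert.prems(3) linear_0[OF assms(2)[OF l(1)]] by simp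
    finally have "(a l k - a l k0) *\<^sub>R u k = 0"
    proof (rule insert.IH[rotated 2])
      fix k' l' assume "k' \<in> F" "l' \<in> I"
      then show "f l' ((a l k' - a l k0) *\<^sub>R u k') = a l' k' *\<^sub>R (a l k' - a l k0) *\<^sub>R u k'"
        using insert.prems(1) by (simp add: linear_scale[OF assms(2)])
    qed (use k insert.prems(2) in auto)
    then show ?thesis
      using l(2) by simp
  qed
  then have "u k0 = 0"
    using insert.prems(3) insert.hyps by simp
  then show ?case
    using F insert.prems(4) by blast
qed simp

text \<open>The earlier boxes determine the current shape, and boxes addable to one shape have
  different contents. Hence the Jucys--Murphy eigenvalues determine the tableau.\<close>

lemma growth_eq_if_content_eq:
  assumes "growth bs" "growth cs" "length bs = length cs"
    "\<And>i. i < length bs \<Longrightarrow> box_content (bs ! i) = box_content (cs ! i)"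
  shows "bs = cs"
  using assms
proof (induction bs arbitrary: cs rule: rev_induct)
  case (snoc b bs)
  then obtain cs' c where cs: "cs = cs' @ [c]"
    by (metis append_is_Nil_conv length_0_conv not_Cons_self2 rev_exhaust)
  have len: "length bs = length cs'"
    using snoc.prems(3) cs by simp
  have "bs = cs'"
  proof (rule snoc.IH)
    show "box_content (bs ! i) = box_content (cs' ! i)" if "i < length bs" for i
      using snoc.prems(4)[of i] that len by (simp add: cs nth_append)
  qed (use snoc.prems cs len growth_snoc in auto)
  moreover have "box_content b = box_content c"
    using snoc.prems(4)[of "length bs"] len by (simp add: cs nth_append)
  moreover have "b \<in> addable (set bs)" "c \<in> addable (set cs')"
    using snoc.prems(1,2) by (simp_all add: cs growth_snoc)
  ultimately show ?case
    using addable_content_inj cs by metis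
qed simp

text \<open>Entry \<open>i + 1\<close> of the tableau sits in the box \<open>S ! i\<close>, hence
  the shift in the index of \<open>jm\<close>. Only the first \<open>length S\<close> Jucys--Murphy
  elements are constrained, so a weight of a small tableau also makes sense for elements of larger
  group algebras.\<close>

definition left_wt :: "(nat \<times> nat) list \<Rightarrow> galg \<Rightarrow> bool" where
  "left_wt S x \<longleftrightarrow> (\<forall>i<length S. jm (Suc i) * x = box_content (S ! i) *\<^sub>R x)"

definition right_wt :: "(nat \<times> nat) list \<Rightarrow> galg \<Rightarrow> bool" where
  "right_wt T x \<longleftrightarrow> (\<forall>i<length T. x * jm (Suc i) = box_content (T ! i) *\<^sub>R x)"

definition wt_space :: "nat \<Rightarrow> (nat \<times> nat) list \<Rightarrow> (nat \<times> nat) list \<Rightarrow> galg set" where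
  "wt_space n S T = {x \<in> gsub n. left_wt S x \<and> right_wt T x}"

definition gpairs :: "nat \<Rightarrow> ((nat \<times> nat) list \<times> (nat \<times> nat) list) set" where
  "gpairs n = (\<Union>D\<in>diagrams n. growths D \<times> growths D)"

definition wt_occurs :: "nat \<Rightarrow> (nat \<times> nat) list \<Rightarrow> (nat \<times> nat) list \<Rightarrow> bool" where
  "wt_occurs n S T \<longleftrightarrow> (\<exists>x\<in>wt_space n S T. x \<noteq> 0)"

definition full :: "nat \<Rightarrow> bool" where
  "full n \<longleftrightarrow> (\<forall>(S, T)\<in>gpairs n. wt_occurs n S T)"

definition growths_len :: "nat \<Rightarrow> (nat \<times> nat) list set" where
  "growths_len n = {T. growth T \<and> length T = n}"

lemma gpairs_iff: "(S, T) \<in> gpairs n \<longleftrightarrow> S \<in> growths_len n \<and> T \<in> growths_len n \<and> set S = set T"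
proof
  assume "S \<in> growths_len n \<and> T \<in> growths_len n \<and> set S = set T"
  then have "S \<in> growths (set S)" "T \<in> growths (set S)" "set S \<in> diagrams n"
    by (auto simp: growths_len_def growths_def diagrams_def growth_diagram distinct_card growth_distinct)
  then show "(S, T) \<in> gpairs n"
    by (auto simp: gpairs_def)
qed (auto simp: gpairs_def growths_len_def diagrams_def dest: growths_length, auto simp: growths_def)

lemma finite_gpairs: "finite (gpairs n)"
  unfolding gpairs_def by (intro finite_UN_I finite_diagrams finite_cartesian_product finite_growths)

lemma card_gpairs: "card (gpairs n) = fact n"
proof -
  have "card (gpairs n) = (\<Sum>D\<in>diagrams n. card (growths D \<times> growths D))"
    unfolding gpairs_def
    by (rule card_UN_disjoint) (auto simp: finite_diagrams finite_growths, auto simp: growths_def)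
  then show ?thesis
    using sum_card_growths_squared[of n] by (simp add: card_cartesian_product power2_eq_square)
qed

lemma finite_growths_len: "finite (growths_len n)"
proof (rule finite_subset)
  show "growths_len n \<subseteq> fst ` gpairs n"
    using gpairs_iff by force
qed (simp add: finite_gpairs)

lemma left_wt_snoc: "left_wt (S @ [b]) x \<longleftrightarrow> left_wt S x \<and> jm (Suc (length S)) * x = box_content b *\<^sub>R x"
  by (auto simp: left_wt_def nth_append less_Suc_eq)

lemma right_wt_snoc: "right_wt (T @ [b]) x \<longleftrightarrow> right_wt T x \<and> x * jm (Suc (length T)) = box_content b *\<^sub>R x"
  by (auto simp: right_wt_def nth_append less_Suc_eq)

lemma star_wt_space:
  assumes "x \<in> wt_space n S T"
  shows "star x \<in> wt_space n T S"
proof -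
  have "star (jm i * x) = star x * jm i" "star (x * jm i) = jm i * star x" for i
    by (simp_all add: star_mult star_jm)
  then show ?thesis
    using assms unfolding wt_space_def left_wt_def right_wt_def
    by (auto simp: star_in_gsub) (metis linear_scale[OF linear_star])+
qed

lemma star_nonzero: "x \<noteq> 0 \<Longrightarrow> star x \<noteq> 0"
  using lookup_mult_star_pos[of x] by fastforce

section \<open>Weight vectors as a basis of the group algebra\<close>

lemma wt_space_independent:
  assumes u: "\<And>S T. (S, T) \<in> gpairs n \<Longrightarrow> u (S, T) \<in> wt_space n S T"
    and sum: "(\<Sum>p\<in>gpairs n. u p) = 0" and p: "p \<in> gpairs n"
  shows "u p = 0"
proof (rule joint_eigenvectors_independent[OF finite_gpairs _ _ _ sum p])
  \<comment> \<open>The commuting operators are indexed by a position \<open>i\<close> and a flag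
    \<open>r\<close> for the side from which \<open>jm (Suc i)\<close> acts.\<close>
  let ?f = "\<lambda>(i, r) x. if r then x * jm (Suc i) else jm (Suc i) * x"
  let ?a = "\<lambda>(i, r) (S, T). if r then box_content (T ! i) else box_content (S ! i)"
  fix l assume "l \<in> {..<n} \<times> (UNIV :: bool set)"
  then show "linear (?f l)"
    by (cases l; cases "snd l") (simp_all add: linear_mult_left linear_mult_right)
next
  fix p l assume "p \<in> gpairs n" and "l \<in> {..<n} \<times> (UNIV :: bool set)"
  then show "(case l of (i, r) \<Rightarrow> \<lambda>x. if r then x * jm (Suc i) else jm (Suc i) * x) (u p) =
      (case l of (i, r) \<Rightarrow> \<lambda>(S, T). if r then box_content (T ! i) else box_content (S ! i)) p *\<^sub>R u p"
    using u by (cases p; cases l) (auto simp: wt_space_def left_wt_def right_wt_def gpairs_iff growths_len_def)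
next
  fix p p' assume *: "p \<in> gpairs n" "p' \<in> gpairs n" "p \<noteq> p'"
  obtain S T S' T' where p: "p = (S, T)" "p' = (S', T')"
    by fastforce
  have len: "length S = n" "length T = n" "length S' = n" "length T' = n"
    and g: "growth S" "growth T" "growth S'" "growth T'"
    using * by (auto simp: p gpairs_iff growths_len_def)
  have "S \<noteq> S' \<or> T \<noteq> T'"
    using * p by auto
  then have "(\<exists>i<n. box_content (S ! i) \<noteq> box_content (S' ! i)) \<or> (\<exists>i<n. box_content (T ! i) \<noteq> box_content (T' ! i))"
    using growth_eq_if_content_eq[of S S'] growth_eq_if_content_eq[of T T'] g len by auto
  then show "\<exists>l\<in>{..<n} \<times> (UNIV :: bool set).
      (case l of (i, r) \<Rightarrow> \<lambda>(S, T). if r then box_content (T ! i) else box_content (S ! i)) p \<noteq>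
      (case l of (i, r) \<Rightarrow> \<lambda>(S, T). if r then box_content (T ! i) else box_content (S ! i)) p'"
  proof
    assume "\<exists>i<n. box_content (S ! i) \<noteq> box_content (S' ! i)"
    then obtain i where "i < n" "box_content (S ! i) \<noteq> box_content (S' ! i)"
      by blast
    then show ?thesis
      by (intro bexI[of _ "(i, False)"]) (auto simp: p)
  next
    assume "\<exists>i<n. box_content (T ! i) \<noteq> box_content (T' ! i)"
    then obtain i where "i < n" "box_content (T ! i) \<noteq> box_content (T' ! i)"
      by blast
    then show ?thesis
      by (intro bexI[of _ "(i, True)"]) (auto simp: p)
  qed
qed

lemma wt_space_scaleR: "x \<in> wt_space n S T \<Longrightarrow> c *\<^sub>R x \<in> wt_space n S T"
  by (auto simp: wt_space_def left_wt_def right_wt_def gsub_scaleR scaleR_left_commute)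

text \<open>By \<open>card_gpairs\<close> there are as many weight vectors as group elements. An
  \<open>x\<close> outside their span would give \<open>fact n + 1\<close> independent elements in a
  space spanned by \<open>fact n\<close>.\<close>

lemma wt_basis_expand:
  assumes e: "\<And>S T. (S, T) \<in> gpairs n \<Longrightarrow> e (S, T) \<in> wt_space n S T \<and> e (S, T) \<noteq> 0"
    and x: "x \<in> gsub n"
  obtains c where "x = (\<Sum>p\<in>gpairs n. c p *\<^sub>R e p)"
proof -
  have coeff: "c p = 0" if "(\<Sum>p\<in>gpairs n. c p *\<^sub>R e p) = 0" "p \<in> gpairs n" for c p
  proof -
    have "c p *\<^sub>R e p = 0"
      by (rule wt_space_independent[of n "\<lambda>p. c p *\<^sub>R e p"]) (use that e wt_space_scaleR in auto)
    then show ?thesis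
      using e that(2) by (cases p) auto
  qed
  have inj: "inj_on e (gpairs n)"
  proof (rule inj_onI, rule ccontr)
    fix p q assume pq: "p \<in> gpairs n" "q \<in> gpairs n" "e p = e q" "p \<noteq> q"
    let ?c = "\<lambda>r. if r = p then 1 else if r = q then - 1 else 0 :: real"
    have "(\<Sum>r\<in>gpairs n. ?c r *\<^sub>R e r) = (\<Sum>r\<in>{p, q}. ?c r *\<^sub>R e r)"
      by (rule sum.mono_neutral_right) (use pq finite_gpairs in auto)
    then have "(\<Sum>r\<in>gpairs n. ?c r *\<^sub>R e r) = 0"
      using pq by simp
    then show False
      using coeff[of ?c p] pq by simp
  qed
  have ind: "independent (e ` gpairs n)"
  proof (rule independent_if_scalars_zero)
    fix f v assume f: "(\<Sum>v\<in>e ` gpairs n. f v *\<^sub>R v) = 0" "v \<in> e ` gpairs n"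
    then have "(\<Sum>p\<in>gpairs n. f (e p) *\<^sub>R e p) = 0"
      by (simp add: sum.reindex[OF inj])
    then show "f v = 0"
      using coeff[of "\<lambda>p. f (e p)"] f(2) by auto
  qed (simp add: finite_gpairs)
  have sub: "e ` gpairs n \<subseteq> span (bas ` Sn n)"
    using e by (fastforce simp: wt_space_def gsub_span[symmetric])
  have "x \<in> span (e ` gpairs n)"
  proof (rule ccontr)
    assume nx: "x \<notin> span (e ` gpairs n)"
    then have "independent (insert x (e ` gpairs n))"
      using ind by (rule independent_insertI)
    then have "card (insert x (e ` gpairs n)) \<le> card (bas ` Sn n)"
      using independent_span_bound[of "bas ` Sn n" "insert x (e ` gpairs n)"] sub x
      by (auto simp: finite_Sn gsub_span)
    also have "\<dots> \<le> fact n"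
      using card_image_le[OF finite_Sn, of bas n] by (simp add: card_Sn)
    finally have "card (insert x (e ` gpairs n)) \<le> fact n" .
    moreover have "x \<notin> e ` gpairs n"
      using nx span_base by blast
    ultimately show False
      by (simp add: finite_gpairs card_image[OF inj] card_gpairs)
  qed
  then obtain f where "x = (\<Sum>v\<in>e ` gpairs n. f v *\<^sub>R v)"
    using span_finite[of "e ` gpairs n"] finite_gpairs by auto
  then have "x = (\<Sum>p\<in>gpairs n. f (e p) *\<^sub>R e p)"
    by (simp add: sum.reindex[OF inj])
  then show ?thesis
    by (rule that)
qed

text \<open>The commutator of 1 with \<open>jm (Suc i)\<close> vanishes, and it multiplies the
  \<open>(S, T)\<close> term of the expansion by the difference of the contents of
  \<open>S ! i\<close> and \<open>T ! i\<close>. For \<open>S \<noteq> T\<close> some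
  \<open>i\<close> makes this factor nonzero, so the term is zero.\<close>

lemma one_expand:
  assumes e: "\<And>S T. (S, T) \<in> gpairs n \<Longrightarrow> e (S, T) \<in> wt_space n S T \<and> e (S, T) \<noteq> 0"
  obtains c where "1 = (\<Sum>T\<in>growths_len n. c T *\<^sub>R e (T, T))"
proof -
  obtain c where c: "1 = (\<Sum>p\<in>gpairs n. c p *\<^sub>R e p)"
    using wt_basis_expand[OF e gsub_one] by blast
  have off: "c (S, T) *\<^sub>R e (S, T) = 0" if ST: "(S, T) \<in> gpairs n" "S \<noteq> T" for S T
  proof -
    obtain i where i: "i < n" "box_content (S ! i) \<noteq> box_content (T ! i)"
      using growth_eq_if_content_eq[of S T] ST by (auto simp: gpairs_iff growths_len_def)
    let ?d = "\<lambda>p. box_content (fst p ! i) - box_content (snd p ! i)"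
    have "?d p *\<^sub>R c p *\<^sub>R e p = c p *\<^sub>R (jm (Suc i) * e p - e p * jm (Suc i))" if "p \<in> gpairs n" for p
    proof -
      obtain S' T' where p: "p = (S', T')"
        by fastforce
      have "jm (Suc i) * e p = box_content (S' ! i) *\<^sub>R e p" "e p * jm (Suc i) = box_content (T' ! i) *\<^sub>R e p"
        using e[of S' T'] that i(1)
        by (auto simp: p wt_space_def left_wt_def right_wt_def gpairs_iff growths_len_def)
      then show ?thesis
        by (simp add: p algebra_simps)
    qed
    then have "(\<Sum>p\<in>gpairs n. ?d p *\<^sub>R c p *\<^sub>R e p) =
        (\<Sum>p\<in>gpairs n. c p *\<^sub>R (jm (Suc i) * e p - e p * jm (Suc i)))"
      by (rule sum.cong[OF refl])
    also have "\<dots> = jm (Suc i) * (\<Sum>p\<in>gpairs n. c p *\<^sub>R e p) - (\<Sum>p\<in>gpairs n. c p *\<^sub>R e p) * jm (Suc i)"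
      by (simp add: sum_distrib_left sum_distrib_right scaleR_diff_right sum_subtractf)
    also have "\<dots> = 0"
      by (simp add: c[symmetric])
    finally have sum: "(\<Sum>p\<in>gpairs n. ?d p *\<^sub>R c p *\<^sub>R e p) = 0" .
    have "?d (S, T) *\<^sub>R c (S, T) *\<^sub>R e (S, T) = 0"
      by (rule wt_space_independent[OF _ sum ST(1)]) (use e wt_space_scaleR in blast)
    then show ?thesis
      using i(2) by simp
  qed
  have "(\<Sum>p\<in>gpairs n. c p *\<^sub>R e p) = (\<Sum>p\<in>(\<lambda>T. (T, T)) ` growths_len n. c p *\<^sub>R e p)"
  proof (rule sum.mono_neutral_right)
    show "\<forall>p\<in>gpairs n - (\<lambda>T. (T, T)) ` growths_len n. c p *\<^sub>R e p = 0"
    proof clarify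
      fix S T assume *: "(S, T) \<in> gpairs n" "(S, T) \<notin> (\<lambda>T. (T, T)) ` growths_len n"
      then have "S \<noteq> T"
        by (auto simp: gpairs_iff)
      then show "c (S, T) *\<^sub>R e (S, T) = 0"
        by (rule off[OF *(1)])
    qed
  qed (auto simp: gpairs_iff finite_gpairs)
  also have "\<dots> = (\<Sum>T\<in>growths_len n. c (T, T) *\<^sub>R e (T, T))"
    by (subst sum.reindex) (auto simp: inj_on_def)
  finally show ?thesis
    using that[of "\<lambda>T. c (T, T)"] c by simp
qed

section \<open>Products of weight vectors\<close>

lemma full_family:
  assumes "full n"
  obtains e where "\<And>S T. (S, T) \<in> gpairs n \<Longrightarrow> e (S, T) \<in> wt_space n S T \<and> e (S, T) \<noteq> 0"
proof -
  have "\<exists>x. x \<in> wt_space n (fst p) (snd p) \<and> x \<noteq> 0" if "p \<in> gpairs n" for p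
    using assms that unfolding full_def wt_occurs_def by (cases p) auto
  then obtain e where "\<And>p. p \<in> gpairs n \<Longrightarrow> e p \<in> wt_space n (fst p) (snd p) \<and> e p \<noteq> 0"
    by metis
  then show ?thesis
    using that[of e] by fastforce
qed

text \<open>In \<open>x * jm (Suc i) * y\<close> the middle factor can be absorbed on either side,
  with two different scalars if the contents at position \<open>i\<close> differ.\<close>

lemma mult_eq_0_if_weights_differ:
  assumes "right_wt R x" "left_wt S y" "growth R" "growth S" "length R \<le> length S"
    "take (length R) S \<noteq> R"
  shows "x * y = 0"
proof -
  obtain i where i: "i < length R" "box_content (S ! i) \<noteq> box_content (R ! i)"
    using growth_eq_if_content_eq[OF growth_take[OF assms(4), of "length R"] assms(3)] assms(5,6)
    by auto
  have "box_content (R ! i) *\<^sub>R (x * y) = x * jm (Suc i) * y"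
    using assms(1) i(1) by (simp add: right_wt_def)
  also have "\<dots> = box_content (S ! i) *\<^sub>R (x * y)"
    using assms(2,5) i(1) by (simp add: left_wt_def mult.assoc)
  finally have "(box_content (R ! i) - box_content (S ! i)) *\<^sub>R (x * y) = 0"
    by (simp add: scaleR_diff_left)
  then show ?thesis
    using i(2) by simp
qed

text \<open>With a basis whose \<open>(R, R)\<close> member is \<open>y\<close> itself, only that
  member of the expansion of 1 survives multiplication by \<open>x\<close>, so \<open>x\<close> is a
  multiple of \<open>x * y\<close>. The vector \<open>x\<close> may come from a larger group
  algebra, as it does in \<open>wt_occurs_two_corners\<close>.\<close>

lemma mult_diagonal_nonzero:
  assumes "full n" "R \<in> growths_len n" "right_wt R x" "x \<noteq> 0" "y \<in> wt_space n R R" "y \<noteq> 0"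
  shows "x * y \<noteq> 0"
proof -
  obtain e0 where e0: "\<And>S T. (S, T) \<in> gpairs n \<Longrightarrow> e0 (S, T) \<in> wt_space n S T \<and> e0 (S, T) \<noteq> 0"
    using full_family[OF assms(1)] by blast
  define e where "e = e0((R, R) := y)"
  have e: "e (S, T) \<in> wt_space n S T \<and> e (S, T) \<noteq> 0" if "(S, T) \<in> gpairs n" for S T
    using e0[OF that] assms(5,6) by (auto simp: e_def)
  obtain c where c: "1 = (\<Sum>T\<in>growths_len n. c T *\<^sub>R e (T, T))"
    using one_expand[OF e] by blast
  have zero: "x * e (T, T) = 0" if "T \<in> growths_len n" "T \<noteq> R" for T
  proof (rule mult_eq_0_if_weights_differ[OF assms(3)])
    show "left_wt T (e (T, T))"
      using e[of T T] that by (auto simp: gpairs_iff wt_space_def)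
  qed (use that assms(2) in \<open>auto simp: growths_len_def\<close>)
  have "x = x * (\<Sum>T\<in>growths_len n. c T *\<^sub>R e (T, T))"
    by (simp add: c[symmetric])
  also have "\<dots> = (\<Sum>T\<in>growths_len n. c T *\<^sub>R (x * e (T, T)))"
    by (simp add: sum_distrib_left)
  also have "\<dots> = (\<Sum>T\<in>{R}. c T *\<^sub>R (x * e (T, T)))"
    by (rule sum.mono_neutral_right) (use zero assms(2) finite_growths_len in auto)
  finally have "x = c R *\<^sub>R (x * y)"
    by (simp add: e_def)
  then show ?thesis
    using assms(4) by auto
qed

text \<open>The expansion of 1 is taken one level above \<open>R\<close>. Its member for
  \<open>S @ [b]\<close> is killed by \<open>x\<close> unless \<open>S = R\<close>; then
  \<open>b\<close> is addable to \<open>R\<close>, and the content of \<open>b\<close> is a root of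
  the cubic polynomial.\<close>

lemma right_wt_annihilated:
  assumes "full (Suc m)" "R \<in> growths_len m" "right_wt R x"
    and "box_content ` addable (set R) \<subseteq> {a, c, d}"
  shows "x * (jm (Suc m) - a *\<^sub>R 1) * (jm (Suc m) - c *\<^sub>R 1) * (jm (Suc m) - d *\<^sub>R 1) = 0"
proof -
  let ?K = "jm (Suc m)"
  let ?h = "(?K - a *\<^sub>R 1) * (?K - c *\<^sub>R 1) * (?K - d *\<^sub>R 1)"
  obtain e where e: "\<And>S T. (S, T) \<in> gpairs (Suc m) \<Longrightarrow> e (S, T) \<in> wt_space (Suc m) S T \<and> e (S, T) \<noteq> 0"
    using full_family[OF assms(1)] by blast
  obtain k where k: "1 = (\<Sum>T\<in>growths_len (Suc m). k T *\<^sub>R e (T, T))"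
    using one_expand[OF e] by blast
  have "x * e (T, T) * ?h = 0" if T: "T \<in> growths_len (Suc m)" for T
  proof -
    have wt: "left_wt T (e (T, T))" "right_wt T (e (T, T))"
      using e[of T T] T by (auto simp: gpairs_iff wt_space_def)
    obtain S b where S: "T = S @ [b]"
      using T by (metis (mono_tags, lifting) growths_len_def length_Suc_conv_rev mem_Collect_eq)
    have len: "length S = m" "length R = m"
      using T assms(2) S by (auto simp: growths_len_def)
    show ?thesis
    proof (cases "S = R")
      case False
      then have "x * e (T, T) = 0"
        by (intro mult_eq_0_if_weights_differ[OF assms(3) wt(1)])
          (use T assms(2) len S in \<open>auto simp: growths_len_def\<close>)
      then show ?thesis by simp
    next
      case True
      have "b \<in> addable (set R)"
        using T True by (simp add: S growths_len_def growth_snoc)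
      then have b: "box_content b \<in> {a, c, d}"
        using assms(4) by blast
      have *: "y * (?K - t *\<^sub>R 1) = (box_content b - t) *\<^sub>R y" if "y * ?K = box_content b *\<^sub>R y" for y t
        using that by (simp add: algebra_simps)
      have "x * e (T, T) * ?K = box_content b *\<^sub>R (x * e (T, T))"
        using wt(2) len by (simp add: S right_wt_snoc mult.assoc)
      then have "x * e (T, T) * ?h = ((box_content b - a) * (box_content b - c) * (box_content b - d)) *\<^sub>R (x * e (T, T))"
        by (simp add: mult.assoc[symmetric] *)
      then show ?thesis
        using b by auto
    qed
  qed
  moreover have "x * ?h = (\<Sum>T\<in>growths_len (Suc m). k T *\<^sub>R (x * e (T, T) * ?h))"
  proof -
    have "x * ?h = x * (\<Sum>T\<in>growths_len (Suc m). k T *\<^sub>R e (T, T)) * ?h"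
      by (simp only: k[symmetric] mult_1_right)
    then show ?thesis
      by (simp only: sum_distrib_left sum_distrib_right mult_scaleR_left mult_scaleR_right)
  qed
  ultimately show ?thesis
    by (simp add: mult.assoc)
qed

text \<open>\<open>x'\<close> is the image of \<open>x\<close> under the intertwiner of Okounkov and Vershik.\<close>

lemma swap_right_wt:
  assumes x: "right_wt (\<gamma> @ [a, b] @ \<delta>) x" "x \<noteq> 0"
    and g: "growth (\<gamma> @ [a, b] @ \<delta>)" "growth (\<gamma> @ [b, a] @ \<delta>)"
  defines "x' \<equiv> x * cox (Suc (length \<gamma>)) - (1 / (box_content b - box_content a)) *\<^sub>R x"
  shows "right_wt (\<gamma> @ [b, a] @ \<delta>) x'" "x' \<noteq> 0"
proof -
  let ?k = "Suc (length \<gamma>)" and ?s = "cox (Suc (length \<gamma>))" and ?r = "box_content b - box_content a"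
  have "growth (\<gamma> @ [a])" "growth (\<gamma> @ [b])" "a \<noteq> b"
    using growth_take[OF g(1), of "Suc (length \<gamma>)"] growth_take[OF g(2), of "Suc (length \<gamma>)"]
      growth_distinct[OF g(1)] by auto
  then have "\<bar>?r\<bar> \<ge> 2"
    using addable_content_gap[of b "set \<gamma>" a] by (auto simp: growth_snoc)
  then have r: "?r \<noteq> 0" "?r * ?r \<noteq> 1"
    by (auto simp: square_eq_1_iff abs_if split: if_splits)
  have wt: "x * jm (Suc i) = box_content ((\<gamma> @ [a, b] @ \<delta>) ! i) *\<^sub>R x" if "i < length (\<gamma> @ [a, b] @ \<delta>)" for i
    using x(1) that unfolding right_wt_def by blast
  have xa: "x * jm ?k = box_content a *\<^sub>R x" and xb: "x * jm (Suc ?k) = box_content b *\<^sub>R x"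
    using wt[of "length \<gamma>"] wt[of "Suc (length \<gamma>)"] by (auto simp: nth_append)
  have sk: "?s * jm ?k = jm (Suc ?k) * ?s - 1"
    using jm_cox[of ?k] by simp
  have sk': "?s * jm (Suc ?k) = jm ?k * ?s + 1"
    using cox_jm[of ?k] by simp
  \<comment> \<open>These identities account for the coefficient \<open>1 / ?r\<close> in
    \<open>x'\<close>: with it, the constants produced by the Hecke relations recombine into
    multiples of \<open>x'\<close>.\<close>
  have frac: "1 + box_content a / ?r = box_content b / ?r" "1 - box_content b / ?r = - (box_content a / ?r)"
    using r(1) by (simp_all add: field_simps)
  show "right_wt (\<gamma> @ [b, a] @ \<delta>) x'"
    unfolding right_wt_def
  proof (intro allI impI)
    fix i assume i: "i < length (\<gamma> @ [b, a] @ \<delta>)"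
    consider "i = length \<gamma>" | "i = Suc (length \<gamma>)" | "i \<noteq> length \<gamma>" "i \<noteq> Suc (length \<gamma>)"
      by blast
    then show "x' * jm (Suc i) = box_content ((\<gamma> @ [b, a] @ \<delta>) ! i) *\<^sub>R x'"
    proof cases
      case 1
      have "x' * jm ?k = x * (?s * jm ?k) - (1 / ?r) *\<^sub>R (x * jm ?k)"
        by (simp add: x'_def left_diff_distrib mult.assoc)
      also have "\<dots> = box_content b *\<^sub>R (x * ?s) - (1 + box_content a / ?r) *\<^sub>R x"
        by (simp add: sk xa right_diff_distrib mult.assoc[symmetric] xb scaleR_add_left)
      also have "\<dots> = box_content b *\<^sub>R x'"
        by (simp add: frac x'_def scaleR_diff_right)
      finally show ?thesis
        using 1 by (simp add: nth_append)
    next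
      case 2
      have "x' * jm (Suc ?k) = x * (?s * jm (Suc ?k)) - (1 / ?r) *\<^sub>R (x * jm (Suc ?k))"
        by (simp add: x'_def left_diff_distrib mult.assoc)
      also have "\<dots> = box_content a *\<^sub>R (x * ?s) + (1 - box_content b / ?r) *\<^sub>R x"
        by (simp add: sk' xb distrib_left mult.assoc[symmetric] xa scaleR_diff_left)
      also have "\<dots> = box_content a *\<^sub>R x'"
        by (simp add: frac x'_def scaleR_diff_right)
      finally show ?thesis
        using 2 by (simp add: nth_append)
    next
      case 3
      have nth: "(\<gamma> @ [b, a] @ \<delta>) ! i = (\<gamma> @ [a, b] @ \<delta>) ! i"
        using 3 by (auto simp: nth_append nth_Cons split: nat.splits)
      have "?s * jm (Suc i) = jm (Suc i) * ?s"
        using 3 by (intro cox_jm_commute) auto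
      then have "x' * jm (Suc i) = x * jm (Suc i) * ?s - (1 / ?r) *\<^sub>R (x * jm (Suc i))"
        by (simp add: x'_def left_diff_distrib mult.assoc)
      then show ?thesis
        using wt[of i] i by (simp add: nth[simplified] x'_def scaleR_diff_right)
    qed
  qed
  \<comment> \<open>Otherwise \<open>?s\<close> would act on \<open>x\<close> as the scalar
    \<open>1 / ?r\<close>, although its square is 1; the content gap excludes
    \<open>?r * ?r = 1\<close>.\<close>
  show "x' \<noteq> 0"
  proof
    assume "x' = 0"
    then have *: "x * ?s = (1 / ?r) *\<^sub>R x"
      by (simp add: x'_def)
    have "x = x * ?s * ?s"
      by (simp add: mult.assoc cox_cox)
    also have "\<dots> = (1 / (?r * ?r)) *\<^sub>R x"
      by (simp add: *)
    finally have "(1 - 1 / (?r * ?r)) *\<^sub>R x = 0"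
      by (simp only: scaleR_diff_left scaleR_one right_minus_eq)
    then have "1 / (?r * ?r) = 1"
      using x(2) by (metis right_minus_eq scaleR_eq_0_iff)
    moreover have "q = 1" if "1 / q = 1" for q :: real
      using that by simp
    ultimately show False
      using r(2) by blast
  qed
qed

section \<open>Moving between the tableaux of one shape\<close>

definition swp :: "(nat \<times> nat) list \<Rightarrow> (nat \<times> nat) list \<Rightarrow> bool" where
  "swp S T \<longleftrightarrow> growth S \<and> growth T \<and> (\<exists>\<gamma> a b \<delta>. S = \<gamma> @ [a, b] @ \<delta> \<and> T = \<gamma> @ [b, a] @ \<delta>)"

lemma swp_connected_set_length: "swp\<^sup>*\<^sup>* S T \<Longrightarrow> set T = set S \<and> length T = length S"
proof (induction rule: rtranclp_induct)
  case (step T T')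
  from step.hyps(2) obtain \<gamma> a b \<delta> where "T = \<gamma> @ [a, b] @ \<delta>" "T' = \<gamma> @ [b, a] @ \<delta>"
    unfolding swp_def by blast
  then have "set T' = set T" "length T' = length T"
    by auto
  then show ?case
    using step.IH by simp
qed simp

lemma swp_connected_snoc:
  assumes "swp\<^sup>*\<^sup>* S T" "growth (S @ [b])"
  shows "swp\<^sup>*\<^sup>* (S @ [b]) (T @ [b])"
  using assms(1)
proof (induction rule: rtranclp_induct)
  case (step T T')
  have set: "set T = set S" "set T' = set S"
    using swp_connected_set_length[OF step.hyps(1)]
      swp_connected_set_length[OF rtranclp.rtrancl_into_rtrancl[OF step.hyps]] by simp_all
  obtain \<gamma> a c \<delta> where T: "T = \<gamma> @ [a, c] @ \<delta>" "T' = \<gamma> @ [c, a] @ \<delta>" and g: "growth T" "growth T'"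
    using step.hyps(2) unfolding swp_def by blast
  have "b \<in> addable (set S)"
    using assms(2) growth_snoc by blast
  then have "growth (T @ [b])" "growth (T' @ [b])"
    using g by (simp_all only: growth_snoc set)
  then have "swp (T @ [b]) (T' @ [b])"
    unfolding swp_def T by (intro conjI exI[of _ \<gamma>] exI[of _ a] exI[of _ c] exI[of _ "\<delta> @ [b]"]) simp_all
  then show ?case
    using step.IH by simp
qed simp

lemma diagram_remove_two:
  assumes "diagram D" "b \<in> removable D" "c \<in> removable D" "b \<noteq> c"
  shows "diagram (D - {b, c})" "b \<in> addable (D - {b, c})" "c \<in> addable (D - {b, c})"
proof -
  have "D - {b, c} = (D - {b}) \<inter> (D - {c})" "insert b (D - {b, c}) = D - {c}" "insert c (D - {b, c}) = D - {b}"
    using assms by (auto simp: removable_def)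
  then show "diagram (D - {b, c})" "b \<in> addable (D - {b, c})" "c \<in> addable (D - {b, c})"
    using assms diagram_Int by (auto simp: removable_def addable_def)
qed

lemma growths_snoc_snoc:
  assumes "diagram D" "b \<in> removable D" "c \<in> removable D" "b \<noteq> c" "\<gamma> \<in> growths (D - {b, c})"
  shows "\<gamma> @ [b] \<in> growths (D - {c})" "\<gamma> @ [b, c] \<in> growths D"
proof -
  have "insert b (D - {b, c}) = D - {c}"
    using assms by (auto simp: removable_def)
  then show b: "\<gamma> @ [b] \<in> growths (D - {c})"
    using diagram_remove_two[OF assms(1-4)] assms(5) by (auto simp: growths_def growth_snoc)
  show "\<gamma> @ [b, c] \<in> growths D"
    using growths_snoc[of "\<gamma> @ [b]" c D] b assms(1,3) by simp
qed

text \<open>If the last boxes \<open>b\<close> and \<open>c\<close> differ, both are corners and can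
  be removed together. The path then leads through a tableau ending in \<open>c\<close>,
  \<open>b\<close>, exchanges these two boxes, and continues inside \<open>D - {c}\<close>.\<close>

lemma growths_connected:
  assumes "S \<in> growths D" "T \<in> growths D"
  shows "swp\<^sup>*\<^sup>* S T"
  using assms
proof (induction "card D" arbitrary: D S T)
  case 0
  then have "D = {}"
    using growths_diagram diagram_finite by fastforce
  then show ?case
    using 0 by simp
next
  case (Suc n)
  have D: "diagram D" "finite D"
    using growths_diagram[OF Suc.prems(1)] diagram_finite by auto
  obtain S' b where S: "S = S' @ [b]"
    using growths_length[OF Suc.prems(1)] Suc.hyps(2) by (metis length_0_conv old.nat.distinct(1) rev_exhaust)
  obtain T' c where T: "T = T' @ [c]"
    using growths_length[OF Suc.prems(2)] Suc.hyps(2) by (metis length_0_conv old.nat.distinct(1) rev_exhaust)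
  have S': "b \<in> removable D" "S' \<in> growths (D - {b})" and T': "c \<in> removable D" "T' \<in> growths (D - {c})"
    using Suc.prems growths_snoc S T by auto
  have card: "n = card (D - {b})" "n = card (D - {c})"
    using Suc.hyps(2) D(2) removableD(1)[OF S'(1)] removableD(1)[OF T'(1)] by auto
  have gS: "growth (S' @ [b])" and gT: "growth (T' @ [c])"
    using Suc.prems S T by (auto simp: growths_def)
  show ?case
  proof (cases "b = c")
    case True
    then show ?thesis
      using swp_connected_snoc[OF Suc.hyps(1)[OF card(1) S'(2)] gS] T'(2) S T by simp
  next
    case False
    obtain \<gamma> where \<gamma>: "\<gamma> \<in> growths (D - {b, c})"
      using growths_nonempty[OF diagram_remove_two(1)[OF D(1) S'(1) T'(1) False]] by blast
    have gc: "\<gamma> @ [c] \<in> growths (D - {b})" "\<gamma> @ [c, b] \<in> growths D"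
      using growths_snoc_snoc[OF D(1) T'(1) S'(1)] False \<gamma> by (auto simp: insert_commute)
    have gb: "\<gamma> @ [b] \<in> growths (D - {c})" "\<gamma> @ [b, c] \<in> growths D"
      using growths_snoc_snoc[OF D(1) S'(1) T'(1) False \<gamma>] by auto
    have "swp\<^sup>*\<^sup>* (S' @ [b]) ((\<gamma> @ [c]) @ [b])"
      using swp_connected_snoc[OF Suc.hyps(1)[OF card(1) S'(2) gc(1)] gS] .
    moreover have "swp (\<gamma> @ [c, b]) (\<gamma> @ [b, c])"
      unfolding swp_def
      by (intro conjI exI[of _ \<gamma>] exI[of _ c] exI[of _ b] exI[of _ "[]"]) (use gb gc in \<open>simp_all add: growths_def\<close>)
    moreover have "growth ((\<gamma> @ [b]) @ [c])"
      using gb by (simp add: growths_def)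
    then have "swp\<^sup>*\<^sup>* ((\<gamma> @ [b]) @ [c]) (T' @ [c])"
      using swp_connected_snoc[OF Suc.hyps(1)[OF card(2) gb(1) T'(2)]] by simp
    ultimately show ?thesis
      unfolding S T by simp
  qed
qed

lemma wt_occurs_sym: "wt_occurs n S T \<Longrightarrow> wt_occurs n T S"
  using star_wt_space star_nonzero unfolding wt_occurs_def by blast

lemma wt_occurs_swp:
  assumes "wt_occurs n S T" "swp T T'" "length T = n"
  shows "wt_occurs n S T'"
proof -
  obtain x where x: "x \<in> gsub n" "left_wt S x" "right_wt T x" "x \<noteq> 0"
    using assms(1) by (auto simp: wt_occurs_def wt_space_def)
  obtain \<gamma> a b \<delta> where T: "T = \<gamma> @ [a, b] @ \<delta>" "T' = \<gamma> @ [b, a] @ \<delta>" and g: "growth T" "growth T'"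
    using assms(2) by (auto simp: swp_def)
  let ?x = "x * cox (Suc (length \<gamma>)) - (1 / (box_content b - box_content a)) *\<^sub>R x"
  have "?x \<in> gsub n"
    using assms(3) T x(1) by (intro gsub_diff gsub_mult gsub_scaleR cox_in_gsub) auto
  moreover have "left_wt S ?x"
    using x(2) by (auto simp: left_wt_def right_diff_distrib mult.assoc[symmetric] scaleR_diff_right)
  moreover have "right_wt T' ?x" "?x \<noteq> 0"
    using swap_right_wt[of \<gamma> a b \<delta> x] x T g by auto
  ultimately show ?thesis
    by (auto simp: wt_occurs_def wt_space_def)
qed

text \<open>Intertwiners move the right weight only; since \<open>star\<close> exchanges the two
  sides, the left weight can be moved in the same way.\<close>

lemma wt_occurs_growths:
  assumes "wt_occurs n S T" "S \<in> growths D" "T \<in> growths D" "card D = n"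
    "S' \<in> growths D" "T' \<in> growths D"
  shows "wt_occurs n S' T'"
proof -
  have *: "wt_occurs n R R''" if "wt_occurs n R R'" "swp\<^sup>*\<^sup>* R' R''" "length R' = n" for R R' R''
    using that(2,1,3)
  proof (induction rule: rtranclp_induct)
    case (step U V)
    have "length U = n"
      using swp_connected_set_length[OF step.hyps(1)] step.prems(2) by simp
    then show ?case
      using wt_occurs_swp step by blast
  qed
  have "wt_occurs n S T'"
    using * assms growths_connected growths_length by metis
  then show ?thesis
    using * assms growths_connected growths_length wt_occurs_sym by metis
qed

lemma fullI:
  assumes "\<And>D. D \<in> diagrams n \<Longrightarrow> \<exists>S\<in>growths D. \<exists>T\<in>growths D. wt_occurs n S T"
  shows "full n"
  unfolding full_def
proof clarify
  fix S T assume "(S, T) \<in> gpairs n"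
  then obtain D where D: "D \<in> diagrams n" "S \<in> growths D" "T \<in> growths D"
    by (auto simp: gpairs_def)
  then show "wt_occurs n S T"
    using assms[OF D(1)] wt_occurs_growths by (auto simp: diagrams_def)
qed

lemma full_wt_occurs:
  assumes "full n" "S \<in> growths D" "T \<in> growths D" "card D = n"
  shows "wt_occurs n S T"
proof -
  have "(S, T) \<in> gpairs n"
    using assms growths_diagram by (auto simp: gpairs_def diagrams_def)
  then show ?thesis
    using assms(1) unfolding full_def by auto
qed

section \<open>Shapes with two corners\<close>

lemma wt_occurs_two_corners:
  assumes "full m" "full (Suc m)" and D: "diagram D" "card D = Suc (Suc m)"
    and bc: "b \<in> removable D" "c \<in> removable D" "b \<noteq> c"
  shows "\<exists>S\<in>growths D. \<exists>T\<in>growths D. wt_occurs (Suc (Suc m)) S T"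
proof -
  have fin: "finite D" and bD: "b \<in> D" "c \<in> D"
    using diagram_finite D bc removableD by auto
  obtain \<gamma> where \<gamma>: "\<gamma> \<in> growths (D - {b, c})"
    using growths_nonempty[OF diagram_remove_two(1)[OF D(1) bc]] by blast
  have gb: "\<gamma> @ [b] \<in> growths (D - {c})" "\<gamma> @ [b, c] \<in> growths D"
    using growths_snoc_snoc[OF D(1) bc \<gamma>] .
  have gc: "\<gamma> @ [c] \<in> growths (D - {b})" "\<gamma> @ [c, b] \<in> growths D"
    using growths_snoc_snoc[OF D(1) bc(2,1)] bc(3) \<gamma> by (auto simp: insert_commute)
  have card: "card (D - {b}) = Suc m" "card (D - {c}) = Suc m" "card (D - {b, c}) = m"
    using D(2) fin bD bc(3) by (simp_all add: card_Diff_subset)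
  have len: "length \<gamma> = m"
    using growths_length[OF \<gamma>] card by simp
  have box_content: "box_content c \<noteq> box_content b"
    using addable_content_inj diagram_remove_two(2,3)[OF D(1) bc] bc(3) by metis
  obtain x where x: "x \<in> gsub (Suc m)" "left_wt (\<gamma> @ [c]) x" "right_wt (\<gamma> @ [c]) x" "x \<noteq> 0"
    using full_wt_occurs[OF assms(2) gc(1) gc(1) card(1)] by (auto simp: wt_occurs_def wt_space_def)
  obtain y1 where y1: "y1 \<in> gsub (Suc m)" "left_wt (\<gamma> @ [b]) y1" "right_wt (\<gamma> @ [b]) y1" "y1 \<noteq> 0"
    using full_wt_occurs[OF assms(2) gb(1) gb(1) card(2)] by (auto simp: wt_occurs_def wt_space_def)
  \<comment> \<open>The product with \<open>star y1\<close> has a positive coefficient at the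
    identity. This coefficient survives \<open>pr m\<close>, which guarantees
    \<open>pr m y \<noteq> 0\<close> further down.\<close>
  define y where "y = y1 * star y1"
  have sy: "star y1 \<in> wt_space (Suc m) (\<gamma> @ [b]) (\<gamma> @ [b])"
    using y1 by (intro star_wt_space) (auto simp: wt_space_def)
  have y: "y \<in> gsub (Suc m)" "left_wt (\<gamma> @ [b]) y" "right_wt (\<gamma> @ [b]) y" "lookup y 0 > 0"
    using y1 sy lookup_mult_star_pos[OF y1(4)]
    by (auto simp: y_def wt_space_def left_wt_def right_wt_def gsub_mult mult.assoc[symmetric])
      (simp add: mult.assoc)
  let ?s = "cox (Suc m)"
  \<comment> \<open>Since \<open>x * y = 0\<close>, the Hecke relations turn \<open>u\<close> into a weight vector; it is nonzero because
    projecting \<open>u * ?s\<close> to the smaller group algebra gives \<open>x\<close> times a nonzero weight vector.\<close>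
  define u where "u = x * ?s * y"
  have xw: "left_wt \<gamma> x" "jm (Suc m) * x = box_content c *\<^sub>R x" "right_wt \<gamma> x" "x * jm (Suc m) = box_content c *\<^sub>R x"
    using x(2,3) len by (auto simp: left_wt_snoc right_wt_snoc)
  have yw: "left_wt \<gamma> y" "jm (Suc m) * y = box_content b *\<^sub>R y" "right_wt \<gamma> y" "y * jm (Suc m) = box_content b *\<^sub>R y"
    using y(2,3) len by (auto simp: left_wt_snoc right_wt_snoc)
  have "x * jm (Suc m) * y = x * (jm (Suc m) * y)"
    by (simp only: mult.assoc)
  then have "box_content c *\<^sub>R (x * y) = box_content b *\<^sub>R (x * y)"
    by (simp only: xw yw mult_scaleR_left mult_scaleR_right)
  then have xy: "x * y = 0"
    using box_content by simp
  have comm: "x * jm (Suc (Suc m)) = jm (Suc (Suc m)) * x" "y * jm (Suc (Suc m)) = jm (Suc (Suc m)) * y"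
    using jm_commute_gsub x(1) y(1) by auto
  have "jm (Suc (Suc m)) * u = x * (jm (Suc (Suc m)) * ?s) * y"
    using comm by (simp add: u_def mult.assoc[symmetric])
  also have "\<dots> = x * ?s * (jm (Suc m) * y) + x * y"
    by (simp add: jm_cox distrib_left distrib_right mult.assoc)
  also have "\<dots> = box_content b *\<^sub>R u"
    by (simp add: yw xy u_def)
  finally have left: "left_wt (\<gamma> @ [c, b]) u"
    using left_wt_snoc[of "\<gamma> @ [c]" b u] left_wt_snoc[of \<gamma> c u] xw(1,2) len
    by (auto simp: u_def left_wt_def mult.assoc[symmetric])
  have "u * jm (Suc (Suc m)) = x * (?s * jm (Suc (Suc m))) * y"
    using comm by (simp add: u_def mult.assoc)
  also have "\<dots> = x * jm (Suc m) * ?s * y + x * y"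
    by (simp add: cox_jm distrib_left distrib_right mult.assoc)
  also have "\<dots> = box_content c *\<^sub>R u"
    by (simp add: xw xy u_def)
  finally have right: "right_wt (\<gamma> @ [b, c]) u"
    using right_wt_snoc[of "\<gamma> @ [b]" c u] right_wt_snoc[of \<gamma> b u] yw(3,4) len
    by (auto simp: u_def right_wt_def mult.assoc)
  have "u \<in> gsub (Suc (Suc m))"
    unfolding u_def by (intro gsub_mult cox_in_gsub) (use gsub_mono[OF _ x(1)] gsub_mono[OF _ y(1)] in auto)
  moreover have "u \<noteq> 0"
  proof
    assume "u = 0"
    then have "0 = pr (Suc m) (u * ?s)"
      by simp
    also have "\<dots> = x * pr (Suc m) (?s * y * ?s)"
      using pr_mult_left[OF x(1), of "?s * y * ?s"] by (simp add: u_def mult.assoc)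
    also have "\<dots> = x * pr m y"
      by (simp add: pr_cox_conj[OF y(1)])
    finally have "x * pr m y = 0"
      by simp
    moreover have "x * pr m y \<noteq> 0"
    proof (rule mult_diagonal_nonzero[OF assms(1) _ xw(3) x(4)])
      show "\<gamma> \<in> growths_len m"
        using \<gamma> len by (simp add: growths_len_def growths_def)
      have "jm (Suc i) \<in> gsub m" if "i < m" for i
        using jm_in_gsub[of "Suc i"] gsub_mono[of "Suc i" m] that by simp
      then have "left_wt \<gamma> (pr m y)" "right_wt \<gamma> (pr m y)"
        using yw(1,3) len unfolding left_wt_def right_wt_def
        by (metis pr_mult_left pr_scaleR, metis pr_mult_right pr_scaleR)
      then show "pr m y \<in> wt_space m \<gamma> \<gamma>"
        by (simp add: wt_space_def pr_in_gsub)
      have "lookup (pr m y) 0 \<noteq> 0"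
        using y(4) by (simp add: lookup_pr)
      then show "pr m y \<noteq> 0"
        by auto
    qed
    ultimately show False
      by simp
  qed
  ultimately have "wt_occurs (Suc (Suc m)) (\<gamma> @ [c, b]) (\<gamma> @ [b, c])"
    using left right by (auto simp: wt_occurs_def wt_space_def)
  then show ?thesis
    using gb gc by blast
qed

section \<open>Every standard tableau occurs\<close>

text \<open>For a polynomial \<open>P\<close>, the relation between \<open>s\<close>,
  \<open>K\<close> and \<open>J\<close> moves \<open>P(K)\<close> to the left of \<open>s\<close> as
  \<open>P(J)\<close>, minus the divided difference of \<open>P\<close> at \<open>J\<close> and
  \<open>K\<close>. Here \<open>P\<close> has the roots \<open>c\<close>, \<open>a\<close>,
  \<open>d\<close> and \<open>v\<close> is an eigenvector of \<open>K\<close> for the root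
  \<open>c\<close>, so the divided difference reduces to \<open>(J - a)(J - d)\<close>.\<close>

lemma hecke_annihilation_step:
  fixes s K J v :: "'a :: real_algebra_1"
  assumes sK: "s * K = J * s - 1" and KJ: "J * K = K * J" and vK: "v * K = c *\<^sub>R v"
    and ann: "v * s * (K - c *\<^sub>R 1) * (K - a *\<^sub>R 1) * (K - d *\<^sub>R 1) = 0"
  shows "v * (J - a *\<^sub>R 1) * (J - d *\<^sub>R 1) * (J - c *\<^sub>R 1) * s = v * (J - a *\<^sub>R 1) * (J - d *\<^sub>R 1)"
proof -
  have sK': "s * (K * x) = J * (s * x) - x" for x
    by (metis sK left_diff_distrib mult.assoc mult_1_left)
  have KJ': "J * (K * x) = K * (J * x)" for x
    by (metis KJ mult.assoc)
  have vK': "v * (K * x) = c *\<^sub>R (v * x)" for x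
    by (metis vK mult.assoc mult_scaleR_left)
  show ?thesis
    using ann by (simp add: algebra_simps sK sK' KJ KJ' vK vK')
qed

text \<open>Put \<open>Y = J - c *\<^sub>R 1\<close>. The preceding identity for \<open>v\<close>
  gives \<open>v * H * Y * s = v * H\<close>, and for \<open>v * Y\<close> it gives
  \<open>v * H * Y * Y * s = v * H * Y\<close>. Multiplying the second by \<open>s\<close> yields
  \<open>v * H * Y * Y = v * H * Y * s = v * H\<close>. This is why the cubic annihilation is
  required for two vectors.\<close>

lemma hecke_annihilation:
  fixes s K J v :: "'a :: real_algebra_1"
  assumes ss: "s * s = 1" and sJ: "s * J = K * s + 1" and sK: "s * K = J * s - 1"
    and KJ: "J * K = K * J" and vK: "v * K = c *\<^sub>R v"
    and ann: "\<And>w. w \<in> {v, v * (J - c *\<^sub>R 1)} \<Longrightarrow>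
      w * s * (K - c *\<^sub>R 1) * (K - a *\<^sub>R 1) * (K - d *\<^sub>R 1) = 0"
  shows "v * (J - a *\<^sub>R 1) * (J - d *\<^sub>R 1) * ((J - c *\<^sub>R 1) * (J - c *\<^sub>R 1) - 1) = 0"
proof -
  define H where "H = (J - a *\<^sub>R 1) * (J - d *\<^sub>R 1)"
  have comm: "(J - c *\<^sub>R 1) * H = H * (J - c *\<^sub>R 1)"
    by (simp add: H_def algebra_simps)
  have 1: "v * H * (J - c *\<^sub>R 1) * s = v * H"
    using hecke_annihilation_step[OF sK KJ vK ann] by (simp add: H_def mult.assoc)
  have "v * (J - c *\<^sub>R 1) * K = c *\<^sub>R (v * (J - c *\<^sub>R 1))"
    using vK by (simp add: algebra_simps KJ) (metis mult.assoc mult_scaleR_left)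
  from hecke_annihilation_step[OF sK KJ this ann]
  have 2: "v * (J - c *\<^sub>R 1) * H * (J - c *\<^sub>R 1) * s = v * (J - c *\<^sub>R 1) * H"
    by (simp add: H_def mult.assoc)
  have "v * H * s = v * H * (J - c *\<^sub>R 1) * s * s"
    by (simp only: 1)
  then have "v * H * (J - c *\<^sub>R 1) = v * H * s"
    by (simp add: mult.assoc ss)
  also have "\<dots> = v * H * (J - c *\<^sub>R 1) * (J - c *\<^sub>R 1) * s"
  proof -
    have "v * H * (J - c *\<^sub>R 1) * (J - c *\<^sub>R 1) * s = v * H * (J - c *\<^sub>R 1)"
      using 2 by (simp only: mult.assoc comm)
    then show ?thesis
      using \<open>v * H * (J - c *\<^sub>R 1) = v * H * s\<close> by simp
  qed
  finally have "v * H * s * s = v * H * (J - c *\<^sub>R 1) * (J - c *\<^sub>R 1) * s * s"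
    using \<open>v * H * (J - c *\<^sub>R 1) = v * H * s\<close> by simp
  moreover have "v * H * s * s = v * H"
    "v * H * (J - c *\<^sub>R 1) * (J - c *\<^sub>R 1) * s * s = v * H * ((J - c *\<^sub>R 1) * (J - c *\<^sub>R 1))"
    by (simp_all only: mult.assoc ss mult_1_right)
  ultimately have "v * H = v * H * ((J - c *\<^sub>R 1) * (J - c *\<^sub>R 1))"
    by (simp only:)
  then have "v * H * ((J - c *\<^sub>R 1) * (J - c *\<^sub>R 1) - 1) = 0"
    by (simp only: right_diff_distrib[of "v * H"] mult_1_right right_minus_eq)
  then show ?thesis
    by (simp only: H_def mult.assoc)
qed

section \<open>Rectangles and their neighbourhood in Young's lattice\<close>

lemma diagram_rectangle: "diagram ({1..p} \<times> {1..q})"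
  unfolding diagram_def by auto

text \<open>Every box lies weakly above and to the left of some corner, here of the only
  one.\<close>

lemma rectangle_if_one_corner:
  assumes D: "diagram D" "D \<noteq> {}" and one: "\<And>b c. b \<in> removable D \<Longrightarrow> c \<in> removable D \<Longrightarrow> b = c"
  obtains p q where "1 \<le> p" "1 \<le> q" "D = {1..p} \<times> {1..q}"
proof -
  obtain b where b: "b \<in> removable D"
    using removable_nonempty[OF D] by blast
  obtain p q where pq: "b = (p, q)"
    by fastforce
  have in_D: "(p, q) \<in> D"
    using removableD(1)[OF b] pq by simp
  have "D = {1..p} \<times> {1..q}"
  proof (intro Set.set_eqI iffI; clarify)
    fix i j assume ij: "(i, j) \<in> D"
    then obtain k l where "(k, l) \<in> removable D" "i \<le> k" "j \<le> l"
      by (rule removable_below[OF D(1)])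
    then show "i \<in> {1..p} \<and> j \<in> {1..q}"
      using one[OF _ b, of "(k, l)"] pq diagram_pos[OF D(1) ij] by auto
  next
    fix i j assume "i \<in> {1..p}" "j \<in> {1..q}"
    then show "(i, j) \<in> D"
      using diagram_down[OF D(1) in_D] by auto
  qed
  then show ?thesis
    using that diagram_pos[OF D(1) in_D] by blast
qed

lemma growth_map:
  assumes "inj_on f {..<n}" "\<And>k. k \<le> n \<Longrightarrow> diagram (f ` {..<k})"
  shows "growth (map f [0..<n])"
proof -
  have "set (take k (map f [0..<n])) = f ` {..<min k n}" for k
    by (auto simp: take_map min_def atLeast0LessThan)
  moreover have "distinct (map f [0..<n])"
    using assms(1) by (simp add: distinct_map atLeast0LessThan)
  ultimately show ?thesis
    using assms(2) by (simp add: growth_def)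
qed

lemma addable_outside_rectangle:
  assumes E: "diagram E" "E \<subseteq> {1..p} \<times> {1..q}" and pq: "1 \<le> p" "1 \<le> q"
    and ij: "(i, j) \<in> addable E" "(i, j) \<notin> {1..p} \<times> {1..q}"
  shows "i = Suc p \<and> j = 1 \<or> i = 1 \<and> j = Suc q"
proof -
  have le: "k \<le> p" "l \<le> q" if "(k, l) \<in> E" for k l
    using E(2) that by auto
  have pos: "1 \<le> i" "1 \<le> j" and i: "i = 1 \<or> (i - 1, j) \<in> E" and j: "j = 1 \<or> (i, j - 1) \<in> E"
    using addable_iff[OF E(1), of i j] ij(1) by blast+
  show ?thesis
  proof (cases "i \<le> p")
    case True
    then have "q < j"
      using ij(2) pos by auto
    then have "(i, j - 1) \<in> E"
      using j pq by linarith
    then show ?thesis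
      using le[of i "j - 1"] le[of "i - 1" j] \<open>q < j\<close> i by fastforce
  next
    case False
    then have "(i - 1, j) \<in> E"
      using i pq by linarith
    then show ?thesis
      using le[of "i - 1" j] le[of i "j - 1"] False j by fastforce
  qed
qed

text \<open>The values \<open>- p\<close> and \<open>q\<close> are the contents of the boxes
  \<open>(Suc p, 1)\<close> and \<open>(1, Suc q)\<close> just outside the rectangle. Inside it,
  only the second removed box can be put back, since the corner needs both of its neighbours
  first.\<close>

lemma rectangle_corner_removed:
  assumes p: "2 \<le> p" and q: "2 \<le> q"
  defines "D \<equiv> {1..p} \<times> {1..q} :: (nat \<times> nat) set"
  shows "(p, q) \<in> removable D" "(p - 1, q) \<in> removable (D - {(p, q)})"
    "(p, q - 1) \<in> removable (D - {(p, q)})"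
    "box_content ` addable (D - {(p, q), (p - 1, q)}) \<subseteq> {box_content (p - 1, q), - real p, real q}"
    "box_content ` addable (D - {(p, q), (p, q - 1)}) \<subseteq> {box_content (p, q - 1), - real p, real q}"
proof -
  have D: "diagram D"
    unfolding D_def by (rule diagram_rectangle)
  show c: "(p, q) \<in> removable D"
    using p q removable_iff[OF D, of p q] by (auto simp: D_def)
  then have D1: "diagram (D - {(p, q)})"
    by (rule removableD)
  show a: "(p - 1, q) \<in> removable (D - {(p, q)})" and b: "(p, q - 1) \<in> removable (D - {(p, q)})"
    using p q removable_iff[OF D1, of "p - 1" q] removable_iff[OF D1, of p "q - 1"] by (auto simp: D_def)
  have a2: "diagram (D - {(p, q), (p - 1, q)})" and b2: "diagram (D - {(p, q), (p, q - 1)})"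
    using removableD(2)[OF a] removableD(2)[OF b] by (simp_all add: Diff_insert[symmetric] insert_commute)
  show "box_content ` addable (D - {(p, q), (p - 1, q)}) \<subseteq> {box_content (p - 1, q), - real p, real q}"
  proof
    fix t assume "t \<in> box_content ` addable (D - {(p, q), (p - 1, q)})"
    then obtain i j where ij: "(i, j) \<in> addable (D - {(p, q), (p - 1, q)})" "t = box_content (i, j)"
      by auto
    have "(i, j) \<noteq> (p, q)"
      using ij(1) p q unfolding addable_iff[OF a2] by auto
    moreover have "(i, j) \<notin> D - {(p, q), (p - 1, q)}"
      using ij(1) addableD by blast
    ultimately have "(i, j) = (p - 1, q) \<or> (i, j) \<notin> D"
      by blast
    then have "i = p - 1 \<and> j = q \<or> (i = Suc p \<and> j = 1) \<or> (i = 1 \<and> j = Suc q)"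
      using addable_outside_rectangle[OF a2, of p q] ij(1) p q unfolding D_def by auto
    then show "t \<in> {box_content (p - 1, q), - real p, real q}"
      using ij(2) by (auto simp: box_content_def)
  qed
  show "box_content ` addable (D - {(p, q), (p, q - 1)}) \<subseteq> {box_content (p, q - 1), - real p, real q}"
  proof
    fix t assume "t \<in> box_content ` addable (D - {(p, q), (p, q - 1)})"
    then obtain i j where ij: "(i, j) \<in> addable (D - {(p, q), (p, q - 1)})" "t = box_content (i, j)"
      by auto
    have "(i, j) \<noteq> (p, q)"
      using ij(1) p q unfolding addable_iff[OF b2] by auto
    moreover have "(i, j) \<notin> D - {(p, q), (p, q - 1)}"
      using ij(1) addableD by blast
    ultimately have "(i, j) = (p, q - 1) \<or> (i, j) \<notin> D"
      by blast
    then have "i = p \<and> j = q - 1 \<or> (i = Suc p \<and> j = 1) \<or> (i = 1 \<and> j = Suc q)"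
      using addable_outside_rectangle[OF b2, of p q] ij(1) p q unfolding D_def by auto
    then show "t \<in> {box_content (p, q - 1), - real p, real q}"
      using ij(2) by (auto simp: box_content_def)
  qed
qed

text \<open>Serves the rectangles with one row or one column. There at most one box can be taken off
  after the corner, so the comparison of two such boxes in \<open>wt_occurs_rectangle\<close> has no
  analogue; the symmetrizer and the antisymmetrizer are explicit weight vectors instead.\<close>

lemma wt_occurs_symmetrizer:
  fixes \<epsilon> :: "fperm \<Rightarrow> real" and e :: real
  assumes mult: "\<And>g i j. g \<in> Sn n \<Longrightarrow> 1 \<le> i \<Longrightarrow> i < j \<Longrightarrow> j \<le> n \<Longrightarrow>
      \<epsilon> (g + tr i j) = e * \<epsilon> g \<and> \<epsilon> (tr i j + g) = e * \<epsilon> g"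
    and e: "e * e = 1" and nz: "\<epsilon> 0 \<noteq> 0" and box_content: "\<And>i. i < n \<Longrightarrow> box_content (f i) = e * real i"
  shows "wt_occurs n (map f [0..<n]) (map f [0..<n])"
proof -
  define x where "x = (\<Sum>g\<in>Sn n. \<epsilon> g *\<^sub>R bas g)"
  note jm = symmetrizer_jm[OF mult x_def _ _ e]
  have "left_wt (map f [0..<n]) x" "right_wt (map f [0..<n]) x"
    unfolding left_wt_def right_wt_def using jm box_content by auto
  moreover have "x \<in> gsub n"
    unfolding x_def by (intro subspace_sum[OF subspace_gsub] gsub_scaleR) simp
  moreover have "lookup x 0 = \<epsilon> 0"
    by (simp add: x_def lookup_sum lookup_scaleR lookup_bas finite_Sn if_distrib cong: if_cong)
  then have "x \<noteq> 0"
    using nz by auto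
  ultimately show ?thesis
    by (auto simp: wt_occurs_def wt_space_def)
qed

lemma wt_occurs_row: "wt_occurs n (map (\<lambda>i. (1, Suc i)) [0..<n]) (map (\<lambda>i. (1, Suc i)) [0..<n])"
  by (rule wt_occurs_symmetrizer[where \<epsilon> = "\<lambda>_. 1" and e = 1]) (auto simp: box_content_def)

lemma wt_occurs_column: "wt_occurs n (map (\<lambda>i. (Suc i, 1)) [0..<n]) (map (\<lambda>i. (Suc i, 1)) [0..<n])"
proof (rule wt_occurs_symmetrizer[where \<epsilon> = sgn_fperm and e = "- 1"])
  show "sgn_fperm 0 \<noteq> 0"
    by (simp add: sgn_fperm_def fapp_zero sign_id)
qed (auto simp: box_content_def sgn_fperm_plus sgn_fperm_tr)

lemma growths_row: "map (\<lambda>i. (1, Suc i)) [0..<n] \<in> growths ({1..1} \<times> {1..n})"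
proof -
  have im: "(\<lambda>i. (1::nat, Suc i)) ` {..<k} = {1..1} \<times> {1..k}" for k
    unfolding image_Suc_lessThan[symmetric] by auto
  have "growth (map (\<lambda>i. (1, Suc i)) [0..<n])"
  proof (rule growth_map)
    show "diagram ((\<lambda>i. (1, Suc i)) ` {..<k})" for k
      unfolding im by (rule diagram_rectangle)
  qed (simp add: inj_on_def)
  then show ?thesis
    using im[of n] by (simp add: growths_def atLeast0LessThan)
qed

lemma growths_column: "map (\<lambda>i. (Suc i, 1)) [0..<n] \<in> growths ({1..n} \<times> {1..1})"
proof -
  have im: "(\<lambda>i. (Suc i, 1::nat)) ` {..<k} = {1..k} \<times> {1..1}" for k
    unfolding image_Suc_lessThan[symmetric] by auto
  have "growth (map (\<lambda>i. (Suc i, 1)) [0..<n])"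
  proof (rule growth_map)
    show "diagram ((\<lambda>i. (Suc i, 1)) ` {..<k})" for k
      unfolding im by (rule diagram_rectangle)
  qed (simp add: inj_on_def)
  then show ?thesis
    using im[of n] by (simp add: growths_def atLeast0LessThan)
qed

text \<open>If the \<open>(m + 1)\<close>-st Jucys--Murphy element has only the eigenvalues \<open>box_content b\<close>, \<open>a\<close>, \<open>d\<close>
  on the vectors of right weight \<open>R\<close>, then the next one has only the eigenvalues \<open>a\<close>, \<open>d\<close> and
  \<open>box_content b \<plusminus> 1\<close> on those of right weight \<open>R @ [b]\<close>.\<close>

lemma right_wt_annihilated_next:
  assumes "full (Suc m)" "growth (R @ [b])" "length R = m" "right_wt (R @ [b]) v"
    and sub: "box_content ` addable (set R) \<subseteq> {box_content b, a, d}"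
  defines "J \<equiv> jm (Suc (Suc m))"
  shows "v * (J - a *\<^sub>R 1) * (J - d *\<^sub>R 1) *
    ((J - box_content b *\<^sub>R 1) * (J - box_content b *\<^sub>R 1) - 1) = 0"
proof (rule hecke_annihilation[where s = "cox (Suc m)" and K = "jm (Suc m)"])
  have R: "R \<in> growths_len m"
    using assms(2,3) by (simp add: growths_len_def growth_snoc)
  have v: "right_wt R v" "v * jm (Suc m) = box_content b *\<^sub>R v"
    using assms(3,4) by (auto simp: right_wt_snoc)
  show "v * jm (Suc m) = box_content b *\<^sub>R v"
    by (rule v)
  show "cox (Suc m) * cox (Suc m) = 1"
    by (rule cox_cox)
  show "cox (Suc m) * J = jm (Suc m) * cox (Suc m) + 1"
    unfolding J_def by (rule cox_jm) simp
  show "cox (Suc m) * jm (Suc m) = J * cox (Suc m) - 1"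
    unfolding J_def using jm_cox[of "Suc m"] by simp
  show "J * jm (Suc m) = jm (Suc m) * J"
    unfolding J_def by (rule jm_commute)
  fix w assume "w \<in> {v, v * (J - box_content b *\<^sub>R 1)}"
  moreover have "right_wt R (v * (J - box_content b *\<^sub>R 1))"
    unfolding right_wt_def
  proof (intro allI impI)
    fix i assume i: "i < length R"
    have "v * (J - box_content b *\<^sub>R 1) * jm (Suc i) = v * jm (Suc i) * (J - box_content b *\<^sub>R 1)"
      by (simp add: right_diff_distrib left_diff_distrib mult.assoc jm_commute J_def)
    then show "v * (J - box_content b *\<^sub>R 1) * jm (Suc i) = box_content (R ! i) *\<^sub>R (v * (J - box_content b *\<^sub>R 1))"
      using v(1) i by (simp add: right_wt_def)
  qed
  ultimately have w: "right_wt R w"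
    using v(1) by auto
  \<comment> \<open>The generator commutes with the first \<open>m\<close> Jucys--Murphy elements,
    so the weight \<open>R\<close> survives and only the information about the last box is
    lost.\<close>
  have "right_wt R (w * cox (Suc m))"
    unfolding right_wt_def
  proof (intro allI impI)
    fix i assume i: "i < length R"
    have "w * cox (Suc m) * jm (Suc i) = w * jm (Suc i) * cox (Suc m)"
      using i assms(3) by (simp add: mult.assoc cox_jm_commute)
    then show "w * cox (Suc m) * jm (Suc i) = box_content (R ! i) *\<^sub>R (w * cox (Suc m))"
      using w i by (simp add: right_wt_def)
  qed
  then show "w * cox (Suc m) * (jm (Suc m) - box_content b *\<^sub>R 1) * (jm (Suc m) - a *\<^sub>R 1) *
      (jm (Suc m) - d *\<^sub>R 1) = 0"
    by (rule right_wt_annihilated[OF assms(1) R _ sub])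
qed

text \<open>In terms of \<open>X = J - b *\<^sub>R 1\<close> the two annihilators are
  \<open>X * X - 2 * X\<close> and \<open>X * X + 2 * X\<close>; their difference leaves a nonzero
  multiple of \<open>X\<close>.\<close>

lemma double_shift_cancel:
  fixes w J :: "'a :: real_algebra_1"
  assumes "w * ((J - (b + 1) *\<^sub>R 1) * (J - (b + 1) *\<^sub>R 1) - 1) = 0"
    and "w * ((J - (b - 1) *\<^sub>R 1) * (J - (b - 1) *\<^sub>R 1) - 1) = 0"
  shows "w * J = b *\<^sub>R w"
proof -
  define X where "X = J - b *\<^sub>R 1"
  have "J - (b + 1) *\<^sub>R 1 = X - 1" "J - (b - 1) *\<^sub>R 1 = X + 1"
    by (simp_all add: X_def algebra_simps)
  then have "w * X * X - (w * X + w * X) = 0" "w * X * X + (w * X + w * X) = 0"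
    using assms by (simp_all add: algebra_simps)
  then have "2 *\<^sub>R (w * X + w * X) = 0"
    by (simp add: scaleR_2 add_eq_0_iff)
  then have "w * X = 0"
    by (simp flip: scaleR_2)
  then show ?thesis
    by (simp add: X_def right_diff_distrib)
qed

section \<open>Rectangles with at least two rows and two columns\<close>

lemma wt_occurs_rectangle:
  assumes full: "full (Suc (Suc m))" and pq: "2 \<le> p" "2 \<le> q" and D: "D = {1..p} \<times> {1..q}"
    and card: "card D = Suc (Suc (Suc m))"
  shows "\<exists>S\<in>growths D. \<exists>T\<in>growths D. wt_occurs (Suc (Suc (Suc m))) S T"
proof -
  define c a1 a2 where "c = (p, q)" "a1 = (p - 1, q)" "a2 = (p, q - 1)"
  note corner = rectangle_corner_removed[OF pq, folded c_a1_a2_def D]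
  let ?M = "D - {c}"
  have dD: "diagram D"
    unfolding D by (rule diagram_rectangle)
  have dM: "diagram ?M"
    using removableD(2)[OF corner(1)] .
  have ne: "a1 \<noteq> a2" "c \<noteq> a1" "c \<noteq> a2"
    using pq by (auto simp: c_a1_a2_def)
  \<comment> \<open>The contents lie on opposite sides of that of the corner, which brings the two
    annihilators below into the form of \<open>double_shift_cancel\<close>.\<close>
  have cont: "box_content a1 = box_content c + 1" "box_content a2 = box_content c - 1"
    using pq by (auto simp: c_a1_a2_def box_content_def of_nat_diff)
  obtain \<gamma> where \<gamma>: "\<gamma> \<in> growths (?M - {a1, a2})"
    using growths_nonempty[OF diagram_remove_two(1)[OF dM corner(2,3) ne(1)]] by blast
  have g12: "\<gamma> @ [a1] \<in> growths (?M - {a2})" "\<gamma> @ [a1, a2] \<in> growths ?M"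
    using growths_snoc_snoc[OF dM corner(2,3) ne(1) \<gamma>] .
  have g21: "\<gamma> @ [a2] \<in> growths (?M - {a1})" "\<gamma> @ [a2, a1] \<in> growths ?M"
    using growths_snoc_snoc[OF dM corner(3,2) ne(1)[symmetric]] \<gamma> by (simp_all add: insert_commute)
  have cardM: "card ?M = Suc (Suc m)"
    using card removableD(1)[OF corner(1)] diagram_finite[OF dD] by simp
  have len: "length \<gamma> = m"
    using growths_length[OF g12(2)] cardM by simp
  have area: "real p * real q = real (Suc (Suc (Suc m)))"
    using card unfolding D by (simp add: card_cartesian_product flip: of_nat_mult)
  obtain v' where v': "v' \<in> gsub (Suc (Suc m))" "left_wt (\<gamma> @ [a1, a2]) v'"
    "right_wt (\<gamma> @ [a1, a2]) v'" "v' \<noteq> 0"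
    using full_wt_occurs[OF full g12(2) g12(2) cardM] by (auto simp: wt_occurs_def wt_space_def)
  \<comment> \<open>The intertwiner of \<open>swap_right_wt\<close> as an algebra element. It lies
    below the level of \<open>J\<close> and hence commutes with it, so the relation obtained for
    \<open>v'\<close>, with \<open>a2\<close> last, carries over to \<open>v\<close>, where
    \<open>a1\<close> is last.\<close>
  define z where "z = cox (Suc m) - (1 / (box_content a2 - box_content a1)) *\<^sub>R (1 :: galg)"
  define v where "v = v' * z"
  define J where "J = jm (Suc (Suc (Suc m)))"
  define X where "X t = J - t *\<^sub>R 1" for t
  have v_eq: "v = v' * cox (Suc (length \<gamma>)) - (1 / (box_content a2 - box_content a1)) *\<^sub>R v'"
    by (simp add: v_def z_def right_diff_distrib len)
  have "growth (\<gamma> @ [a1, a2] @ [])" "growth (\<gamma> @ [a2, a1] @ [])"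
    using g12 g21 by (auto simp: growths_def)
  then have v: "right_wt (\<gamma> @ [a2, a1]) v" "v \<noteq> 0"
    using swap_right_wt[of \<gamma> a1 a2 "[]" v'] v' unfolding v_eq by simp_all
  have z: "z \<in> gsub (Suc (Suc m))"
    unfolding z_def by (intro gsub_diff gsub_scaleR gsub_one cox_in_gsub) auto
  then have v_in: "v \<in> gsub (Suc (Suc m))"
    unfolding v_def by (intro gsub_mult v')
  have v_left: "left_wt (\<gamma> @ [a1, a2]) v"
    using v'(2) by (auto simp: left_wt_def v_def mult.assoc[symmetric])
  have "z * J = J * z"
    unfolding J_def by (rule jm_commute_gsub[OF z]) simp
  then have zX: "z * X t = X t * z" for t
    by (simp add: X_def algebra_simps)
  then have zX': "z * (X t * y) = X t * (z * y)" for t y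
    by (metis mult.assoc)
  have XJ: "X t * J = J * X t" for t
    by (simp add: X_def algebra_simps)
  have Xjm: "X t * jm i = jm i * X t" for t i
    using jm_commute by (simp add: X_def J_def algebra_simps)
  have ann1: "v * X (- real p) * X (real q) * (X (box_content a1) * X (box_content a1) - 1) = 0"
    using right_wt_annihilated_next[of "Suc m" "\<gamma> @ [a2]" a1 v "- real p" "real q"] full g21 len v corner(4)
    by (simp add: X_def J_def growths_def Diff_insert2[symmetric] insert_commute)
  have "v' * X (- real p) * X (real q) * (X (box_content a2) * X (box_content a2) - 1) = 0"
    using right_wt_annihilated_next[of "Suc m" "\<gamma> @ [a1]" a2 v' "- real p" "real q"] full g12 len v' corner(5)
    by (simp add: X_def J_def growths_def Diff_insert2[symmetric] insert_commute)
  then have "v' * X (- real p) * X (real q) * (X (box_content a2) * X (box_content a2) - 1) * z = 0"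
    by simp
  then have ann2: "v * X (- real p) * X (real q) * (X (box_content a2) * X (box_content a2) - 1) = 0"
    by (simp add: v_def mult.assoc left_diff_distrib right_diff_distrib zX zX')
  \<comment> \<open>The two annihilators share only the root \<open>box_content c\<close> besides \<open>- p\<close> and \<open>q\<close>. If that root did
    not occur, \<open>w\<close> would vanish; but the second moment of \<open>J\<close> is \<open>p * q - 1\<close> instead of \<open>p * q\<close>.\<close>
  define w where "w = v * X (- real p) * X (real q)"
  have wJ: "w * J = box_content c *\<^sub>R w"
    by (rule double_shift_cancel[OF ann1[folded w_def, unfolded X_def cont] ann2[folded w_def, unfolded X_def cont]])
  have "w = v * (J * J + (real p - real q) *\<^sub>R J - (real p * real q) *\<^sub>R 1)"
    by (simp add: w_def X_def algebra_simps)
  then have "pr (Suc (Suc m)) w =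
      v * (pr (Suc (Suc m)) (J * J) + (real p - real q) *\<^sub>R pr (Suc (Suc m)) J
        - (real p * real q) *\<^sub>R pr (Suc (Suc m)) 1)"
    by (simp add: pr_mult_left[OF v_in] pr_add pr_diff pr_scaleR)
  also have "pr (Suc (Suc m)) 1 = 1"
    using pr_bas[of "Suc (Suc m)" 0] by (simp add: bas_zero)
  also have "pr (Suc (Suc m)) (J * J) = real (Suc (Suc m)) *\<^sub>R 1"
    unfolding J_def by (rule pr_jm_squared)
  also have "pr (Suc (Suc m)) J = 0"
    unfolding J_def by (rule pr_jm)
  finally have "pr (Suc (Suc m)) w = (real (Suc (Suc m)) - real p * real q) *\<^sub>R v"
    by (simp add: algebra_simps)
  then have "pr (Suc (Suc m)) w = - v"
    by (simp add: area)
  then have "w \<noteq> 0"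
    using v(2) by auto
  moreover have "w \<in> gsub (Suc (Suc (Suc m)))"
    unfolding w_def X_def J_def
    by (intro gsub_mult gsub_diff gsub_scaleR gsub_one jm_in_gsub gsub_mono[OF _ v_in]) simp
  moreover have "left_wt (\<gamma> @ [a1, a2, c]) w"
  proof -
    have "J * v = v * J"
      unfolding J_def by (rule jm_commute_gsub[OF v_in, symmetric]) simp
    then have "J * w = w * J"
      by (simp add: w_def mult.assoc XJ) (simp add: mult.assoc[symmetric] XJ)
    moreover have "left_wt (\<gamma> @ [a1, a2]) w"
      using v_left by (auto simp: left_wt_def w_def mult.assoc[symmetric])
    ultimately show ?thesis
      using left_wt_snoc[of "\<gamma> @ [a1, a2]" c w] wJ len by (simp add: J_def)
  qed
  moreover have "right_wt (\<gamma> @ [a2, a1, c]) w"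
  proof -
    have "w * jm i = v * jm i * X (- real p) * X (real q)" for i
      by (simp add: w_def mult.assoc Xjm) (simp add: mult.assoc[symmetric] Xjm)
    then have "right_wt (\<gamma> @ [a2, a1]) w"
      using v(1) by (auto simp: right_wt_def w_def)
    then show ?thesis
      using right_wt_snoc[of "\<gamma> @ [a2, a1]" c w] wJ len by (simp add: J_def)
  qed
  ultimately have "wt_occurs (Suc (Suc (Suc m))) (\<gamma> @ [a1, a2, c]) (\<gamma> @ [a2, a1, c])"
    by (auto simp: wt_occurs_def wt_space_def)
  moreover have "\<gamma> @ [a1, a2, c] \<in> growths D" "\<gamma> @ [a2, a1, c] \<in> growths D"
    using growths_snoc[of "\<gamma> @ [a1, a2]" c D] growths_snoc[of "\<gamma> @ [a2, a1]" c D] g12 g21 dD corner(1)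
    by simp_all
  ultimately show ?thesis
    by blast
qed

theorem full_all: "full n"
proof (induction n rule: less_induct)
  case (less n)
  show ?case
  proof (rule fullI)
    fix D assume "D \<in> diagrams n"
    then have D: "diagram D" "card D = n"
      by (auto simp: diagrams_def)
    show "\<exists>S\<in>growths D. \<exists>T\<in>growths D. wt_occurs n S T"
    proof (cases "\<exists>b\<in>removable D. \<exists>c\<in>removable D. b \<noteq> c")
      case True
      then obtain b c where bc: "b \<in> removable D" "c \<in> removable D" "b \<noteq> c"
        by blast
      have "card {b, c} \<le> n"
        using bc removableD(1) D diagram_finite by (metis card_mono empty_subsetI insert_subset)
      then obtain m where "n = Suc (Suc m)"
        using bc(3) by (metis card_2_iff le_Suc_ex numeral_2_eq_2 add_Suc)
      then show ?thesis
        using wt_occurs_two_corners[of m D b c] less D bc by simp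
    next
      case False
      show ?thesis
      proof (cases "D = {}")
        case True
        then have "n = 0"
          using D by simp
        moreover have "map (\<lambda>i. (1, Suc i)) [0..<0] = []"
          by simp
        ultimately show ?thesis
          using wt_occurs_row[of 0] True by simp
      next
        case ne: False
        obtain p q where pq: "1 \<le> p" "1 \<le> q" "D = {1..p} \<times> {1..q}"
          using rectangle_if_one_corner[OF D(1) ne] False by blast
        then have n: "n = p * q"
          using D(2) by (simp add: card_cartesian_product)
        consider "p = 1" | "q = 1" | "2 \<le> p" "2 \<le> q"
          using pq by linarith
        then show ?thesis
        proof cases
          case 1
          then show ?thesis
            using wt_occurs_row[of n] growths_row[of n] n pq(3) by auto
        next
          case 2
          then show ?thesis
            using wt_occurs_column[of n] growths_column[of n] n pq(3) by auto
        next
          case 3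
          \<comment> \<open>The corner and its two neighbours are three different boxes;
            \<open>m\<close> counts the boxes that remain without them.\<close>
          then have "2 * 2 \<le> p * q"
            by (rule mult_le_mono)
          then obtain m where m: "n = Suc (Suc (Suc m))"
            using n by (metis (no_types, opaque_lifting) Suc_diff_le diff_Suc_Suc less_eq_Suc_le
                numeral_3_eq_3 le_Suc_ex add_Suc mult_2 numeral_Bit0 add_Suc_right numeral_2_eq_2)
          then show ?thesis
            using wt_occurs_rectangle[of m p q D] less 3 pq(3) D(2) by simp
        qed
      qed
    qed
  qed
qed

section \<open>Eigenvalues of the transition matrix\<close>

text \<open>The rows of \<open>V\<close> are left eigenvectors of \<open>M\<close>. This is the side
  on which right multiplication in the group algebra acts on coefficient vectors.\<close>

lemma char_poly_if_left_eigenbasis: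
  fixes M V :: "'a :: field mat"
  assumes M: "M \<in> carrier_mat N N" and V: "V \<in> carrier_mat N N"
    and eigen: "V * M = mat_diag N f * V" and det: "det V \<noteq> 0"
  shows "char_poly M = (\<Prod>k<N. [:- f k, 1:])"
proof -
  define W where "W = inverse (det V) \<cdot>\<^sub>m adj_mat V"
  have W: "W \<in> carrier_mat N N"
    unfolding W_def using adj_mat(1)[OF V] by simp
  have VW: "V * W = 1\<^sub>m N" and WV: "W * V = 1\<^sub>m N"
  proof -
    have *: "inverse (det V) \<cdot>\<^sub>m (det V \<cdot>\<^sub>m 1\<^sub>m N) = 1\<^sub>m N"
      by (rule eq_matI) (simp_all add: det)
    show "V * W = 1\<^sub>m N" "W * V = 1\<^sub>m N"
      unfolding W_def mult_smult_distrib[OF V adj_mat(1)[OF V]] mult_smult_assoc_mat[OF adj_mat(1)[OF V] V]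
        adj_mat(2,3)[OF V] by (rule *)+
  qed
  have "M = W * (V * M)"
    using WV M W V by (simp flip: assoc_mult_mat[OF W V M])
  also have "\<dots> = W * mat_diag N f * V"
    unfolding eigen by (rule assoc_mult_mat[OF W mat_diag_dim V, symmetric])
  finally have "similar_mat M (mat_diag N f)"
    unfolding similar_mat_def similar_mat_wit_def Let_def
    using M W V VW WV by (intro exI[of _ W] exI[of _ V]) auto
  then have "char_poly M = char_poly (mat_diag N f)"
    by (rule char_poly_similar)
  also have "\<dots> = (\<Prod>a\<leftarrow>diag_mat (mat_diag N f). [:- a, 1:])"
    by (rule char_poly_upper_triangular[OF mat_diag_dim]) (auto simp: mat_diag_def)
  also have "\<dots> = (\<Prod>k<N. [:- f k, 1:])"
    by (simp add: diag_mat_def mat_diag_def comp_def prod.list_conv_set_nth atLeast0LessThan)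
  finally show ?thesis .
qed

section \<open>The random walk as multiplication in the group algebra\<close>

lemma tr_eq_iff:
  assumes "i < j" "i' < j'"
  shows "tr i j = tr i' j' \<longleftrightarrow> i = i' \<and> j = j'"
proof
  assume "tr i j = tr i' j'"
  then have *: "Transposition.transpose i j k = Transposition.transpose i' j' k" for k
    by (metis fapp_tr)
  show "i = i' \<and> j = j'"
    using *[of i] *[of j] assms by (auto simp: Transposition.transpose_def split: if_splits)
qed auto

lemma tr_neq_zero: "i < j \<Longrightarrow> tr i j \<noteq> 0"
  by (metis fapp_tr fapp_zero id_apply less_irrefl transpose_apply_first)

definition step_element :: "nat \<Rightarrow> nat set \<Rightarrow> galg" where
  "step_element n A = (1 / real n) *\<^sub>R 1 +
    ((real n - 1) / (real n * real (card (transposition_set A)))) *\<^sub>R (\<Sum>j\<in>A. jm j)"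

text \<open>A transposition determines its pair \<open>i < j\<close>, so it occurs in
  \<open>jm j\<close> for one \<open>j\<close> only and the coefficients of the sum over
  \<open>A\<close> are 0 or 1.\<close>

lemma lookup_step_element:
  assumes "finite A"
  shows "lookup (step_element n A) g = step_prob n A (fapp g)"
proof -
  have jm: "lookup (jm j) g = (if \<exists>i. 1 \<le> i \<and> i < j \<and> g = tr i j then 1 else 0)" for j
  proof (cases "\<exists>i. 1 \<le> i \<and> i < j \<and> g = tr i j")
    case True
    then obtain i where i: "1 \<le> i" "i < j" "g = tr i j"
      by blast
    have "lookup (jm j) g = (\<Sum>k\<in>{1..<j}. if k = i then 1 else 0)"
      unfolding jm_def lookup_sum lookup_bas by (intro sum.cong refl) (use i tr_eq_iff in auto)
    then show ?thesis
      using i True by auto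
  next
    case False
    then show ?thesis
      unfolding jm_def lookup_sum lookup_bas by (auto intro!: sum.neutral)
  qed
  have T: "fapp g \<in> transposition_set A \<longleftrightarrow> (\<exists>j\<in>A. \<exists>i. 1 \<le> i \<and> i < j \<and> g = tr i j)"
    unfolding transposition_set_def jm_transpositions_def fapp_tr[symmetric]
    by (auto simp: fapp_inject)
  have sum: "lookup (\<Sum>j\<in>A. jm j) g = (if fapp g \<in> transposition_set A then 1 else 0)"
  proof (cases "fapp g \<in> transposition_set A")
    case True
    then obtain j i where ij: "j \<in> A" "1 \<le> i" "i < j" "g = tr i j"
      using T by blast
    have "lookup (\<Sum>j\<in>A. jm j) g = (\<Sum>k\<in>A. if k = j then 1 else 0)"
      unfolding lookup_sum jm by (intro sum.cong refl) (use ij tr_eq_iff in auto)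
    then show ?thesis
      using ij True assms by simp
  next
    case False
    then show ?thesis
      unfolding lookup_sum jm using T by (auto intro!: sum.neutral)
  qed
  have id: "fapp g = id \<longleftrightarrow> g = 0"
    by (metis fapp_inject fapp_zero)
  have "g \<noteq> 0" if "fapp g \<in> transposition_set A"
    using that T tr_neq_zero by auto
  then show ?thesis
    by (auto simp: step_element_def lookup_add lookup_scaleR sum step_prob_def id lookup_one when_def)
qed

lemma transition_prob_fapp:
  assumes "finite A"
  shows "transition_prob n A (fapp g) (fapp h) = lookup (step_element n A) (- g + h)"
  using lookup_step_element[OF assms, of n "- g + h"]
  by (simp add: transition_prob_def fapp_plus fapp_uminus)

definition growth_eig :: "nat \<Rightarrow> nat set \<Rightarrow> (nat \<times> nat) list \<Rightarrow> real" where
  "growth_eig n A T = 1 / real n + (real n - 1) / (real n * real (card (transposition_set A))) *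
    (\<Sum>j\<in>A. box_content (T ! (j - 1)))"

lemma wt_space_mult_step_element:
  assumes "x \<in> wt_space n S T" "length T = n" "A \<subseteq> {1..n}"
  shows "x * step_element n A = growth_eig n A T *\<^sub>R x"
proof -
  have "x * jm j = box_content (T ! (j - 1)) *\<^sub>R x" if "j \<in> A" for j
  proof -
    have "j \<in> {1..length T}"
      using that assms(2,3) by blast
    then have "j - 1 < length T" "Suc (j - 1) = j"
      by auto
    then show ?thesis
      using assms(1) unfolding wt_space_def right_wt_def by (metis (mono_tags, lifting) mem_Collect_eq)
  qed
  then have "x * (\<Sum>j\<in>A. jm j) = (\<Sum>j\<in>A. box_content (T ! (j - 1))) *\<^sub>R x"
    by (simp add: sum_distrib_left scaleR_sum_left)
  then show ?thesis
    by (simp add: step_element_def growth_eig_def distrib_left scaleR_add_left)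
qed

text \<open>The eigenvalue depends on the right weight alone; the left weights that go with it
  produce the multiplicity. The product runs over pairs, so the dimension count is already built
  in.\<close>

lemma char_poly_transition_mat:
  assumes A: "A \<subseteq> {1..n}" and xs: "distinct xs" "set xs = {p. p permutes {1..n}}"
  shows "char_poly (transition_mat n A xs) = (\<Prod>p\<in>gpairs n. [:- growth_eig n A (snd p), 1:])"
proof -
  have finA: "finite A"
    using A finite_subset by blast
  define N where "N = length xs"
  have N: "N = fact n"
    using distinct_card[OF xs(1)] card_permutations[of "{1..n}" n] by (simp add: N_def xs(2))
  define G where "G r = Fperm (xs ! r)" for r
  have xsG: "xs ! r = fapp (G r)" "G r \<in> Sn n" if "r < N" for r
  proof -
    have p: "xs ! r permutes {1..n}"
      using that xs(2) nth_mem[of r xs] by (simp add: N_def)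
    then show *: "xs ! r = fapp (G r)"
      unfolding G_def by (subst fapp_Fperm[of _ n]) (auto elim: permutes_subset)
    show "G r \<in> Sn n"
      using p * by (simp add: Sn_def)
  qed
  have bijG: "bij_betw G {..<N} (Sn n)"
  proof -
    have inj: "inj_on G {..<N}"
    proof (rule inj_onI)
      fix r r' assume "r \<in> {..<N}" "r' \<in> {..<N}" "G r = G r'"
      then show "r = r'"
        using xsG xs(1) by (metis N_def lessThan_iff nth_eq_iff_index_eq)
    qed
    moreover have "G ` {..<N} = Sn n"
      using xsG card_image[OF inj] N card_Sn[of n] finite_Sn[of n]
      by (intro card_subset_eq) auto
    ultimately show ?thesis
      by (simp add: bij_betw_def)
  qed
  obtain ps where ps: "set ps = gpairs n" "distinct ps"
    using finite_distinct_list[OF finite_gpairs] by blast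
  have lenps: "length ps = N"
    using distinct_card[OF ps(2)] ps(1) card_gpairs N by simp
  obtain e where e: "\<And>S T. (S, T) \<in> gpairs n \<Longrightarrow> e (S, T) \<in> wt_space n S T \<and> e (S, T) \<noteq> 0"
    using full_family[OF full_all] by blast
  have ek: "e (ps ! k) \<in> wt_space n (fst (ps ! k)) (snd (ps ! k))" "e (ps ! k) \<noteq> 0"
    "length (snd (ps ! k)) = n" if "k < N" for k
  proof -
    have "ps ! k \<in> gpairs n"
      using that lenps ps(1) nth_mem by blast
    then show "e (ps ! k) \<in> wt_space n (fst (ps ! k)) (snd (ps ! k))" "e (ps ! k) \<noteq> 0"
      "length (snd (ps ! k)) = n"
      using e by (cases "ps ! k"; auto simp: gpairs_iff growths_len_def)+
  qed
  let ?M = "transition_mat n A xs"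
  define V where "V = mat N N (\<lambda>(k, r). lookup (e (ps ! k)) (G r))"
  define f where "f k = growth_eig n A (snd (ps ! k))" for k
  have M: "?M \<in> carrier_mat N N" and V: "V \<in> carrier_mat N N"
    by (auto simp: transition_mat_def V_def N_def)
  \<comment> \<open>An entry of \<open>V * ?M\<close> is a convolution, namely the coefficient of
    \<open>e (ps ! k) * step_element n A\<close> at \<open>G c\<close>.\<close>
  have "V * ?M = mat_diag N f * V"
  proof (rule eq_matI)
    fix k c assume kc: "k < dim_row (mat_diag N f * V)" "c < dim_col (mat_diag N f * V)"
    then have k: "k < N" and c: "c < N"
      by (auto simp: V_def mat_diag_def)
    let ?x = "e (ps ! k)"
    have "(V * ?M) $$ (k, c) = (\<Sum>r<N. lookup ?x (G r) * transition_prob n A (xs ! r) (xs ! c))"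
      using k c by (simp add: V_def transition_mat_def N_def scalar_prod_def atLeast0LessThan)
    also have "\<dots> = (\<Sum>r<N. lookup ?x (G r) * lookup (step_element n A) (- G r + G c))"
      using c xsG by (simp add: transition_prob_fapp[OF finA])
    also have "\<dots> = (\<Sum>g\<in>Sn n. lookup ?x g * lookup (step_element n A) (- g + G c))"
      by (rule sum.reindex_bij_betw[OF bijG])
    also have "\<dots> = (\<Sum>g\<in>keys ?x. lookup ?x g * lookup (step_element n A) (- g + G c))"
      using ek(1)[OF k] by (intro sum.mono_neutral_right finite_Sn) (auto simp: wt_space_def gsub_def in_keys_iff)
    also have "\<dots> = lookup (?x * step_element n A) (G c)"
      by (simp add: lookup_mult_group)
    also have "\<dots> = f k * lookup ?x (G c)"
      using wt_space_mult_step_element[OF ek(1,3)[OF k] A] by (simp add: lookup_scaleR f_def)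
    also have "\<dots> = (mat_diag N f * V) $$ (k, c)"
      using k c by (simp add: mat_diag_mult_left[OF V]) (simp add: V_def)
    finally show "(V * ?M) $$ (k, c) = (mat_diag N f * V) $$ (k, c)" .
  qed (auto simp: V_def transition_mat_def N_def mat_diag_def)
  \<comment> \<open>A kernel vector of the transposed matrix is a linear relation between the weight
    vectors.\<close>
  moreover have "det V \<noteq> 0"
  proof
    assume "det V = 0"
    then have "det (transpose_mat V) = 0"
      using det_transpose[OF V] by simp
    then obtain v where v: "v \<in> carrier_vec N" "v \<noteq> 0\<^sub>v N" "transpose_mat V *\<^sub>v v = 0\<^sub>v N"
      using det_0_iff_vec_prod_zero[of "transpose_mat V" N] V by auto
    have "(\<Sum>k<N. v $ k *\<^sub>R e (ps ! k)) = 0"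
    proof (rule poly_mapping_eqI)
      fix g
      show "lookup (\<Sum>k<N. v $ k *\<^sub>R e (ps ! k)) g = lookup 0 g"
      proof (cases "g \<in> Sn n")
        case True
        then obtain c where c: "c < N" "g = G c"
          using bijG by (auto simp: bij_betw_def)
        have "(transpose_mat V *\<^sub>v v) $ c = (\<Sum>k<N. lookup (e (ps ! k)) (G c) * v $ k)"
          using c(1) v(1) by (auto simp: V_def scalar_prod_def atLeast0LessThan)
        then show ?thesis
          using v(3) c by (simp add: lookup_sum lookup_scaleR mult.commute)
      next
        case False
        then show ?thesis
          using gsubD[OF _ False] ek(1) unfolding lookup_sum lookup_scaleR
          by (intro trans[OF sum.neutral]) (auto simp: wt_space_def)
      qed
    qed
    moreover define idx where "idx = the_inv_into {..<N} ((!) ps)"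
    have bijps: "bij_betw ((!) ps) {..<N} (gpairs n)"
      using bij_betw_nth[OF ps(2)] lenps ps(1) by simp
    have idx: "idx (ps ! k) = k" if "k < N" for k
      using bijps that unfolding idx_def by (simp add: bij_betw_def the_inv_into_f_f)
    have "(\<Sum>p\<in>gpairs n. v $ idx p *\<^sub>R e p) = (\<Sum>k<N. v $ k *\<^sub>R e (ps ! k))"
      unfolding sum.reindex_bij_betw[OF bijps, symmetric] by (intro sum.cong refl) (simp add: idx)
    ultimately have sum: "(\<Sum>p\<in>gpairs n. v $ idx p *\<^sub>R e p) = 0"
      by simp
    have "v $ k = 0" if k: "k < N" for k
    proof -
      have "v $ idx (ps ! k) *\<^sub>R e (ps ! k) = 0"
        by (rule wt_space_independent[OF _ sum])
          (use e wt_space_scaleR k lenps ps(1) nth_mem in blast)+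
      then show ?thesis
        using idx[OF k] ek(2)[OF k] by simp
    qed
    then have "v = 0\<^sub>v N"
      using v(1) by (intro eq_vecI) auto
    then show False
      using v(2) by simp
  qed
  ultimately have "char_poly ?M = (\<Prod>k<N. [:- f k, 1:])"
    by (intro char_poly_if_left_eigenbasis[OF M V])
  also have "\<dots> = (\<Prod>p\<in>gpairs n. [:- growth_eig n A (snd p), 1:])"
    unfolding f_def
    by (rule prod.reindex_bij_betw) (use bij_betw_nth[OF ps(2)] lenps ps(1) in simp)
  finally show ?thesis .
qed

lemma prod_gpairs:
  fixes F :: "(nat \<times> nat) list \<Rightarrow> 'a :: comm_semiring_1"
  shows "(\<Prod>p\<in>gpairs n. F (snd p)) = (\<Prod>D\<in>diagrams n. \<Prod>T\<in>growths D. F T ^ card (growths D))"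
proof -
  have "(\<Prod>p\<in>gpairs n. F (snd p)) = (\<Prod>D\<in>diagrams n. \<Prod>p\<in>growths D \<times> growths D. F (snd p))"
    unfolding gpairs_def
    by (rule prod.UNION_disjoint) (auto simp: finite_diagrams finite_growths, auto simp: growths_def)
  also have "\<dots> = (\<Prod>D\<in>diagrams n. \<Prod>S\<in>growths D. \<Prod>T\<in>growths D. F T)"
    by (intro prod.cong refl) (simp only: prod.cartesian_product case_prod_unfold)
  also have "\<dots> = (\<Prod>D\<in>diagrams n. \<Prod>T\<in>growths D. F T ^ card (growths D))"
    by (simp add: prod_power_distrib)
  finally show ?thesis .
qed

section \<open>Partitions and their diagrams\<close>

lemma young_diagram_iff:
  "(i, j) \<in> young_diagram lam \<longleftrightarrow> 1 \<le> i \<and> i \<le> length lam \<and> 1 \<le> j \<and> j \<le> lam ! (i - 1)"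
  by (simp add: young_diagram_def)

lemma diagram_young_diagram:
  assumes "lam \<in> partitions n"
  shows "diagram (young_diagram lam)"
proof -
  have sorted: "sorted_wrt (\<ge>) lam"
    using assms by (simp add: partitions_def)
  have "(i, j) \<in> young_diagram lam" if "1 \<le> i" "(Suc i, j) \<in> young_diagram lam" for i j
  proof -
    have "i - 1 < i" "i < length lam"
      using that by (auto simp: young_diagram_iff)
    then have "lam ! (i - 1) \<ge> lam ! i"
      using sorted by (simp add: sorted_wrt_iff_nth_less)
    then show ?thesis
      using that by (simp add: young_diagram_iff)
  qed
  moreover have "(i, j) \<in> young_diagram lam" if "1 \<le> j" "(i, Suc j) \<in> young_diagram lam" for i j
    using that by (simp add: young_diagram_iff)
  moreover have "1 \<le> i \<and> 1 \<le> j" if "(i, j) \<in> young_diagram lam" for i j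
    using that by (simp add: young_diagram_iff)
  ultimately show ?thesis
    unfolding diagram_def using finite_young_diagram[of lam] by blast
qed

lemma card_young_diagram: "card (young_diagram lam) = sum_list lam"
proof -
  have "young_diagram lam = (SIGMA i:{1..length lam}. {1..lam ! (i - 1)})"
    by (auto simp: young_diagram_def)
  then have "card (young_diagram lam) = (\<Sum>i\<in>{1..length lam}. lam ! (i - 1))"
    by simp
  also have "\<dots> = (\<Sum>i<length lam. lam ! i)"
    by (rule sum.reindex_bij_witness[of _ Suc "\<lambda>i. i - 1"]) auto
  finally show ?thesis
    by (simp add: sum_list_sum_nth atLeast0LessThan)
qed

text \<open>The first column recovers the number of parts, since all parts are positive, and the row
  lengths recover the parts.\<close>

lemma inj_young_diagram: "inj_on young_diagram (partitions n)"
proof (rule inj_onI)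
  fix lam mu assume lam: "lam \<in> partitions n" and mu: "mu \<in> partitions n"
    and eq: "young_diagram lam = young_diagram mu"
  have len: "length nu = card {i. (i, 1) \<in> young_diagram nu}" if "nu \<in> partitions n" for nu
  proof -
    have pos: "\<forall>p\<in>set nu. 0 < p"
      using that by (simp add: partitions_def)
    have "1 \<le> nu ! (i - 1)" if "1 \<le> i" "i \<le> length nu" for i
    proof -
      have "nu ! (i - 1) \<in> set nu"
        using that by (intro nth_mem) simp
      then show ?thesis
        using pos by (simp add: Suc_le_eq)
    qed
    then have "{i. (i, 1) \<in> young_diagram nu} = {1..length nu}"
      by (auto simp: young_diagram_iff)
    then show ?thesis
      by simp
  qed
  have row: "nu ! i = row_len (young_diagram nu) (Suc i)" if "i < length nu" for nu i
  proof -
    have "{j. (Suc i, j) \<in> young_diagram nu} = {1..nu ! i}"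
      using that by (auto simp: young_diagram_iff)
    then show ?thesis
      by (simp add: row_len_def)
  qed
  show "lam = mu"
    using len[OF lam] len[OF mu] row eq by (intro nth_equalityI) auto
qed

lemma young_diagram_image: "young_diagram ` partitions n = diagrams n"
proof (intro Set.set_eqI iffI)
  fix D assume "D \<in> diagrams n"
  then have D: "diagram D" "card D = n"
    by (auto simp: diagrams_def)
  define r where "r i = row_len D (Suc i)" for i
  have anti: "r j \<le> r i" if "i \<le> j" for i j
    using that by (induction rule: dec_induct) (auto simp: r_def intro: le_trans[OF row_len_antimono[OF D(1)]])
  have "\<exists>i. r i = 0"
  proof (rule ccontr)
    assume "\<nexists>i. r i = 0"
    then have "(Suc i, 1) \<in> D" for i
      using row_len_iff[OF D(1), of "Suc i" 1] by (simp add: r_def Suc_le_eq)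
    then have "range (\<lambda>i. (Suc i, 1)) \<subseteq> D"
      by auto
    then have "finite (range (\<lambda>i::nat. (Suc i, 1::nat)))"
      using finite_subset diagram_finite[OF D(1)] by blast
    then show False
      using range_inj_infinite[of "\<lambda>i::nat. (Suc i, 1::nat)"] by (simp add: inj_on_def)
  qed
  \<comment> \<open>The first empty row, counted from 0, is the number of nonempty rows, because row
    lengths decrease weakly.\<close>
  define p where "p = (LEAST i. r i = 0)"
  have "r p = 0"
    unfolding p_def using \<open>\<exists>i. r i = 0\<close> by (rule LeastI_ex)
  have less: "r i \<noteq> 0 \<longleftrightarrow> i < p" for i
    using not_less_Least[of i "\<lambda>i. r i = 0"] anti[of p i] \<open>r p = 0\<close>
    by (cases "i < p") (auto simp: p_def[symmetric])
  define lam where "lam = map r [0..<p]"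
  have "young_diagram lam = D"
  proof (intro Set.set_eqI)
    fix b :: "nat \<times> nat"
    obtain i j where b: "b = (i, j)"
      by fastforce
    show "b \<in> young_diagram lam \<longleftrightarrow> b \<in> D"
    proof (cases i)
      case 0
      then show ?thesis
        using diagram_pos[OF D(1), of i j] by (auto simp: b young_diagram_iff)
    next
      case (Suc k)
      have "k < p" if "1 \<le> j" "j \<le> r k"
        using less[of k] that by auto
      then show ?thesis
        unfolding b Suc young_diagram_iff row_len_iff[OF D(1)] r_def[symmetric] lam_def by auto
    qed
  qed
  moreover have "lam \<in> partitions n"
  proof -
    have "sorted_wrt (\<ge>) lam"
      using anti by (auto simp: sorted_wrt_iff_nth_less lam_def)
    moreover have "\<forall>x\<in>set lam. 0 < x"
      using less by (auto simp: lam_def)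
    moreover have "sum_list lam = n"
      using card_young_diagram[of lam] \<open>young_diagram lam = D\<close> D(2) by simp
    ultimately show ?thesis
      by (simp add: partitions_def)
  qed
  ultimately show "D \<in> young_diagram ` partitions n"
    by blast
next
  fix D assume "D \<in> young_diagram ` partitions n"
  then show "D \<in> diagrams n"
    using diagram_young_diagram card_young_diagram by (auto simp: diagrams_def partitions_def)
qed

lemma bij_young_diagram: "bij_betw young_diagram (partitions n) (diagrams n)"
  using inj_young_diagram young_diagram_image by (simp add: bij_betw_def)

text \<open>Position \<open>k\<close> holds the box with entry \<open>k + 1\<close>, since list
  positions start at 0.\<close>

definition entry_order :: "nat list \<Rightarrow> (nat \<times> nat \<Rightarrow> nat) \<Rightarrow> (nat \<times> nat) list" where
  "entry_order lam S = map (\<lambda>k. inv_into (young_diagram lam) S (Suc k)) [0..<sum_list lam]"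

section \<open>Standard tableaux and growth sequences\<close>

context
  fixes n lam
  assumes lam: "lam \<in> partitions n"
begin

lemma sum_lam: "sum_list lam = n"
  using lam by (simp add: partitions_def)

lemma standard_tableaux_bij:
  "S \<in> standard_tableaux lam \<Longrightarrow> bij_betw S (young_diagram lam) {1..n}"
  by (simp add: standard_tableaux_def sum_lam)

lemma entry_order_nth:
  assumes "S \<in> standard_tableaux lam" "k < n"
  shows "entry_order lam S ! k \<in> young_diagram lam" "S (entry_order lam S ! k) = Suc k"
proof -
  note bij = standard_tableaux_bij[OF assms(1)]
  have "Suc k \<in> S ` young_diagram lam"
    using bij assms(2) by (simp add: bij_betw_def)
  then show "entry_order lam S ! k \<in> young_diagram lam" "S (entry_order lam S ! k) = Suc k"
    using assms(2) by (simp_all add: entry_order_def sum_lam inv_into_into f_inv_into_f)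
qed

text \<open>The first \<open>k\<close> boxes are those with entries at most \<open>k\<close>. They
  form a diagram because entries increase along rows and down columns.\<close>

lemma entry_order_growths:
  assumes S: "S \<in> standard_tableaux lam"
  shows "entry_order lam S \<in> growths (young_diagram lam)"
proof -
  note bij = standard_tableaux_bij[OF S]
  note Y = diagram_young_diagram[OF lam]
  have len: "length (entry_order lam S) = n"
    by (simp add: entry_order_def sum_lam)
  have "distinct (entry_order lam S)"
    unfolding distinct_conv_nth len using entry_order_nth(2)[OF S] by (metis nat.inject)
  have prefix: "set (take k (entry_order lam S)) = {b \<in> young_diagram lam. S b \<le> k}" for k
  proof (intro Set.set_eqI iffI)
    fix b assume "b \<in> set (take k (entry_order lam S))"
    then obtain l where "l < k" "l < n" "b = entry_order lam S ! l"
      by (auto simp: in_set_conv_nth len)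
    then show "b \<in> {b \<in> young_diagram lam. S b \<le> k}"
      using entry_order_nth[OF S] by auto
  next
    fix b assume "b \<in> {b \<in> young_diagram lam. S b \<le> k}"
    then have b: "b \<in> young_diagram lam" "S b \<le> k" and Sb: "1 \<le> S b" "S b \<le> n"
      using bij by (auto simp: bij_betw_def)
    then have l: "S b - 1 < n" "S b - 1 < k" "S (entry_order lam S ! (S b - 1)) = S b"
      using entry_order_nth(2)[OF S, of "S b - 1"] by auto
    then have "entry_order lam S ! (S b - 1) = b"
      using bij b(1) entry_order_nth(1)[OF S l(1)] by (auto simp: bij_betw_def inj_on_def)
    then show "b \<in> set (take k (entry_order lam S))"
      using l len by (auto simp: in_set_conv_nth intro!: exI[of _ "S b - 1"])
  qed
  have "diagram {b \<in> young_diagram lam. S b \<le> k}" for k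
  proof -
    have "(i, j) \<in> {b \<in> young_diagram lam. S b \<le> k}"
      if "1 \<le> i" "(Suc i, j) \<in> {b \<in> young_diagram lam. S b \<le> k}" for i j
    proof -
      have "(i, j) \<in> young_diagram lam"
        using diagram_down[OF Y, of "Suc i" j i j] diagram_pos[OF Y, of "Suc i" j] that by auto
      moreover from this have "S (i, j) < S (Suc i, j)"
        using S that by (simp add: standard_tableaux_def)
      ultimately show ?thesis
        using that by simp
    qed
    moreover have "(i, j) \<in> {b \<in> young_diagram lam. S b \<le> k}"
      if "1 \<le> j" "(i, Suc j) \<in> {b \<in> young_diagram lam. S b \<le> k}" for i j
    proof -
      have "(i, j) \<in> young_diagram lam"
        using diagram_down[OF Y, of i "Suc j" i j] diagram_pos[OF Y, of i "Suc j"] that by auto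
      moreover from this have "S (i, j) < S (i, Suc j)"
        using S that by (simp add: standard_tableaux_def)
      ultimately show ?thesis
        using that by simp
    qed
    moreover have "1 \<le> i \<and> 1 \<le> j" if "(i, j) \<in> {b \<in> young_diagram lam. S b \<le> k}" for i j
      using diagram_pos[OF Y, of i j] that by blast
    moreover have "finite {b \<in> young_diagram lam. S b \<le> k}"
      by (simp add: finite_young_diagram)
    ultimately show ?thesis
      unfolding diagram_def by blast
  qed
  then have "growth (entry_order lam S)"
    unfolding growth_def prefix using \<open>distinct (entry_order lam S)\<close> by blast
  moreover have "set (entry_order lam S) = young_diagram lam"
    using prefix[of n] len bij by (auto simp: bij_betw_def)
  ultimately show ?thesis
    by (simp add: growths_def)
qed

lemma inj_entry_order: "inj_on (entry_order lam) (standard_tableaux lam)"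
proof (rule inj_onI)
  fix S S' assume S: "S \<in> standard_tableaux lam" and S': "S' \<in> standard_tableaux lam"
    and eq: "entry_order lam S = entry_order lam S'"
  show "S = S'"
  proof (rule extensionalityI)
    show "S \<in> extensional (young_diagram lam)" "S' \<in> extensional (young_diagram lam)"
      using S S' by (simp_all add: standard_tableaux_def)
    fix b assume "b \<in> young_diagram lam"
    then have "b \<in> set (entry_order lam S)"
      using entry_order_growths[OF S] by (simp add: growths_def)
    then obtain k where "k < n" "b = entry_order lam S ! k"
      by (auto simp: in_set_conv_nth entry_order_def sum_lam)
    then show "S b = S' b"
      using entry_order_nth(2)[OF S] entry_order_nth(2)[OF S'] eq by simp
  qed
qed

lemma entry_order_surj:
  assumes T: "T \<in> growths (young_diagram lam)"
  shows "T \<in> entry_order lam ` standard_tableaux lam"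
proof -
  let ?Y = "young_diagram lam"
  have T': "distinct T" "set T = ?Y" "\<And>k. diagram (set (take k T))"
    using T by (auto simp: growths_def growth_def)
  have len: "length T = n"
    using growths_length[OF T] by (simp add: card_young_diagram sum_lam)
  \<comment> \<open>The entry of a box is its position in \<open>T\<close> plus 1;
    \<open>restrict\<close> makes the filling extensional, as \<open>standard_tableaux\<close>
    demands.\<close>
  define S where "S = restrict (\<lambda>b. Suc (the_inv_into {..<n} ((!) T) b)) ?Y"
  have inj: "inj_on ((!) T) {..<n}" and bijT: "bij_betw ((!) T) {..<n} ?Y"
    using bij_betw_nth[OF T'(1)] T'(2) len by (auto simp: bij_betw_def)
  have S_nth: "S (T ! k) = Suc k" if "k < n" for k
    using that the_inv_into_f_f[OF inj, of k] nth_mem[of k T] T'(2) len by (simp add: S_def)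
  have nth: "\<exists>k<n. b = T ! k" if "b \<in> ?Y" for b
    using that T'(2) len by (metis in_set_conv_nth)
  have prefix: "b \<in> set (take (S c) T) \<longleftrightarrow> S b \<le> S c" if bc: "b \<in> ?Y" "c \<in> ?Y" for b c
  proof -
    obtain k l where kl: "k < n" "b = T ! k" "l < n" "c = T ! l"
      using nth bc by metis
    have "b \<in> set (take (Suc l) T) \<longleftrightarrow> k < Suc l"
      using kl T'(1) len by (auto simp: in_set_conv_nth nth_eq_iff_index_eq)
    then show ?thesis
      using kl by (simp add: S_nth less_Suc_eq_le)
  qed
  have mono: "S (i, j) < S (i', j')"
    if "(i, j) \<in> ?Y" "(i', j') \<in> ?Y" "i \<le> i'" "j \<le> j'" "(i, j) \<noteq> (i', j')" for i j i' j'
  proof -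
    have "(i', j') \<in> set (take (S (i', j')) T)"
      using prefix that(2) by blast
    \<comment> \<open>Every prefix of \<open>T\<close> is a diagram, so together with
      \<open>(i', j')\<close> it contains the boxes above and to the left.\<close>
    then have "(i, j) \<in> set (take (S (i', j')) T)"
      using diagram_down[OF T'(3)] that diagram_pos[OF diagram_young_diagram[OF lam] that(1)] by blast
    then have "S (i, j) \<le> S (i', j')"
      using prefix that by blast
    moreover have "S (i, j) \<noteq> S (i', j')"
    proof -
      from nth[OF that(1)] obtain k where k: "k < n" "(i, j) = T ! k"
        by blast
      from nth[OF \<open>(i', j') \<in> ?Y\<close>] obtain l where l: "l < n" "(i', j') = T ! l"
        by blast
      have "k \<noteq> l"
        using k l \<open>(i, j) \<noteq> (i', j')\<close> by metis
      then show ?thesis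
        using S_nth k l by simp
    qed
    ultimately show ?thesis
      by simp
  qed
  have "bij_betw S ?Y {1..n}"
  proof (rule bij_betw_byWitness[where f' = "\<lambda>k. T ! (k - 1)"])
    show "\<forall>b\<in>?Y. T ! (S b - 1) = b"
      using nth S_nth by fastforce
    show "\<forall>k\<in>{1..n}. S (T ! (k - 1)) = k"
      using S_nth by auto
    show "S ` ?Y \<subseteq> {1..n}"
      using nth S_nth by fastforce
    show "(\<lambda>k. T ! (k - 1)) ` {1..n} \<subseteq> ?Y"
      using nth_mem T'(2) len by force
  qed
  then have S: "S \<in> standard_tableaux lam"
    unfolding standard_tableaux_def sum_lam using mono by (auto simp: S_def)
  have "entry_order lam S = T"
  proof (rule nth_equalityI)
    show "length (entry_order lam S) = length T"
      by (simp add: entry_order_def sum_lam len)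
    fix k assume "k < length (entry_order lam S)"
    then have k: "k < n"
      by (simp add: entry_order_def sum_lam)
    obtain l where "l < n" "entry_order lam S ! k = T ! l"
      using nth[OF entry_order_nth(1)[OF S k]] by blast
    then show "entry_order lam S ! k = T ! k"
      using entry_order_nth(2)[OF S k] S_nth by simp
  qed
  then show ?thesis
    using S by blast
qed

lemma bij_entry_order:
  "bij_betw (entry_order lam) (standard_tableaux lam) (growths (young_diagram lam))"
  using inj_entry_order entry_order_growths entry_order_surj by (auto simp: bij_betw_def)

text \<open>The tableau itself is the change of summation index: each \<open>j\<close> in
  \<open>A\<close> is the entry of exactly one box.\<close>

lemma growth_eig_entry_order:
  assumes S: "S \<in> standard_tableaux lam" and A: "A \<subseteq> {1..n}"
  shows "growth_eig n A (entry_order lam S) = eig n A lam S"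
proof -
  note bij = standard_tableaux_bij[OF S]
  have "(\<Sum>j\<in>A. box_content (entry_order lam S ! (j - 1))) =
      (\<Sum>b\<in>{b \<in> young_diagram lam. S b \<in> A}. box_content b)"
  proof (rule sum.reindex_bij_witness[of _ S "\<lambda>j. entry_order lam S ! (j - 1)"])
    fix j assume j: "j \<in> A"
    then have "j \<in> {1..n}"
      using A by blast
    then have j1: "j - 1 < n" "Suc (j - 1) = j"
      by auto
    show "S (entry_order lam S ! (j - 1)) = j" "entry_order lam S ! (j - 1) \<in> {b \<in> young_diagram lam. S b \<in> A}"
      using entry_order_nth[OF S j1(1)] j j1(2) by auto
  next
    fix b assume b: "b \<in> {b \<in> young_diagram lam. S b \<in> A}"
    then have "S b \<in> {1..n}"
      using A by blast
    then have "S b - 1 < n" "Suc (S b - 1) = S b"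
      by auto
    then show "entry_order lam S ! (S b - 1) = b" "S b \<in> A"
      using entry_order_nth[OF S, of "S b - 1"] b bij by (auto simp: bij_betw_def inj_on_def)
  qed auto
  then show ?thesis
    by (simp add: growth_eig_def eig_def box_content_def case_prod_beta)
qed

end

theorem theorem1p1:
  fixes n :: nat and A :: "nat set" and xs :: "(nat \<Rightarrow> nat) list"
  assumes "2 \<le> n" and "A \<subseteq> {1..n}" and "n \<in> A"
    and "distinct xs" and "set xs = {p. p permutes {1..n}}"
  shows "char_poly (transition_mat n A xs) =
    (\<Prod>lam\<in>partitions n. \<Prod>S\<in>standard_tableaux lam.
       [:- eig n A lam S, 1:] ^ num_standard_tableaux lam)"
proof -
  let ?F = "\<lambda>T. [:- growth_eig n A T, 1:]"
  have "char_poly (transition_mat n A xs) = (\<Prod>p\<in>gpairs n. ?F (snd p))"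
    by (rule char_poly_transition_mat[OF assms(2,4,5)])
  also have "\<dots> = (\<Prod>D\<in>diagrams n. \<Prod>T\<in>growths D. ?F T ^ card (growths D))"
    by (rule prod_gpairs)
  also have "\<dots> = (\<Prod>lam\<in>partitions n. \<Prod>T\<in>growths (young_diagram lam).
      ?F T ^ card (growths (young_diagram lam)))"
    by (rule prod.reindex_bij_betw[OF bij_young_diagram, symmetric])
  also have "\<dots> = (\<Prod>lam\<in>partitions n. \<Prod>S\<in>standard_tableaux lam.
      [:- eig n A lam S, 1:] ^ num_standard_tableaux lam)"
  proof (rule prod.cong[OF refl])
    fix lam assume lam: "lam \<in> partitions n"
    note bij = bij_entry_order[OF lam]
    have "card (growths (young_diagram lam)) = num_standard_tableaux lam"
      using bij_betw_same_card[OF bij] by (simp add: num_standard_tableaux_def)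
    then have "(\<Prod>T\<in>growths (young_diagram lam). ?F T ^ card (growths (young_diagram lam))) =
        (\<Prod>S\<in>standard_tableaux lam. ?F (entry_order lam S) ^ num_standard_tableaux lam)"
      by (simp only: prod.reindex_bij_betw[OF bij, symmetric])
    also have "\<dots> = (\<Prod>S\<in>standard_tableaux lam. [:- eig n A lam S, 1:] ^ num_standard_tableaux lam)"
      by (intro prod.cong refl) (simp add: growth_eig_entry_order[OF lam _ assms(2)])
    finally show "(\<Prod>T\<in>growths (young_diagram lam). ?F T ^ card (growths (young_diagram lam))) =
        (\<Prod>S\<in>standard_tableaux lam. [:- eig n A lam S, 1:] ^ num_standard_tableaux lam)" .
  qed
  finally show ?thesis .
qed

end
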